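(* Let $p$ be a power of $2$ and let $S(x)=x^p+a_0x$ with $a_0\in\mathbb{F}_{p^2}$. (1) One has $H_S\subset\mathbb{F}_{p^4}^2$. (2) Assume $\mathrm{Tr}_{\mathbb{F}_p/\mathbb{F}_2}(a_0^{p+1})=1$. Then the curve $\overline{C}_S$ is $\mathbb{F}_{p^4}$-maximal.
   Context: $\mathbb{F}$ is an algebraic closure of $\mathbb{F}_p$. $C_S$ is the affine curve $y^p+y=xS(x)=x^{p+1}+a_0x^2$ and $\overline{C}_S$ is its smooth compactification. The Heisenberg group of $S$ has underlying set $H_S=\{(a,b)\in\mathbb{F}_{p^2}\times\mathbb{F}: b^p+b=a^{p+1}+a_0a^2\}$ and group law $(a,b)\cdot(a',b')=(a+a',b+b'+aa'^p)$. A smooth projective geometrically connected curve $C$ of genus $g$ over $\mathbb{F}_{p^4}$ is $\mathbb{F}_{p^4}$-maximal if $|C(\mathbb{F}_{p^4})|=p^4+1+2gp^2$. *)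

theory Defs
  imports "HOL-Algebra.Algebra" "HOL-Algebra.Algebraic_Closure_Type"
begin

text \<open>
  A smooth projective curve over a field \<open>k\<close> is encoded by its function field: \<open>k \<subseteq> K\<close> are
  subfields of an ambient field type, the closed points of the curve are the discrete valuation
  rings of \<open>K\<close> over \<open>k\<close> (the places), with the valuation rings as local rings. The smooth
  compactification of a smooth affine curve is the smooth projective curve with the same
  function field. Only finite fields \<open>k\<close> are used below; these are perfect, so that the regular
  curve formed by the places is smooth.
\<close>

definition places :: "'b::field set \<Rightarrow> 'b set \<Rightarrow> 'b set set" where
  "places k K = {V. subring V (ring_of_type_algebra :: 'b ring) \<and> k \<subset> V \<and> V \<subset> K \<and>
                    (\<forall>z\<in>K. z \<in> V \<or> inverse z \<in> V)}"

text \<open>The non-units of \<open>V\<close>. The first disjunct is needed because \<open>inverse 0 = 0\<close>.\<close>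

definition max_ideal :: "'b::field set \<Rightarrow> 'b set" where
  "max_ideal V = {z \<in> V. z = 0 \<or> inverse z \<notin> V}"

definition uniformizer :: "'b::field set \<Rightarrow> 'b \<Rightarrow> bool" where
  "uniformizer V t \<longleftrightarrow> max_ideal V = (\<lambda>u. t * u) ` V"

text \<open>The normalised valuation of a nonzero element; its value at \<open>0\<close> is never used.\<close>

definition place_val :: "'b::field set \<Rightarrow> 'b \<Rightarrow> int" where
  "place_val V z = (THE m. \<exists>t u. uniformizer V t \<and> u \<in> V - max_ideal V \<and> z = t powi m * u)"

definition residue_field :: "'b::field set \<Rightarrow> 'b set ring" where
  "residue_field V = (ring_of_type_algebra\<lparr>carrier := V\<rparr>) Quot (max_ideal V)"

definition place_degree :: "'b::field set \<Rightarrow> 'b set \<Rightarrow> nat" where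
  "place_degree k V =
     ring.dim (residue_field V)
       ((\<lambda>c. max_ideal V +>\<^bsub>ring_of_type_algebra\<lparr>carrier := V\<rparr>\<^esub> c) ` k)
       (carrier (residue_field V))"

definition divisors :: "'b::field set \<Rightarrow> 'b set \<Rightarrow> ('b set \<Rightarrow> int) set" where
  "divisors k K = {D. finite {V. D V \<noteq> 0} \<and> {V. D V \<noteq> 0} \<subseteq> places k K}"

definition divisor_degree :: "'b::field set \<Rightarrow> ('b set \<Rightarrow> int) \<Rightarrow> int" where
  "divisor_degree k D = (\<Sum>V | D V \<noteq> 0. D V * int (place_degree k V))"

definition riemann_roch_space :: "'b::field set \<Rightarrow> 'b set \<Rightarrow> ('b set \<Rightarrow> int) \<Rightarrow> 'b set" where
  "riemann_roch_space k K D =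
     {z \<in> K. z = 0 \<or> (\<forall>V\<in>places k K. place_val V z \<ge> - D V)}"

text \<open>
  The genus is the maximum of \<open>deg D - \<ell>(D) + 1\<close> over all divisors \<open>D\<close>; it exists by
  Riemann's theorem. It is stated as a relation, so that a genus claim includes the existence
  of the maximum.
\<close>

definition has_genus :: "'b::field set \<Rightarrow> 'b set \<Rightarrow> nat \<Rightarrow> bool" where
  "has_genus k K g \<longleftrightarrow>
     (let r = (\<lambda>D. divisor_degree k D
                     - int (ring.dim ring_of_type_algebra k (riemann_roch_space k K D)) + 1)
      in (\<exists>D\<in>divisors k K. r D = int g) \<and> (\<forall>D\<in>divisors k K. r D \<le> int g))"

text \<open>Rational points are the closed points with residue field \<open>k\<close>.\<close>

definition rational_places :: "'b::field set \<Rightarrow> 'b set \<Rightarrow> 'b set set" where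
  "rational_places k K = {V \<in> places k K. place_degree k V = 1}"


text \<open>The subfield with \<open>q\<close> elements of an algebraic closure of a finite field.\<close>

definition fin_subfield :: "nat \<Rightarrow> 'a::field set" where
  "fin_subfield q = {x. x ^ q = x}"

text \<open>
  A polynomial in \<open>k[X,Y]\<close> is an element of \<open>k[X][Y]\<close>: the outer variable is \<open>Y\<close>.
\<close>

definition polys_over :: "'a::field set \<Rightarrow> 'a poly poly set" where
  "polys_over k = {g. \<forall>i j. poly.coeff (poly.coeff g i) j \<in> k}"

text \<open>
  The algebraic closure of \<open>F(X)\<close>, with \<open>F\<close> the base type, is large enough to contain the
  function field of every irreducible plane curve over \<open>F\<close>.
\<close>

type_synonym 'a universal_field = "'a poly fract alg_closure"

definition const :: "'a::field \<Rightarrow> 'a universal_field" where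
  "const c = to_ac (Fract [:c:] 1)"

definition eval2 :: "'a::field poly poly \<Rightarrow> 'a universal_field \<Rightarrow> 'a universal_field \<Rightarrow> 'a universal_field"
  where "eval2 g x y = poly (map_poly (\<lambda>c. poly (map_poly const c) x) g) y"

text \<open>
  A generic point of \<open>f = 0\<close> over \<open>k\<close>: the kernel of evaluation at \<open>(x, y)\<close> on \<open>k[X,Y]\<close> is the
  ideal \<open>(f)\<close>, so \<open>k[x,y]\<close> is the coordinate ring \<open>k[X,Y]/(f)\<close> and \<open>k(x,y)\<close> is its field of
  fractions. Up to isomorphism over \<open>k\<close> the field does not depend on the choice of the generic
  point.
\<close>

definition generic_point ::
  "'a::field set \<Rightarrow> 'a poly poly \<Rightarrow> 'a universal_field \<times> 'a universal_field \<Rightarrow> bool" where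
  "generic_point k f P \<longleftrightarrow>
     (\<forall>g\<in>polys_over k. eval2 g (fst P) (snd P) = 0 \<longleftrightarrow> (\<exists>h\<in>polys_over k. g = f * h))"

definition function_field :: "'a::field set \<Rightarrow> 'a poly poly \<Rightarrow> 'a universal_field set" where
  "function_field k f =
     (let P = (SOME P. generic_point k f P)
      in generate_field ring_of_type_algebra (const ` k \<union> {fst P, snd P}))"

text \<open>
  The smooth compactification of the affine plane curve \<open>f = 0\<close> over the field with \<open>p\<^sup>4\<close>
  elements is maximal over that field. The base type is an algebraic closure of that field, so
  irreducibility of \<open>f\<close> says that the curve is geometrically irreducible; for the smooth
  compactification this is geometric connectedness.
\<close>

definition maximal_compactification :: "nat \<Rightarrow> 'a::field poly poly \<Rightarrow> bool" where
  "maximal_compactification p f \<longleftrightarrow>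
     f \<in> polys_over (fin_subfield (p ^ 4)) \<and>
     Factorial_Ring.irreducible f \<and>
     (let k = const ` fin_subfield (p ^ 4); K = function_field (fin_subfield (p ^ 4)) f
      in \<exists>g. has_genus k K g \<and> card (rational_places k K) = p ^ 4 + 1 + 2 * g * p ^ 2)"


definition S_poly :: "nat \<Rightarrow> 'a::field \<Rightarrow> 'a poly" where
  "S_poly p a0 = Polynomial.monom 1 p + Polynomial.monom a0 1"

text \<open>\<open>Y\<^sup>p + Y - X S(X)\<close>\<close>

definition curve_poly :: "nat \<Rightarrow> 'a::field poly \<Rightarrow> 'a poly poly" where
  "curve_poly p S =
     Polynomial.monom 1 p + Polynomial.monom 1 1 - [: Polynomial.monom 1 1 * S :]"

definition heisenberg :: "nat \<Rightarrow> 'a::field \<Rightarrow> ('a \<times> 'a) monoid" where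
  "heisenberg p a0 =
     \<lparr>carrier = {(a, b). a \<in> fin_subfield (p ^ 2) \<and> b ^ p + b = a ^ (p + 1) + a0 * a ^ 2},
      monoid.mult = (\<lambda>(a, b) (a', b'). (a + a', b + b' + a * a' ^ p)),
      one = (0, 0)\<rparr>"

text \<open>
  The trace from the field with \<open>2 ^ n\<close> elements to the prime field: the sum of the conjugates
  under the Frobenius \<open>x \<mapsto> x\<^sup>2\<close>.
\<close>

definition trace_to_F2 :: "nat \<Rightarrow> 'a::field \<Rightarrow> 'a" where
  "trace_to_F2 n x = (\<Sum>i<n. x ^ (2 ^ i))"

end

theory Submission
  imports Defs
begin

text \<open>
  Write \<open>q\<close> for \<open>p\<close>, \<open>k\<close> for the field with \<open>\<kappa> = q\<^sup>4\<close> elements and \<open>A = k[x, y]\<close>. Since \<open>k\<close> is finite, all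
  dimensions over \<open>k\<close> are read off from cardinalities.

  The ring \<open>A\<close> has the basis \<open>x\<^sup>i y\<^sup>j\<close>, \<open>j < q\<close>, over \<open>k\<close>, and the pole orders \<open>q i + (q + 1) j\<close> of these monomials
  at infinity are pairwise distinct. This makes the pole order a multiplicative function on \<open>A\<close>, proves
  the curve irreducible, shows that \<open>x / y\<close> is a uniformizer at the only place at infinity, and counts the
  functions in \<open>A\<close> of bounded pole order: they form a space of dimension \<open>m - q (q - 1) / 2\<close> when the order
  is \<open>< m\<close>, \<open>q\<close> divides \<open>m\<close> and \<open>m\<close> is large.

  The finite places are localisations of \<open>A\<close>. Put \<open>T\<^sub>N = x ^ (\<kappa> ^ N) - x\<close>. Every finite place is a zero of some
  \<open>T\<^sub>N\<close>, and modulo \<open>T\<^sub>N\<close> every element of \<open>A\<close> satisfies \<open>w ^ (\<kappa> ^ (2 N)) = w\<close>; so \<open>T\<^sub>N\<close> is a uniformizer at each of its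
  zeros. By the Chinese remainder theorem the zeros of \<open>T\<^sub>N\<close> have total degree at most \<open>q \<kappa>\<^sup>N\<close>, its pole order.
  Every divisor lies below some \<open>m \<infinity> + c (zeros of T\<^sub>N)\<close>, whose Riemann-Roch space is, up to the factor
  \<open>T\<^sub>N\<^sup>c\<close>, a space of functions in \<open>A\<close> of bounded pole order; hence the genus is \<open>q (q - 1) / 2\<close>.

  The rational places are infinity and the points \<open>(a, b)\<close> over \<open>k\<close>. By additive Hilbert 90 there are \<open>q\<close> values
  \<open>b\<close> for each \<open>a\<close> with \<open>Tr (a ^ (q + 1) + a\<^sub>0 a\<^sup>2) = 0\<close>. In terms of \<open>u = a + a ^ (q\<^sup>2)\<close> this trace is
  \<open>u ^ (q + 1) + a\<^sub>0 u\<^sup>2 + a\<^sub>0\<^sup>q u ^ (2 q)\<close>, a quadratic form on a plane over the field with \<open>q\<close> elements, and the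
  condition on \<open>a\<^sub>0\<close> says that it is hyperbolic, so that it has \<open>2 q - 1\<close> zeros.
\<close>

section \<open>Places and their valuations\<close>

text \<open>The genus is a maximum over all divisors, which would call for the Riemann-Roch theorem;
  counting takes its place. The quantity \<open>deg D - l(D)\<close> is monotone in
  \<open>D\<close>, so it need only be bounded on a cofinal family of divisors. An upper bound for
  the degree of the zeros of \<open>T N\<close> is enough for that, and the value of the maximum
  comes from a divisor supported at infinity.

  The family uses \<open>T N\<close> because \<open>y ^ q + y\<close> has derivative 1 in
  \<open>y\<close>: the curve is unramified over the affine line, so the simple zeros of
  \<open>x ^ (\<kappa> ^ N) - x\<close> on the line stay simple on the curve. Here this appears as
  an identity for Frobenius powers modulo \<open>T N\<close>, which also yields the inverses and the
  idempotents that the local rings and the Chinese remainder theorem require.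

  The zeros of the quadratic form give \<open>(2 q - 1) q^2\<close> admissible values of
  \<open>a\<close>, hence \<open>2 q^4 - q^3\<close> affine points. With the point at infinity this
  is \<open>q^4 + 1 + q (q - 1) q^2\<close>, the number that maximality demands for genus
  \<open>q (q - 1) / 2\<close>.\<close>

lemma type_ring_simps [simp]:
  "carrier (ring_of_type_algebra :: 'b::field ring) = UNIV"
  "x \<otimes>\<^bsub>(ring_of_type_algebra :: 'b ring)\<^esub> y = x * y"
  "x \<oplus>\<^bsub>(ring_of_type_algebra :: 'b ring)\<^esub> y = x + y"
  "\<one>\<^bsub>(ring_of_type_algebra :: 'b ring)\<^esub> = 1"
  "\<zero>\<^bsub>(ring_of_type_algebra :: 'b ring)\<^esub> = 0"
  by (simp_all add: ring_of_type_algebra_def)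

lemma type_ring_a_inv [simp]: "\<ominus>\<^bsub>(ring_of_type_algebra :: 'b::field ring)\<^esub> x = - x"
proof -
  interpret ring "ring_of_type_algebra :: 'b ring" by rule
  show ?thesis using minus_equality[of "- x" x] by simp
qed

lemma type_ring_m_inv [simp]:
  assumes "x \<noteq> 0"
  shows "inv\<^bsub>(ring_of_type_algebra :: 'b::field ring)\<^esub> x = inverse x"
proof -
  interpret cring "ring_of_type_algebra :: 'b ring" by rule
  show ?thesis using comm_inv_char[of x "inverse x"] assms by simp
qed

lemma type_ring_nat_pow [simp]:
  "x [^]\<^bsub>(ring_of_type_algebra :: 'b::field ring)\<^esub> (n :: nat) = x ^ n"
proof -
  interpret ring "ring_of_type_algebra :: 'b ring" by rule
  show ?thesis by (induction n) (simp_all add: mult.commute)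
qed

lemma subring_type_iff:
  "subring V (ring_of_type_algebra :: 'b::field ring) \<longleftrightarrow>
     1 \<in> V \<and> (\<forall>a\<in>V. \<forall>b\<in>V. a + b \<in> V \<and> a * b \<in> V) \<and> (\<forall>a\<in>V. - a \<in> V)"
proof -
  interpret ring "ring_of_type_algebra :: 'b ring" by rule
  show ?thesis
  proof
    assume "subring V (ring_of_type_algebra :: 'b ring)"
    from subringE[OF this]
    show "1 \<in> V \<and> (\<forall>a\<in>V. \<forall>b\<in>V. a + b \<in> V \<and> a * b \<in> V) \<and> (\<forall>a\<in>V. - a \<in> V)" by simp
  next
    assume "1 \<in> V \<and> (\<forall>a\<in>V. \<forall>b\<in>V. a + b \<in> V \<and> a * b \<in> V) \<and> (\<forall>a\<in>V. - a \<in> V)"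
    then show "subring V (ring_of_type_algebra :: 'b ring)"
      by (intro subringI) auto
  qed
qed

lemma subfield_typeI:
  assumes "subring V (ring_of_type_algebra :: 'b::field ring)" and "\<And>a. a \<in> V \<Longrightarrow> inverse a \<in> V"
  shows "subfield V (ring_of_type_algebra :: 'b ring)"
proof -
  interpret field "ring_of_type_algebra :: 'b ring" by rule
  show ?thesis using assms by (intro subfieldI') auto
qed

section \<open>Dimension over a finite field as a logarithm of cardinality\<close>

context ring
begin

text \<open>Each step of the inductive definition of \<open>dimension\<close> adjoins a vector
  \<open>v\<close> outside \<open>E\<close>. The map from \<open>(c, e)\<close> to
  \<open>c v + e\<close> is then injective, because a coincidence with different \<open>c\<close>
  would put \<open>v\<close> into \<open>E\<close>; so the cardinality is multiplied by
  \<open>card K\<close>.\<close>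

lemma card_dimension:
  assumes "dimension n K E" and "subfield K R" and "finite K"
  shows "finite E \<and> card E = card K ^ n"
  using assms
proof (induction n K E rule: dimension.induct)
  case (zero_dim K)
  then show ?case by simp
next
  case (Suc_dim v E n K)
  note sp = space_subgroup_props[OF Suc_dim.prems(1) Suc_dim.hyps(3)]
  note K = subringE[OF subfieldE(1)[OF Suc_dim.prems(1)]]
  define f where "f = (\<lambda>(c, e). c \<otimes> v \<oplus> e)"
  have eq: "line_extension K v E = f ` (K \<times> E)"
    unfolding f_def by (auto simp: line_extension_mem_iff image_iff) blast
  have "inj_on f (K \<times> E)"
  proof (rule inj_onI, clarify)
    fix c e c' e' assume c: "c \<in> K" "c' \<in> K" and e: "e \<in> E" "e' \<in> E" and ff: "f (c, e) = f (c', e')"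
    have carr: "c \<in> carrier R" "c' \<in> carrier R" "e \<in> carrier R" "e' \<in> carrier R"
      using c e K(1) sp(1) by auto
    have f': "c \<otimes> v \<oplus> e = c' \<otimes> v \<oplus> e'" using ff by (simp add: f_def)
    have "(c \<ominus> c') \<otimes> v = (c \<otimes> v \<oplus> e) \<ominus> c' \<otimes> v \<ominus> e"
      using carr Suc_dim.hyps(1) by algebra
    also have "\<dots> = e' \<ominus> e" unfolding f' using carr Suc_dim.hyps(1) by algebra
    also have "\<dots> \<in> E" using e sp(3,4) by (simp add: minus_eq)
    finally have "(c \<ominus> c') \<otimes> v \<in> E" .
    moreover have "c \<ominus> c' \<in> K" using c K by (simp add: minus_eq)
    ultimately have "c \<ominus> c' = \<zero>"
      using sp(6)[of "c \<ominus> c'" v] Suc_dim.hyps(1,2) by auto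
    hence "c = c'" using carr by (simp add: r_right_minus_eq)
    then show "c = c' \<and> e = e'" using f' carr Suc_dim.hyps(1) by simp
  qed
  then show ?case
    using Suc_dim.IH[OF Suc_dim.prems] Suc_dim.prems by (simp add: eq card_image)
qed

text \<open>Greedy choice of a basis: a subspace \<open>F\<close> of \<open>E\<close> is enlarged by
  a vector outside it until it fills \<open>E\<close>, and finiteness of \<open>E\<close> makes this
  stop. The value of \<open>dim\<close> is meaningful only once such a \<open>dimension\<close> fact
  exists.\<close>

lemma finite_subspace_dimension:
  assumes K: "subfield K R" and E: "finite E" "E \<subseteq> carrier R" "\<zero> \<in> E"
    and add: "\<And>a b. a \<in> E \<Longrightarrow> b \<in> E \<Longrightarrow> a \<oplus> b \<in> E"
    and smult: "\<And>c a. c \<in> K \<Longrightarrow> a \<in> E \<Longrightarrow> c \<otimes> a \<in> E"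
  shows "\<exists>n. dimension n K E"
proof -
  have "\<exists>n. dimension n K E" if "dimension m K F" "F \<subseteq> E" for m F
    using that
  proof (induction "card (E - F)" arbitrary: m F rule: less_induct)
    case less
    show ?case
    proof (cases "F = E")
      case True
      then show ?thesis using less.prems by blast
    next
      case False
      then obtain v where v: "v \<in> E" "v \<notin> F" using less.prems by blast
      let ?G = "line_extension K v F"
      have G: "dimension (Suc m) K ?G" using v E less.prems by (intro Suc_dim) auto
      have sub: "?G \<subseteq> E" using less.prems v add smult by (force simp: line_extension_mem_iff)
      have "F \<subseteq> ?G"
      proof
        fix u assume "u \<in> F"
        then have "u \<in> carrier R" using E(2) less.prems(2) by blast
        then have "u = \<zero> \<otimes> v \<oplus> u" using v E(2) by auto
        then show "u \<in> ?G"
          using \<open>u \<in> F\<close> subringE(2)[OF subfieldE(1)[OF K]] by (auto simp: line_extension_mem_iff)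
      qed
      moreover have "v \<in> ?G"
      proof -
        have "v = \<one> \<otimes> v \<oplus> \<zero>" using v E(2) by auto
        then show ?thesis
          using subringE(3)[OF subfieldE(1)[OF K]] space_subgroup_props(2)[OF K less.prems(1)]
          by (force simp: line_extension_mem_iff)
      qed
      ultimately have "E - ?G \<subset> E - F" using v by blast
      then have "card (E - ?G) < card (E - F)" using E(1) by (intro psubset_card_mono) auto
      then show ?thesis using less.hyps G sub by blast
    qed
  qed
  from this[OF zero_dim] E(3) show ?thesis by blast
qed

text \<open>The bridge between cardinalities and the dimensions that occur in place degrees and in
  the genus.\<close>

lemma card_eq_power_dim:
  assumes K: "subfield K R" "finite K" and E: "finite E" "E \<subseteq> carrier R" "\<zero> \<in> E"
    and add: "\<And>a b. a \<in> E \<Longrightarrow> b \<in> E \<Longrightarrow> a \<oplus> b \<in> E"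
    and smult: "\<And>c a. c \<in> K \<Longrightarrow> a \<in> E \<Longrightarrow> c \<otimes> a \<in> E"
  shows "card E = card K ^ dim K E"
proof -
  obtain n where n: "dimension n K E" using finite_subspace_dimension[OF K(1) E add smult] by blast
  have "dim K E = n" using dimI[OF K(1) n] by (simp add: over_def)
  then show ?thesis using card_dimension[OF n K] by simp
qed

end

text \<open>Every fibre of \<open>f\<close> over its image contains a translate of
  \<open>H\<close>.\<close>

lemma card_image_mult_le:
  fixes G H :: "'b::ab_group_add set"
  assumes "finite G" "\<And>g h. g \<in> G \<Longrightarrow> h \<in> H \<Longrightarrow> g + h \<in> G \<and> f (g + h) = f g"
  shows "card (f ` G) * card H \<le> card G"
proof -
  have "card (f ` G) * card H = (\<Sum>z\<in>f ` G. card H)" by simp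
  also have "\<dots> \<le> (\<Sum>z\<in>f ` G. card {g \<in> G. f g = z})"
  proof (rule sum_mono)
    fix z assume "z \<in> f ` G"
    then obtain g where g: "g \<in> G" "z = f g" by blast
    have "card H = card ((+) g ` H)" by (simp add: card_image)
    also have "\<dots> \<le> card {g' \<in> G. f g' = z}"
      using assms g by (intro card_mono) auto
    finally show "card H \<le> card {g \<in> G. f g = z}" .
  qed
  also have "\<dots> = card G"
    using sum.group[of G "f ` G" f "\<lambda>_. 1 :: nat"] assms(1) by simp
  finally show ?thesis .
qed

text \<open>The opposite estimate: every fibre of \<open>f\<close> lies in a translate of
  \<open>H\<close>.\<close>

lemma card_le_image_mult:
  fixes G H :: "'b::ab_group_add set"
  assumes "finite G" "finite H" "\<And>g h. g \<in> G \<Longrightarrow> h \<in> G \<Longrightarrow> f g = f h \<Longrightarrow> h - g \<in> H"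
  shows "card G \<le> card (f ` G) * card H"
proof -
  have "card G = (\<Sum>z\<in>f ` G. card {g \<in> G. f g = z})"
    using sum.group[of G "f ` G" f "\<lambda>_. 1 :: nat"] assms(1) by simp
  also have "\<dots> \<le> (\<Sum>z\<in>f ` G. card H)"
  proof (rule sum_mono)
    fix z assume "z \<in> f ` G"
    then obtain g where g: "g \<in> G" "z = f g" by blast
    show "card {g' \<in> G. f g' = z} \<le> card H"
      using assms g by (intro card_inj_on_le[of "\<lambda>g'. g' - g"]) (auto simp: inj_on_def)
  qed
  also have "\<dots> = card (f ` G) * card H" by simp
  finally show ?thesis .
qed

section \<open>Valuation rings and normalised valuations\<close>

locale subfield_pair =
  fixes k K :: "'b::field set"
  assumes k_one: "1 \<in> k" and k_add: "a \<in> k \<Longrightarrow> b \<in> k \<Longrightarrow> a + b \<in> k"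
    and k_mult: "a \<in> k \<Longrightarrow> b \<in> k \<Longrightarrow> a * b \<in> k" and k_uminus: "a \<in> k \<Longrightarrow> - a \<in> k"
    and k_inverse: "a \<in> k \<Longrightarrow> inverse a \<in> k"
    and K_add: "a \<in> K \<Longrightarrow> b \<in> K \<Longrightarrow> a + b \<in> K"
    and K_mult: "a \<in> K \<Longrightarrow> b \<in> K \<Longrightarrow> a * b \<in> K" and K_uminus: "a \<in> K \<Longrightarrow> - a \<in> K"
    and K_inverse: "a \<in> K \<Longrightarrow> inverse a \<in> K" and k_sub_K: "k \<subseteq> K"
    and finite_k: "finite k"
begin

lemma k_zero: "0 \<in> k"
  using k_add[OF k_one k_uminus[OF k_one]] by simp

lemma K_zero: "0 \<in> K" and K_one: "1 \<in> K"
  using k_zero k_one k_sub_K by auto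

lemma K_power: "a \<in> K \<Longrightarrow> a ^ n \<in> K"
  by (induction n) (auto intro: K_mult K_one)

lemma K_divide: "a \<in> K \<Longrightarrow> b \<in> K \<Longrightarrow> a / b \<in> K"
  by (simp add: field_class.field_divide_inverse K_mult K_inverse)

lemma K_powi: "a \<in> K \<Longrightarrow> a powi n \<in> K"
  by (cases "n \<ge> 0") (auto simp: power_int_def K_power K_inverse)

lemma subfield_k: "subfield k (ring_of_type_algebra :: 'b ring)"
  by (intro subfield_typeI) (auto simp: subring_type_iff k_one k_add k_mult k_uminus k_inverse)

lemma card_k_ge2: "card k \<ge> 2"
  using card_mono[OF finite_k, of "{0, 1}"] k_zero k_one by simp

end

locale place_of = subfield_pair +
  fixes V
  assumes V_place: "V \<in> places k K"
begin

abbreviation "M \<equiv> max_ideal V"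

lemma V_one: "1 \<in> V" and V_add: "a \<in> V \<Longrightarrow> b \<in> V \<Longrightarrow> a + b \<in> V"
  and V_mult: "a \<in> V \<Longrightarrow> b \<in> V \<Longrightarrow> a * b \<in> V" and V_uminus: "a \<in> V \<Longrightarrow> - a \<in> V"
  and k_psub_V: "k \<subset> V" and V_psub_K: "V \<subset> K"
  and V_cases: "z \<in> K \<Longrightarrow> z \<in> V \<or> inverse z \<in> V"
  using V_place by (auto simp: places_def subring_type_iff)

lemma k_V: "c \<in> k \<Longrightarrow> c \<in> V" and V_K: "z \<in> V \<Longrightarrow> z \<in> K"
  using k_psub_V V_psub_K by auto

lemma V_zero: "0 \<in> V"
  using k_V k_zero by simp

lemma V_power: "a \<in> V \<Longrightarrow> a ^ n \<in> V"
  by (induction n) (auto intro: V_mult V_one)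

lemma unit_iff: "u \<in> V - M \<longleftrightarrow> u \<noteq> 0 \<and> u \<in> V \<and> inverse u \<in> V"
  by (auto simp: max_ideal_def)

lemma unit_mult: "u \<in> V - M \<Longrightarrow> v \<in> V - M \<Longrightarrow> u * v \<in> V - M"
  unfolding unit_iff by (auto intro: V_mult)

lemma unit_inverse: "u \<in> V - M \<Longrightarrow> inverse u \<in> V - M"
  unfolding unit_iff by auto

lemma unit_power: "u \<in> V - M \<Longrightarrow> u ^ n \<in> V - M"
  unfolding unit_iff by (auto intro: V_power simp: power_inverse[symmetric])

lemma unit_powi: "u \<in> V - M \<Longrightarrow> u powi n \<in> V - M"
  by (cases "n \<ge> 0") (simp_all only: power_int_def if_True if_False unit_power unit_inverse)

lemma one_unit: "1 \<in> V - M"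
  unfolding unit_iff by (auto intro: V_one)

lemma M_V: "a \<in> M \<Longrightarrow> a \<in> V" and M_zero: "0 \<in> M" and one_notin_M: "1 \<notin> M"
  using one_unit V_zero by (auto simp: max_ideal_def)

lemma k_unit: "c \<in> k \<Longrightarrow> c \<noteq> 0 \<Longrightarrow> c \<in> V - M"
  unfolding unit_iff using k_V k_inverse by auto

lemma M_mult: assumes "a \<in> M" "v \<in> V" shows "a * v \<in> M"
proof (rule ccontr)
  assume *: "a * v \<notin> M"
  have "a * v \<in> V" using assms V_mult M_V by blast
  with * have "a * v \<noteq> 0" "inverse (a * v) \<in> V" by (auto simp: max_ideal_def)
  then have "a \<noteq> 0" "v * inverse (a * v) \<in> V" using V_mult assms by auto
  moreover have "v * inverse (a * v) = inverse a" using \<open>a * v \<noteq> 0\<close> by (simp add: field_simps)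
  ultimately have "inverse a \<in> V" by metis
  then show False using \<open>a \<noteq> 0\<close> assms by (auto simp: max_ideal_def)
qed

lemma M_mult': "a \<in> M \<Longrightarrow> v \<in> V \<Longrightarrow> v * a \<in> M"
  using M_mult by (simp add: mult.commute)

text \<open>Of two nonzero elements of a valuation ring one divides the other, so the sum is one of
  the summands times an element of \<open>V\<close>.\<close>

lemma M_add: assumes "a \<in> M" "b \<in> M" shows "a + b \<in> M"
proof -
  have aux: "a + b \<in> M" if "a \<in> M" "b \<in> M" "b \<noteq> 0" "a / b \<in> V" for a b
  proof -
    have "a + b = b * (a / b + 1)" using that by (simp add: field_simps)
    then show ?thesis using M_mult[OF that(2) V_add[OF that(4) V_one]] by simp
  qed
  consider "b = 0" | "a = 0" | "b \<noteq> 0" "a \<noteq> 0" by blast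
  then show ?thesis
  proof cases
    case 3
    have "a / b \<in> K" using assms M_V V_K K_divide by blast
    then consider "a / b \<in> V" | "b / a \<in> V" using V_cases[of "a / b"] 3 by (auto simp: field_simps)
    then show ?thesis using aux[of a b] aux[of b a] assms 3 by cases (simp_all add: add.commute)
  qed (use assms in auto)
qed

lemma M_uminus: "a \<in> M \<Longrightarrow> - a \<in> M"
  using M_mult[of a "- 1"] V_uminus[OF V_one] by simp

lemma M_diff: "a \<in> M \<Longrightarrow> b \<in> M \<Longrightarrow> a - b \<in> M"
  using M_add[OF _ M_uminus] by fastforce

lemma M_prime: "a \<in> V \<Longrightarrow> b \<in> V \<Longrightarrow> a * b \<in> M \<Longrightarrow> a \<in> M \<or> b \<in> M"
  using unit_mult by blast

lemma M_prime_power: "a \<in> V \<Longrightarrow> a ^ n \<in> M \<Longrightarrow> a \<in> M"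
  using unit_power by blast

lemma unit_add: assumes "u \<in> V - M" "a \<in> M" shows "u + a \<in> V - M"
proof -
  have "u + a \<in> V" using V_add M_V assms by blast
  moreover have "u + a \<notin> M" using M_diff[of "u + a" a] assms by auto
  ultimately show ?thesis by blast
qed

lemma uniformizer_in: "uniformizer V t \<Longrightarrow> t \<in> M"
  using imageI[OF V_one, of "(*) t"] by (simp add: uniformizer_def)

lemma M_nontrivial: "\<exists>a\<in>M. a \<noteq> 0"
proof -
  obtain z where z: "z \<in> K" "z \<notin> V" using V_psub_K by blast
  then have "inverse z \<in> V" "z \<noteq> 0" using V_cases V_zero by auto
  with z have "inverse z \<in> M" "inverse z \<noteq> 0" by (auto simp: max_ideal_def)
  then show ?thesis by blast
qed

lemma uniformizer_nonzero: "uniformizer V t \<Longrightarrow> t \<noteq> 0"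
  using M_nontrivial by (auto simp: uniformizer_def)

lemma uniformizer_unique:
  assumes "uniformizer V t" "uniformizer V t'"
  shows "\<exists>u\<in>V - M. t' = t * u"
proof -
  obtain u where u: "u \<in> V" "t' = t * u"
    using uniformizer_in[OF assms(2)] assms(1) by (auto simp: uniformizer_def)
  obtain v where v: "v \<in> V" "t = t' * v"
    using uniformizer_in[OF assms(1)] assms(2) by (auto simp: uniformizer_def)
  have "t = t * (u * v)" using u(2) v(2) by (metis mult.assoc)
  then have "u * v = 1" using uniformizer_nonzero[OF assms(1)] by simp
  then have "inverse u = v" "u \<noteq> 0" by (auto intro: inverse_unique)
  then have "u \<in> V - M" unfolding unit_iff using u(1) v(1) by simp
  then show ?thesis using u by blast
qed

lemma powi_unit_imp_zero:
  assumes "uniformizer V t" "t powi n \<in> V - M"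
  shows "n = 0"
proof -
  have "False" if "n > 0" "t powi n \<in> V - M" for n
  proof -
    obtain m where "n = int (Suc m)" using \<open>n > 0\<close> by (metis Suc_pred zero_less_imp_eq_int)
    then have "t powi n = t * t ^ m" by (simp only: power_int_of_nat power_Suc)
    then show False
      using that M_mult[OF uniformizer_in[OF assms(1)], of "t ^ m"] V_power M_V
        uniformizer_in[OF assms(1)] by auto
  qed
  from this[of n] this[of "- n"] assms(2) unit_inverse[OF assms(2)]
  show ?thesis by (auto simp: power_int_minus not_less_iff_gr_or_eq intro: linorder_cases[of n 0])
qed

text \<open>The definite description in \<open>place_val\<close> ranges over all uniformizers, so
  uniqueness has to compare two of them. They differ by a unit, and a power of \<open>t\<close> is a
  unit only for the exponent 0.\<close>

lemma place_val_eq: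
  assumes t: "uniformizer V t" and u: "u \<in> V - M"
  shows "place_val V (t powi n * u) = n"
  unfolding place_val_def
proof (rule the_equality)
  show "\<exists>t' u'. uniformizer V t' \<and> u' \<in> V - M \<and> t powi n * u = t' powi n * u'"
    using assms by blast
next
  fix m assume "\<exists>t' u'. uniformizer V t' \<and> u' \<in> V - M \<and> t powi n * u = t' powi m * u'"
  then obtain t' u' where t': "uniformizer V t'" and u': "u' \<in> V - M"
    and eq: "t powi n * u = t' powi m * u'" by blast
  obtain v where v: "v \<in> V - M" "t' = t * v" using uniformizer_unique[OF t t'] by blast
  have t0: "t \<noteq> 0" by (rule uniformizer_nonzero[OF t])
  have u0: "u \<noteq> 0" using u unit_iff by blast
  have "t powi (n - m) = v powi m * u' * inverse u"
    using eq t0 u0 unfolding v(2) by (simp add: power_int_diff power_int_mult_distrib field_simps)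
  also have "\<dots> \<in> V - M" using u u' v by (intro unit_mult unit_powi unit_inverse)
  finally have "t powi (n - m) \<in> V - M" .
  from powi_unit_imp_zero[OF t this] show "m = n" by simp
qed

end

text \<open>Membership in \<open>places\<close> asks for a valuation ring only. That every such ring
  is discrete is a theorem about the curve, proved separately for finite places and for the pole;
  this locale collects what follows from it.\<close>

locale discrete_place = place_of +
  fixes t
  assumes unif: "uniformizer V t"
    and decomp: "z \<in> K \<Longrightarrow> z \<noteq> 0 \<Longrightarrow> \<exists>n u. u \<in> V - max_ideal V \<and> z = t powi n * u"
begin

lemma t_M: "t \<in> M" and t_nz: "t \<noteq> 0" and t_K: "t \<in> K"
  using uniformizer_in uniformizer_nonzero unif M_V V_K by auto

lemma val_decomp:
  assumes "z \<in> K" "z \<noteq> 0"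
  obtains u where "u \<in> V - M" "z = t powi place_val V z * u"
  using decomp[OF assms] place_val_eq[OF unif] by auto

lemma val_mult:
  assumes "z \<in> K" "z \<noteq> 0" "w \<in> K" "w \<noteq> 0"
  shows "place_val V (z * w) = place_val V z + place_val V w"
proof -
  obtain u where u: "u \<in> V - M" "z = t powi place_val V z * u" by (rule val_decomp[OF assms(1,2)])
  obtain v where v: "v \<in> V - M" "w = t powi place_val V w * v" by (rule val_decomp[OF assms(3,4)])
  have "z * w = (t powi place_val V z * u) * (t powi place_val V w * v)" using u(2) v(2) by simp
  also have "\<dots> = t powi (place_val V z + place_val V w) * (u * v)"
    using t_nz by (simp add: power_int_add mult_ac)
  finally show ?thesis using place_val_eq[OF unif unit_mult[OF u(1) v(1)]] by simp
qed

lemma val_unit: "u \<in> V - M \<Longrightarrow> place_val V u = 0"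
  using place_val_eq[OF unif, of u 0] by simp

lemma val_powi_t: "place_val V (t powi n) = n"
  using place_val_eq[OF unif one_unit, of n] by simp

lemma val_nonneg_iff:
  assumes "z \<in> K" "z \<noteq> 0"
  shows "place_val V z \<ge> 0 \<longleftrightarrow> z \<in> V"
proof -
  have pos: "t powi n * u \<in> V" if "n \<ge> 0" "u \<in> V - M" for n u
    using that t_M M_V V_power V_mult by (auto simp: power_int_def)
  obtain u where u: "u \<in> V - M" "z = t powi place_val V z * u" by (rule val_decomp[OF assms])
  show ?thesis
  proof
    assume "z \<in> V"
    show "place_val V z \<ge> 0"
    proof (rule ccontr)
      assume neg: "\<not> place_val V z \<ge> 0"
      have "inverse z = t powi (- place_val V z) * inverse u"
        using u(2) by (metis inverse_mult_distrib power_int_minus)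
      then have "inverse z \<in> V" using pos[of "- place_val V z" "inverse u"] neg unit_inverse[OF u(1)] by simp
      then have "z \<in> V - M" using assms \<open>z \<in> V\<close> unit_iff by blast
      then show False using val_unit neg by simp
    qed
  qed (use pos[of _ u] u in metis)
qed

lemma val_ge_iff:
  assumes "z \<in> K" "z \<noteq> 0"
  shows "place_val V z \<ge> n \<longleftrightarrow> z * t powi (- n) \<in> V"
proof -
  have "place_val V (z * t powi (- n)) = place_val V z - n"
    using val_mult[OF assms, of "t powi (- n)"] t_nz K_powi[OF t_K] val_powi_t by simp
  then show ?thesis
    using val_nonneg_iff[of "z * t powi (- n)"] assms t_nz K_powi[OF t_K] K_mult by auto
qed

text \<open>The value of \<open>place_val\<close> at 0 is arbitrary, hence the extra disjunct. The
  right side is linear in \<open>z\<close>, which makes closure properties of Riemann-Roch spaces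
  visible.\<close>

lemma val_ge_iff0:
  assumes "z \<in> K"
  shows "z = 0 \<or> place_val V z \<ge> n \<longleftrightarrow> z * t powi (- n) \<in> V"
  using val_ge_iff[of z n] assms V_zero by (cases "z = 0") auto

text \<open>Raising the valuation bound by one means that the leading residue vanishes;
  \<open>RR_step\<close> uses it in this form.\<close>

lemma val_Suc_iff0:
  assumes "z \<in> K"
  shows "z = 0 \<or> place_val V z \<ge> n + 1 \<longleftrightarrow> z * t powi (- n) \<in> M"
proof -
  have eq: "z * t powi (- n) = t * (z * t powi (- (n + 1)))"
    using t_nz by (simp add: power_int_add power_int_minus power_int_diff field_simps)
  show ?thesis unfolding val_ge_iff0[OF assms]
  proof
    assume "z * t powi (- (n + 1)) \<in> V"
    then show "z * t powi (- n) \<in> M" unfolding eq by (rule M_mult[OF t_M])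
  next
    assume "z * t powi (- n) \<in> M"
    then obtain v where "v \<in> V" "z * t powi (- n) = t * v" using unif by (auto simp: uniformizer_def)
    then show "z * t powi (- (n + 1)) \<in> V" using t_nz unfolding eq by simp
  qed
qed

end

section \<open>The coordinate ring of the curve\<close>

lemma sum_diff_lessThan:
  fixes B r :: nat
  assumes "r \<le> B"
  shows "(\<Sum>j<r. B - j) + r * (r - 1) div 2 = r * B"
  using assms
proof (induction r)
  case (Suc r)

  have "Suc r * (Suc r - 1) = r * (r - 1) + 2 * r" by (cases r) (simp_all add: algebra_simps)
  then have "Suc r * (Suc r - 1) div 2 = r * (r - 1) div 2 + r" by simp
  then show ?case using Suc by simp
qed simp

text \<open>Since \<open>q + 1\<close> is 1 modulo \<open>q\<close>, the residue of the weight
  modulo \<open>q\<close> is \<open>j\<close>.\<close>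

lemma weights_unique:
  fixes q :: nat
  assumes "j < q" "j' < q" "q * i + (q + 1) * j = q * i' + (q + 1) * j'"
  shows "i = i' \<and> j = j'"
proof -
  have mod: "(q * i + (q + 1) * j) mod q = j" if "j < q" for i j
  proof -
    have "q * i + (q + 1) * j = j + q * (i + j)" by (simp add: algebra_simps)
    then have "(q * i + (q + 1) * j) mod q = (j + q * (i + j)) mod q" by (rule arg_cong)
    then show ?thesis using that by simp
  qed
  have "j = j'" using mod[OF assms(1), of i] mod[OF assms(2), of i'] unfolding assms(3) by metis
  then show ?thesis using assms by simp
qed

lemma char2_add_self: "CHAR('a::ring_1) = 2 \<Longrightarrow> (a :: 'a) + a = 0"
  by (metis minus_CHAR_2 diff_self)

lemma char2_add_eq_0_iff: "CHAR('a::ring_1) = 2 \<Longrightarrow> (a :: 'a) + b = 0 \<longleftrightarrow> a = b"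
  by (metis minus_CHAR_2 right_minus_eq)

lemma char2_frobenius_add:
  "CHAR('a::comm_ring_1) = 2 \<Longrightarrow> ((a :: 'a) + b) ^ (2 ^ m) = a ^ (2 ^ m) + b ^ (2 ^ m)"
  using freshmans_dream'[of "2 ^ m" m a b] by simp

text \<open>
  \<open>A\<close> is the coordinate ring \<open>k[x, y]\<close> and \<open>wt\<close> the pole order at infinity of its nonzero elements. By the
  assumption \<open>leading\<close>, \<open>A\<close> is spanned by the monomials with \<open>j < q\<close>. Since the characteristic is \<open>2\<close>,
  signs are suppressed throughout.
\<close>

locale curve =
  fixes k A :: "'b::field set" and x y a0 :: 'b and n q :: nat and wt :: "'b \<Rightarrow> nat"
  assumes char2: "CHAR('b) = 2" and n_pos: "n \<ge> 1" and q_eq: "q = 2 ^ n"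
    and k1: "1 \<in> k" and kadd: "\<And>a b. a \<in> k \<Longrightarrow> b \<in> k \<Longrightarrow> a + b \<in> k"
    and kmult: "\<And>a b. a \<in> k \<Longrightarrow> b \<in> k \<Longrightarrow> a * b \<in> k"
    and kinv: "\<And>a. a \<in> k \<Longrightarrow> inverse a \<in> k"
    and card_k: "card k = q ^ 4" and k_frob: "\<And>c. c \<in> k \<Longrightarrow> c ^ (q ^ 4) = c"
    and k_A: "k \<subseteq> A" and x_A: "x \<in> A" and y_A: "y \<in> A"
    and A_add: "\<And>g h. g \<in> A \<Longrightarrow> h \<in> A \<Longrightarrow> g + h \<in> A"
    and A_mult: "\<And>g h. g \<in> A \<Longrightarrow> h \<in> A \<Longrightarrow> g * h \<in> A"
    and a0_k: "a0 \<in> k" and curve_eq: "y ^ q + y = x ^ (q + 1) + a0 * x ^ 2"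
    and wt_mult: "\<And>g h. g \<in> A \<Longrightarrow> h \<in> A \<Longrightarrow> g \<noteq> 0 \<Longrightarrow> h \<noteq> 0 \<Longrightarrow> wt (g * h) = wt g + wt h"
    and wt_add: "\<And>g h. g \<in> A \<Longrightarrow> h \<in> A \<Longrightarrow> g \<noteq> 0 \<Longrightarrow> h \<noteq> 0 \<Longrightarrow> g + h \<noteq> 0 \<Longrightarrow>
                   wt (g + h) \<le> max (wt g) (wt h)"
    and x_nz: "x \<noteq> 0" and y_nz: "y \<noteq> 0" and wt_x: "wt x = q" and wt_y: "wt y = q + 1"
    and leading: "\<And>w. w \<in> A \<Longrightarrow> w \<noteq> 0 \<Longrightarrow> \<exists>c\<in>k. \<exists>i j. c \<noteq> 0 \<and> j < q \<and> wt w = q * i + (q + 1) * j \<and>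
                   (w + c * x ^ i * y ^ j = 0 \<or> wt (w + c * x ^ i * y ^ j) < wt w)"
    and evaluation: "\<And>a b. a \<in> k \<Longrightarrow> b \<in> k \<Longrightarrow> b ^ q + b = a ^ (q + 1) + a0 * a ^ 2 \<Longrightarrow>
                   \<exists>e. (\<forall>c\<in>k. e c = c) \<and> e x = a \<and> e y = b \<and>
                       (\<forall>g\<in>A. e g \<in> k \<and> (\<forall>h\<in>A. e (g + h) = e g + e h \<and> e (g * h) = e g * e h))"
begin

text \<open>The denominator 0 does no harm, as the quotient is then 0; \<open>K_E\<close> restores a
  nonzero denominator.\<close>

definition K :: "'b set" where "K = {g / h | g h. g \<in> A \<and> h \<in> A}"

definition "\<kappa> = q ^ 4"

abbreviation "genus \<equiv> q * (q - 1) div 2"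

lemmas add_self [simp] = char2_add_self[OF char2] and add_eq_0_char2 = char2_add_eq_0_iff[OF char2]
  and frob_add = char2_frobenius_add[OF char2]
  and minus_eq_plus = minus_CHAR_2[OF char2] and uminus_id = uminus_CHAR_2[OF char2]

lemma add_self_left [simp]: "(a :: 'b) + (a + b) = b"
  by (simp flip: add.assoc)

lemma q_ge2: "q \<ge> 2" and q_pos: "q > 0"
  using n_pos self_le_power[of "2::nat" n] q_eq by auto

lemma kappa_ge2: "\<kappa> \<ge> 2"
  using power_mono[OF q_ge2, of 4] by (auto simp: \<kappa>_def)

lemma q_add: "((a :: 'b) + b) ^ (q ^ e) = a ^ (q ^ e) + b ^ (q ^ e)"
  using frob_add[of a b "n * e"] by (simp add: q_eq power_mult)

lemma kappa_add: "((a :: 'b) + b) ^ (\<kappa> ^ e) = a ^ (\<kappa> ^ e) + b ^ (\<kappa> ^ e)"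
  using q_add[of a b "4 * e"] by (simp add: power_mult \<kappa>_def)

lemma A_0: "0 \<in> A" and A_1: "1 \<in> A"
  using A_add[of 1 1] k1 k_A by auto

lemma A_power: "a \<in> A \<Longrightarrow> a ^ e \<in> A"
  by (induction e) (auto intro: A_mult A_1)

lemma A_sum: "(\<And>i. i \<in> I \<Longrightarrow> f i \<in> A) \<Longrightarrow> sum f I \<in> A"
  by (induction I rule: infinite_finite_induct) (auto intro: A_0 A_add)

lemma A_prod: "(\<And>i. i \<in> I \<Longrightarrow> f i \<in> A) \<Longrightarrow> prod f I \<in> A"
  by (induction I rule: infinite_finite_induct) (auto intro: A_1 A_mult)

lemma A_K: "g \<in> A \<Longrightarrow> g \<in> K"
  unfolding K_def using A_1 by force

lemma K_I: "g \<in> A \<Longrightarrow> h \<in> A \<Longrightarrow> g / h \<in> K"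
  unfolding K_def by blast

lemma K_E:
  assumes "z \<in> K" obtains g h where "g \<in> A" "h \<in> A" "h \<noteq> 0" "z = g / h"
proof -
  obtain g h where gh: "g \<in> A" "h \<in> A" "z = g / h" using assms unfolding K_def by blast
  show ?thesis using that[of g h] that[of 0 1] gh A_0 A_1 by (cases "h = 0") auto
qed

sublocale subfield_pair k K
proof
  show "a + b \<in> K" if ab: "a \<in> K" "b \<in> K" for a b
  proof -
    obtain g h where 1: "g \<in> A" "h \<in> A" "h \<noteq> 0" "a = g / h" by (rule K_E[OF ab(1)])
    obtain g' h' where 2: "g' \<in> A" "h' \<in> A" "h' \<noteq> 0" "b = g' / h'" by (rule K_E[OF ab(2)])
    have "a + b = (g * h' + g' * h) / (h * h')" using 1 2 by (simp add: field_simps)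
    then show ?thesis using 1 2 by (auto intro: K_I A_add A_mult)
  qed
  show "a * b \<in> K" if ab: "a \<in> K" "b \<in> K" for a b
  proof -
    obtain g h where 1: "g \<in> A" "h \<in> A" "h \<noteq> 0" "a = g / h" by (rule K_E[OF ab(1)])
    obtain g' h' where 2: "g' \<in> A" "h' \<in> A" "h' \<noteq> 0" "b = g' / h'" by (rule K_E[OF ab(2)])
    have "a * b = (g * g') / (h * h')" using 1 2 by simp
    then show ?thesis using 1 2 by (auto intro: K_I A_add A_mult)
  qed
  show "inverse a \<in> K" if ab: "a \<in> K" for a
  proof -
    obtain g h where 1: "g \<in> A" "h \<in> A" "h \<noteq> 0" "a = g / h" by (rule K_E[OF ab])
    then have "inverse a = h / g" by simp
    then show ?thesis using 1 by (auto intro: K_I)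
  qed
  show "finite k" using card_k q_pos card.infinite by fastforce
  show "k \<subseteq> K" using k_A A_K by blast
qed (use k1 kadd kmult kinv in \<open>auto simp: uminus_id\<close>)

lemma wt_1: "wt 1 = 0"
  using wt_mult[of 1 1] A_1 by simp

lemma wt_const: "c \<in> k \<Longrightarrow> c \<noteq> 0 \<Longrightarrow> wt c = 0"
  using wt_mult[of c "inverse c"] k_A kinv wt_1 by (auto simp: subset_iff)

lemma wt_power: "a \<in> A \<Longrightarrow> a \<noteq> 0 \<Longrightarrow> wt (a ^ e) = e * wt a"
  by (induction e) (auto simp: wt_1 wt_mult A_power)

lemma mono_A: "c \<in> k \<Longrightarrow> c * x ^ i * y ^ j \<in> A"
  using k_A x_A y_A by (intro A_mult A_power) auto

lemma wt_mono: "c \<in> k \<Longrightarrow> c \<noteq> 0 \<Longrightarrow> wt (c * x ^ i * y ^ j) = q * i + (q + 1) * j"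
  using k_A x_A y_A x_nz y_nz wt_x wt_y
  by (subst wt_mult, auto intro: A_mult A_power simp: subset_iff)
     (subst wt_mult, auto intro: A_mult A_power simp: wt_const wt_power subset_iff)

text \<open>The equality case of the ultrametric inequality: in characteristic 2, \<open>h\<close>
  is \<open>g + (g + h)\<close>, so \<open>g + h\<close> cannot have smaller weight than
  \<open>h\<close>.\<close>

lemma wt_add_less:
  assumes "g \<in> A" "h \<in> A" "h \<noteq> 0" "g = 0 \<or> wt g < wt h"
  shows "g + h \<noteq> 0 \<and> wt (g + h) = wt h"
proof (cases "g = 0")
  case False
  then have less: "wt g < wt h" using assms by simp
  have nz: "g + h \<noteq> 0" using less by (auto simp: add_eq_0_char2)
  have "wt (g + h) \<le> wt h" using wt_add[OF assms(1,2) False assms(3) nz] less by simp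
  moreover have "wt (g + (g + h)) \<le> max (wt g) (wt (g + h))"
    using assms nz False by (intro wt_add) (auto intro: A_add)
  then have "wt h \<le> max (wt g) (wt (g + h))" by simp
  ultimately show ?thesis using nz less by simp
qed (use assms in simp)

text \<open>Cancelling the leading monomial lowers the weight, a natural number, so finitely many
  cancellations exhaust \<open>w\<close>.\<close>

lemma A_induct [consumes 1, case_names mono add]:
  assumes "w \<in> A" and mono: "\<And>c i j. c \<in> k \<Longrightarrow> P (c * x ^ i * y ^ j)"
    and add: "\<And>u v. u \<in> A \<Longrightarrow> v \<in> A \<Longrightarrow> P u \<Longrightarrow> P v \<Longrightarrow> P (u + v)"
  shows "P w"
  using assms(1)
proof (induction "wt w" arbitrary: w rule: less_induct)
  case less
  show ?case
  proof (cases "w = 0")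
    case True
    then show ?thesis using mono[OF k_zero, of 0 0] by simp
  next
    case False
    obtain c i j where c: "c \<in> k" "w + c * x ^ i * y ^ j = 0 \<or> wt (w + c * x ^ i * y ^ j) < wt w"
      using leading[OF less.prems False] by blast
    let ?m = "c * x ^ i * y ^ j"
    from c(2) show ?thesis
    proof
      assume "w + ?m = 0"
      then show ?thesis using mono[OF c(1)] by (simp add: add_eq_0_char2)
    next
      assume "wt (w + ?m) < wt w"
      then have "P (w + ?m)" using less mono_A[OF c(1)] A_add by blast
      then have "P (?m + (w + ?m))" using mono_A[OF c(1)] A_add less.prems mono[OF c(1)] add by blast
      moreover have "?m + (w + ?m) = w" by (simp add: add.left_commute)
      ultimately show ?thesis by simp
    qed
  qed
qed

text \<open>The strict bound makes \<open>L (q * B)\<close> the space of all \<open>\<Sum>j<q. w\<^sub>j(x) y\<^sup>j\<close> with \<open>deg w\<^sub>j < B - j\<close>.\<close>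

definition L :: "nat \<Rightarrow> 'b set" where "L m = {w \<in> A. w = 0 \<or> wt w < m}"

lemma L_add: "g \<in> L m \<Longrightarrow> h \<in> L m \<Longrightarrow> g + h \<in> L m"
  unfolding L_def using wt_add[of g h]
  by (cases "g = 0"; cases "h = 0"; cases "g + h = 0") (auto intro: A_add A_0)

lemma L_mono: "m \<le> m' \<Longrightarrow> L m \<subseteq> L m'"
  unfolding L_def by auto

definition is_weight :: "nat \<Rightarrow> bool" where
  "is_weight m \<longleftrightarrow> (\<exists>i j. j < q \<and> m = q * i + (q + 1) * j)"

text \<open>A weight belongs to exactly one monomial with \<open>j < q\<close>. Passing from the
  bound \<open>m\<close> to \<open>Suc m\<close> therefore adds one free coefficient in
  \<open>k\<close> if \<open>m\<close> is a weight, and nothing otherwise.\<close>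

lemma L_card_aux: "finite (L m) \<and> card (L m) = \<kappa> ^ card {l. l < m \<and> is_weight l}"
proof (induction m)
  case 0
  have "L 0 = {0}" unfolding L_def using A_0 by auto
  then show ?case by simp
next
  case (Suc m)
  show ?case
  proof (cases "is_weight m")
    case False
    have "L (Suc m) = L m" unfolding L_def
      using leading False by (fastforce simp: less_Suc_eq is_weight_def)
    moreover have "{l. l < Suc m \<and> is_weight l} = {l. l < m \<and> is_weight l}"
      using False by (auto simp: less_Suc_eq)
    ultimately show ?thesis using Suc by simp
  next
    case True
    then obtain i j where ij: "j < q" "m = q * i + (q + 1) * j" by (auto simp: is_weight_def)
    let ?u = "\<lambda>c. c * x ^ i * y ^ j"
    define f where "f = (\<lambda>(c, w). ?u c + w)"
    have wtu: "wt (?u c) = m" if "c \<in> k" "c \<noteq> 0" for c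
      using wt_mono[OF that] ij by simp
    have "L (Suc m) = f ` (k \<times> L m)"
    proof (intro equalityI subsetI)
      fix w assume w: "w \<in> L (Suc m)"
      show "w \<in> f ` (k \<times> L m)"
      proof (cases "w \<in> L m")
        case True
        then show ?thesis unfolding f_def using k_zero by (auto intro!: image_eqI[of _ _ "(0, w)"])
      next
        case False
        then have w': "w \<in> A" "w \<noteq> 0" "wt w = m" using w by (auto simp: L_def)
        obtain c i' j' where c: "c \<in> k" "j' < q" "wt w = q * i' + (q + 1) * j'"
          "w + c * x ^ i' * y ^ j' = 0 \<or> wt (w + c * x ^ i' * y ^ j') < wt w"
          using leading[OF w'(1,2)] by blast
        have "i' = i \<and> j' = j" using c w' ij by (intro weights_unique) auto
        then have "w + ?u c \<in> L m" using c w' mono_A[OF c(1)] by (auto simp: L_def intro: A_add)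
        moreover have "w = ?u c + (w + ?u c)" by (simp add: add.left_commute)
        ultimately show ?thesis unfolding f_def using c by (auto intro!: image_eqI[of _ _ "(c, w + ?u c)"])
      qed
    next
      fix w assume "w \<in> f ` (k \<times> L m)"
      then obtain c v where cv: "c \<in> k" "v \<in> L m" "w = ?u c + v" by (auto simp: f_def)
      have "?u c \<in> L (Suc m)" using wtu[OF cv(1)] mono_A[OF cv(1)] by (cases "c = 0") (auto simp: L_def)
      then show "w \<in> L (Suc m)" using L_add L_mono[of m "Suc m"] cv by auto
    qed
    moreover have "inj_on f (k \<times> L m)"
    proof (rule inj_onI, clarify)
      fix c v c' v' assume *: "c \<in> k" "c' \<in> k" "v \<in> L m" "v' \<in> L m" and "f (c, v) = f (c', v')"
      then have eq: "?u c + v = ?u c' + v'" by (simp add: f_def)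
      then have "?u (c + c') = v + v'"
        by (simp add: algebra_simps) (metis add_self_left add.left_commute add.commute)
      then have "?u (c + c') \<in> L m" using L_add * by simp
      then have "c + c' = 0" using wtu[OF kadd[OF *(1,2)]] x_nz y_nz by (auto simp: L_def)
      then have "c = c'" by (simp add: add_eq_0_char2)
      then show "c = c' \<and> v = v'" using eq by simp
    qed
    moreover have "{l. l < Suc m \<and> is_weight l} = insert m {l. l < m \<and> is_weight l}"
      using True by auto
    ultimately show ?thesis using Suc finite_k card_k by (simp add: card_image \<kappa>_def)
  qed
qed

lemma finite_L: "finite (L m)"
  using L_card_aux by blast

text \<open>The weights form the numerical semigroup generated by \<open>q\<close> and
  \<open>q + 1\<close>. The genus enters as the number of its gaps, all of which lie below
  \<open>q * B\<close> once \<open>q \<le> B\<close>.\<close>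

lemma card_weights:
  assumes "q \<le> B"
  shows "card {l. l < q * B \<and> is_weight l} + genus = q * B"
proof -
  let ?S = "SIGMA j:{..<q}. {..<B - j}"
  let ?f = "\<lambda>(j, i). q * i + (q + 1) * j"
  \<comment> \<open>The weight is \<open>q * (i + j) + j\<close> with \<open>j < q\<close>, hence
    below \<open>q * B\<close> exactly when \<open>i + j < B\<close>.\<close>
  have iff: "q * i + (q + 1) * j < q * B \<longleftrightarrow> i < B - j" if "j < q" for i j
  proof
    assume "q * i + (q + 1) * j < q * B"
    then have "q * (i + j) < q * B" by (simp add: algebra_simps)
    then show "i < B - j" using q_pos by simp
  next
    assume "i < B - j"
    then have "q * (i + j + 1) \<le> q * B" by (intro mult_left_mono) auto
    then show "q * i + (q + 1) * j < q * B" using that by (simp add: algebra_simps)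
  qed
  have "{l. l < q * B \<and> is_weight l} = ?f ` ?S"
    using iff by (force simp: is_weight_def image_iff)
  moreover have "inj_on ?f ?S"
  proof (rule inj_onI)
    fix a b assume "a \<in> ?S" "b \<in> ?S" "?f a = ?f b"
    then show "a = b" using weights_unique[of "fst a" q "fst b" "snd a" "snd b"] by (cases a; cases b) auto
  qed
  ultimately have "card {l. l < q * B \<and> is_weight l} = (\<Sum>j<q. B - j)"
    by (simp add: card_image)
  then show ?thesis using sum_diff_lessThan[OF assms] by simp
qed

lemma card_L:
  assumes "q \<le> B"
  shows "card (L (q * B)) = \<kappa> ^ (q * B - genus)" and "genus \<le> q * B"
proof -
  have "card {l. l < q * B \<and> is_weight l} = q * B - genus" and *: "genus \<le> q * B"
    using card_weights[OF assms] by linarith+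
  then show "card (L (q * B)) = \<kappa> ^ (q * B - genus)" using L_card_aux[of "q * B"] by simp
  show "genus \<le> q * B" by (rule *)
qed

lemma L_card_pos: "card (L m) > 0"
  using L_card_aux[of m] kappa_ge2 by simp

text \<open>In effect \<open>A\<close> modulo \<open>w A\<close> has at most
  \<open>\<kappa> ^ (q * e)\<close> elements. On \<open>L (q * B)\<close> the map is constant on
  translates of \<open>w\<close> times \<open>L (q * (B - e))\<close>, and the quotient of the two
  cardinalities does not depend on \<open>B\<close>. An arbitrary \<open>f\<close> allows single
  residues, tuples of residues and cosets to be treated alike.\<close>

lemma coset_count:
  assumes w: "w \<in> A" "w \<noteq> 0" "wt w \<le> q * e"
    and f: "\<And>g a. g \<in> A \<Longrightarrow> a \<in> A \<Longrightarrow> f (g + w * a) = f g"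
  shows "finite (f ` A) \<and> card (f ` A) \<le> \<kappa> ^ (q * e)"
proof (rule finite_if_finite_subsets_card_bdd)
  fix S assume S: "S \<subseteq> f ` A" "finite S"
  obtain G where G: "G \<subseteq> A" "finite G" "S = f ` G" using finite_subset_image[OF S(2,1)] by blast
  define b where "b = Suc (Max (insert 0 (wt ` G)))"
  \<comment> \<open>The summand \<open>b\<close> makes \<open>L (q * B)\<close> contain
    \<open>G\<close>; the others keep both \<open>B\<close> and \<open>B - e\<close> at least
    \<open>q\<close>, as \<open>card_L\<close> requires.\<close>
  define B where "B = b + e + q"
  have "G \<subseteq> L (q * B)"
  proof
    fix g assume "g \<in> G"
    then have "wt g < b" unfolding b_def using G(2) by (simp add: less_Suc_eq_le)
    also have "b \<le> q * B" using q_pos unfolding B_def by (simp add: trans_le_add1 add_mult_distrib2)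
    finally show "g \<in> L (q * B)" using G \<open>g \<in> G\<close> by (auto simp: L_def)
  qed
  then have "S \<subseteq> f ` L (q * B)" using G by blast
  then have 1: "card S \<le> card (f ` L (q * B))" using finite_L by (intro card_mono) auto
  let ?H = "(*) w ` L (q * (B - e))"
  have H: "?H \<subseteq> L (q * B)"
  proof
    fix v assume "v \<in> ?H"
    then obtain a where a: "a \<in> A" "a = 0 \<or> wt a < q * (B - e)" "v = w * a" by (auto simp: L_def)
    have "q * (B - e) + q * e = q * B" unfolding B_def by (simp add: algebra_simps)
    moreover have "wt v = wt w + wt a" if "a \<noteq> 0" using wt_mult[of w a] a w that by simp
    ultimately have "v = 0 \<or> wt v < q * B" using a w(3) by (cases "a = 0") auto
    then show "v \<in> L (q * B)" using a w A_mult by (auto simp: L_def)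
  qed
  have "card (f ` L (q * B)) * card ?H \<le> card (L (q * B))"
  proof (rule card_image_mult_le[OF finite_L])
    fix g h assume gh: "g \<in> L (q * B)" "h \<in> ?H"
    then obtain a where "a \<in> A" "h = w * a" by (auto simp: L_def)
    moreover have "g \<in> A" using gh by (auto simp: L_def)
    moreover have "g + h \<in> L (q * B)" using gh H L_add by blast
    ultimately show "g + h \<in> L (q * B) \<and> f (g + h) = f g" using f by simp
  qed
  moreover have "card ?H = card (L (q * (B - e)))" using w by (intro card_image) (auto simp: inj_on_def)
  moreover have "card (L (q * B)) = \<kappa> ^ (q * e) * card (L (q * (B - e)))"
  proof -
    have "q * B - genus = q * e + (q * (B - e) - genus)"
      using card_L(2)[of "B - e"] unfolding B_def by (simp add: algebra_simps)
    then show ?thesis using card_L(1)[of B] card_L(1)[of "B - e"] unfolding B_def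
      by (simp add: power_add)
  qed
  ultimately have "card (f ` L (q * B)) * card (L (q * (B - e))) \<le> \<kappa> ^ (q * e) * card (L (q * (B - e)))"
    by simp
  then have "card (f ` L (q * B)) \<le> \<kappa> ^ (q * e)" using L_card_pos[of "q * (B - e)"] by simp
  with 1 show "card S \<le> \<kappa> ^ (q * e)" by simp
qed

text \<open>There are finitely many classes modulo \<open>w\<close>, so a sequence repeats one. The
  sequences of interest are the iterated Frobenius powers of \<open>x\<close> and the powers of
  \<open>T N\<close>.\<close>

lemma pigeonhole:
  assumes w: "w \<in> A" "w \<noteq> 0" and s: "\<And>i :: nat. s i \<in> A"
  shows "\<exists>i j. i < j \<and> (\<exists>a\<in>A. s i + s j = w * a)"
proof -
  define f where "f = (\<lambda>g. {g + w * a | a. a \<in> A})"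
  have "f (g + w * a) = f g" if "g \<in> A" "a \<in> A" for g a
  proof -
    have "g + w * a + w * a' = g + w * (a + a')" "g + w * a' = g + w * a + w * (a + a')" for a'
      by (simp_all add: algebra_simps)
    then show ?thesis unfolding f_def using that A_add by blast
  qed
  moreover have "wt w \<le> q * wt w" using q_pos by simp
  ultimately have "finite (f ` A)" using coset_count[OF w, of "wt w" f] by blast
  moreover have "range (f \<circ> s) \<subseteq> f ` A" using s by auto
  ultimately have "finite (range (f \<circ> s))" by (rule finite_subset[rotated])
  then have "\<not> inj (f \<circ> s)" using finite_imageD by blast
  then obtain i j where ij: "i \<noteq> j" "f (s i) = f (s j)" by (auto simp: inj_on_def)
  have *: "\<exists>a\<in>A. s i + s j = w * a" if eq: "f (s i) = f (s j)" for i j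
  proof -
    have "s i \<in> f (s i)" unfolding f_def using A_0 by force
    then obtain a where "a \<in> A" "s i = s j + w * a" unfolding eq by (auto simp: f_def)
    then show ?thesis by (auto simp: add.commute)
  qed
  show ?thesis
  proof (cases "i < j")
    case True
    then show ?thesis using * ij by blast
  next
    case False
    then show ?thesis using *[of j i] ij by (metis linorder_neqE_nat)
  qed
qed

section \<open>Frobenius powers modulo T N\<close>

definition T :: "nat \<Rightarrow> 'b" where "T N = x ^ (\<kappa> ^ N) + x"

lemma T_A: "T N \<in> A"
  unfolding T_def by (intro A_add A_power x_A)

lemma kappa_pow_gt1: "N \<ge> 1 \<Longrightarrow> \<kappa> ^ N > 1"
  using kappa_ge2 one_less_power[of \<kappa> N] by simp

lemma T_wt: assumes "N \<ge> 1" shows "T N \<noteq> 0 \<and> wt (T N) = q * \<kappa> ^ N"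
proof -
  have "q < q * \<kappa> ^ N" using kappa_pow_gt1[OF assms] q_pos by simp
  then have "x + x ^ (\<kappa> ^ N) \<noteq> 0 \<and> wt (x + x ^ (\<kappa> ^ N)) = wt (x ^ (\<kappa> ^ N))"
    using x_A x_nz wt_x by (intro wt_add_less) (auto intro: A_power simp: wt_power mult.commute)
  then show ?thesis unfolding T_def using x_A x_nz wt_x by (simp add: add.commute wt_power)
qed

text \<open>The elements fixed modulo \<open>t\<close> by the \<open>e\<close>-th iterate of the
  \<open>Q\<close>-th power map. For \<open>Q = \<kappa>\<close> they form a
  \<open>k\<close>-algebra, so the property need only be checked on generators.\<close>

definition fixed_mod :: "nat \<Rightarrow> 'b \<Rightarrow> nat \<Rightarrow> 'b set" where
  "fixed_mod Q t e = {h \<in> A. \<exists>a\<in>A. h ^ (Q ^ e) + h = t * a}"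

lemma fixed_modI: "h \<in> A \<Longrightarrow> a \<in> A \<Longrightarrow> h ^ (Q ^ e) + h = t * a \<Longrightarrow> h \<in> fixed_mod Q t e"
  unfolding fixed_mod_def by blast

lemma fixed_mod_add:
  "g \<in> fixed_mod \<kappa> t e \<Longrightarrow> h \<in> fixed_mod \<kappa> t e \<Longrightarrow> g + h \<in> fixed_mod \<kappa> t e"
proof -
  assume "g \<in> fixed_mod \<kappa> t e" "h \<in> fixed_mod \<kappa> t e"
  then obtain a b where *: "g \<in> A" "h \<in> A" "a \<in> A" "b \<in> A"
    "g ^ (\<kappa> ^ e) + g = t * a" "h ^ (\<kappa> ^ e) + h = t * b" by (auto simp: fixed_mod_def)
  have "(g + h) ^ (\<kappa> ^ e) + (g + h) = (g ^ (\<kappa> ^ e) + g) + (h ^ (\<kappa> ^ e) + h)"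
    by (simp add: kappa_add add_ac)
  also have "\<dots> = t * (a + b)" unfolding * by (simp add: algebra_simps)
  finally show ?thesis by (rule fixed_modI[rotated 2]) (use * A_add in auto)
qed

lemma fixed_mod_mult:
  "g \<in> fixed_mod \<kappa> t e \<Longrightarrow> h \<in> fixed_mod \<kappa> t e \<Longrightarrow> g * h \<in> fixed_mod \<kappa> t e"
proof -
  assume "g \<in> fixed_mod \<kappa> t e" "h \<in> fixed_mod \<kappa> t e"
  then obtain a b where *: "g \<in> A" "h \<in> A" "a \<in> A" "b \<in> A"
    "g ^ (\<kappa> ^ e) + g = t * a" "h ^ (\<kappa> ^ e) + h = t * b" by (auto simp: fixed_mod_def)
  have "(g * h) ^ (\<kappa> ^ e) + g * h = (g ^ (\<kappa> ^ e) + g) * h ^ (\<kappa> ^ e) + g * (h ^ (\<kappa> ^ e) + h)"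
    by (simp add: power_mult_distrib algebra_simps)
  also have "\<dots> = t * (a * h ^ (\<kappa> ^ e) + g * b)" unfolding * by (simp add: algebra_simps)
  finally show ?thesis by (rule fixed_modI[rotated 2]) (use * in \<open>auto intro: A_add A_mult A_power\<close>)
qed

lemma k_frob_power: "c \<in> k \<Longrightarrow> c ^ (\<kappa> ^ e) = c"
  by (induction e) (auto simp: power_mult k_frob[folded \<kappa>_def])

lemma fixed_mod_k: "c \<in> k \<Longrightarrow> c \<in> fixed_mod \<kappa> t e"
  unfolding fixed_mod_def using k_frob_power[of c e] k_A A_0 by auto

lemma fixed_mod_power: "g \<in> fixed_mod \<kappa> t e \<Longrightarrow> g ^ i \<in> fixed_mod \<kappa> t e"
  by (induction i) (auto intro: fixed_mod_mult fixed_mod_k k1)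

text \<open>
  With \<open>Q = \<kappa> ^ N\<close> one has \<open>y ^ Q = y + h\<close> where \<open>h \<in> k[x]\<close> is fixed by the \<open>Q\<close>-th power modulo \<open>T N\<close>, so a second
  application of this power maps \<open>y\<close> to \<open>y + 2 h = y\<close>.
\<close>

lemma A_frob:
  assumes "w \<in> A"
  shows "\<exists>a\<in>A. w ^ (\<kappa> ^ (2 * N)) + w = T N * a"
proof -
  let ?X = "fixed_mod \<kappa> (T N) N" and ?Y = "fixed_mod \<kappa> (T N) (2 * N)"
  have up: "h \<in> ?Y" if hX: "h \<in> ?X" for h
  proof -
    obtain a where a: "h \<in> A" "a \<in> A" "h ^ (\<kappa> ^ N) + h = T N * a" using hX by (auto simp: fixed_mod_def)
    have "h ^ (\<kappa> ^ (2 * N)) + h = (h ^ (\<kappa> ^ N) + h) ^ (\<kappa> ^ N) + (h ^ (\<kappa> ^ N) + h)"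
      by (simp add: kappa_add mult_2 power_add power_mult add_ac)
    also have "\<dots> = T N * (T N ^ (\<kappa> ^ N - 1) * a ^ (\<kappa> ^ N) + a)"
      unfolding a(3) using kappa_ge2 by (simp add: power_mult_distrib algebra_simps flip: power_Suc)
    finally show ?thesis by (rule fixed_modI[rotated 2]) (use a T_A in \<open>auto intro: A_add A_mult A_power\<close>)
  qed
  have xX: "x \<in> ?X" unfolding fixed_mod_def T_def using x_A A_1 by auto
  have cX: "x ^ (q + 1) + a0 * x ^ 2 \<in> ?X"
    by (intro fixed_mod_add fixed_mod_mult fixed_mod_power xX fixed_mod_k a0_k)
  \<comment> \<open>By telescoping, this is a sum of iterated \<open>q\<close>-th powers of
    \<open>y ^ q + y\<close>, which the curve equation places in \<open>k[x]\<close>.\<close>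
  have "y ^ (q ^ m) + y \<in> ?X" for m
  proof (induction m)
    case 0
    then show ?case using fixed_mod_k[OF k_zero] by simp
  next
    case (Suc m)
    have "y ^ (q ^ Suc m) + y = (y ^ (q ^ m) + y) ^ q + (y ^ q + y)"
      using q_add[of "y ^ (q ^ m)" y 1] by (simp add: power_mult[symmetric] mult.commute add_ac)
    then show ?case using Suc cX unfolding curve_eq by (simp add: fixed_mod_add fixed_mod_power)
  qed
  from this[of "4 * N"] have "y ^ (\<kappa> ^ N) + y \<in> ?X" by (simp add: power_mult \<kappa>_def)
  then obtain a where a: "a \<in> A" "(y ^ (\<kappa> ^ N) + y) ^ (\<kappa> ^ N) + (y ^ (\<kappa> ^ N) + y) = T N * a"
    by (auto simp: fixed_mod_def)
  have "(y ^ (\<kappa> ^ N) + y) ^ (\<kappa> ^ N) + (y ^ (\<kappa> ^ N) + y) = y ^ (\<kappa> ^ (2 * N)) + y"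
    by (simp add: kappa_add mult_2 power_add power_mult add_ac)
  with a have yY: "y \<in> ?Y" unfolding fixed_mod_def using y_A by auto
  have "w \<in> ?Y" using assms
  proof (induction rule: A_induct)
    case (mono c i j)
    then show ?case by (intro fixed_mod_mult fixed_mod_power fixed_mod_k up[OF xX] yY)
  qed (rule fixed_mod_add)
  then show ?thesis by (auto simp: fixed_mod_def)
qed

end

section \<open>Finite places\<close>

context place_of
begin

text \<open>At each kind of place only a factorisation with respect to \<open>t\<close> has to be
  found. An element of \<open>M\<close> then has a positive exponent, for otherwise its inverse
  would lie in \<open>V\<close>.\<close>

lemma uniformizerI:
  assumes t: "t \<in> M" and decomp: "\<And>z. z \<in> K \<Longrightarrow> z \<noteq> 0 \<Longrightarrow> \<exists>n u. u \<in> V - M \<and> z = t powi n * u"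
  shows "uniformizer V t"
  unfolding uniformizer_def
proof (intro equalityI subsetI)
  fix a assume a: "a \<in> M"
  show "a \<in> (*) t ` V"
  proof (cases "a = 0")
    case True
    then show ?thesis using V_zero by (auto intro!: image_eqI[of _ _ 0])
  next
    case False
    then obtain n u where nu: "u \<in> V - M" "a = t powi n * u" using decomp a M_V V_K by blast
    have tV: "t powi m \<in> V" if "m \<ge> 0" for m
      using that t M_V V_power by (auto simp: power_int_def)
    have "n > 0"
    proof (rule ccontr)
      assume "\<not> n > 0"
      then have "t powi (- n) * inverse u \<in> V" using tV[of "- n"] unit_inverse[OF nu(1)] V_mult by auto
      moreover have "t powi (- n) * inverse u = inverse a" using nu by (simp add: power_int_minus)
      ultimately show False using a False by (auto simp: max_ideal_def)
    qed
    then have "t \<noteq> 0" using nu(2) False by (auto simp: power_int_def zero_power)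
    then have "t powi n = t * t powi (n - 1)"
      using power_int_add_1'[of t "n - 1"] by simp
    then have "a = t * (t powi (n - 1) * u)" using nu(2) by simp
    moreover have "t powi (n - 1) * u \<in> V" using tV[of "n - 1"] \<open>n > 0\<close> nu V_mult by auto
    ultimately show ?thesis by blast
  qed
next
  fix a assume "a \<in> (*) t ` V"
  then show "a \<in> M" using M_mult[OF t] by auto
qed

end

section \<open>Prime ideals and their local rings\<close>

context curve
begin

text \<open>These are the closed points of the affine curve; the last clause excludes the zero
  ideal, whose localisation is all of \<open>K\<close>.\<close>

definition prime_id :: "'b set \<Rightarrow> bool" where
  "prime_id m \<longleftrightarrow> m \<subseteq> A \<and> (\<forall>a\<in>m. \<forall>b\<in>m. a + b \<in> m) \<and> (\<forall>a\<in>A. \<forall>b\<in>m. a * b \<in> m) \<and> 1 \<notin> m \<and>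
     (\<forall>a\<in>A. \<forall>b\<in>A. a * b \<in> m \<longrightarrow> a \<in> m \<or> b \<in> m) \<and> (\<exists>w\<in>m. w \<noteq> 0)"

lemma prime_idD:
  assumes "prime_id m"
  shows "a \<in> m \<Longrightarrow> a \<in> A" "a \<in> m \<Longrightarrow> b \<in> m \<Longrightarrow> a + b \<in> m" "a \<in> A \<Longrightarrow> b \<in> m \<Longrightarrow> a * b \<in> m"
    "1 \<notin> m" "a \<in> A \<Longrightarrow> b \<in> A \<Longrightarrow> a * b \<in> m \<Longrightarrow> a \<in> m \<or> b \<in> m" "\<exists>w\<in>m. w \<noteq> 0"
  using assms unfolding prime_id_def by blast+

lemma prime_id_0: "prime_id m \<Longrightarrow> 0 \<in> m"
  using prime_idD(3)[of m 0] prime_idD(6)[of m] A_0 by auto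

lemma prime_id_power: "prime_id m \<Longrightarrow> a \<in> A \<Longrightarrow> a ^ i \<in> m \<Longrightarrow> a \<in> m"
proof (induction i)
  case 0
  then show ?case using prime_idD(4) by auto
next
  case (Suc i)
  then show ?case using prime_idD(5)[OF Suc.prems(1), of a "a ^ i"] A_power by auto
qed

lemma prime_id_power': "prime_id m \<Longrightarrow> a \<in> m \<Longrightarrow> i > 0 \<Longrightarrow> a ^ i \<in> m"
proof -
  assume m: "prime_id m" "a \<in> m" "i > 0"
  then have "a ^ (i - 1) * a \<in> m" by (intro prime_idD(3) A_power prime_idD(1))
  then show ?thesis using m by (metis power_minus_mult)
qed

text \<open>Two Frobenius powers of \<open>x\<close> agree modulo a nonzero \<open>w\<close> in
  \<open>m\<close>. Their sum is the \<open>\<kappa> ^ i\<close>-th power of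
  \<open>T (j - i)\<close>, and primality removes the exponent.\<close>

lemma prime_id_T:
  assumes m: "prime_id m"
  shows "\<exists>N\<ge>1. T N \<in> m"
proof -
  obtain w where w: "w \<in> m" "w \<noteq> 0" using prime_idD(6)[OF m] by blast
  obtain i j a where ij: "i < j" "a \<in> A" "x ^ (\<kappa> ^ i) + x ^ (\<kappa> ^ j) = w * a"
    using pigeonhole[of w "\<lambda>i. x ^ (\<kappa> ^ i)"] w prime_idD(1)[OF m] x_A A_power by blast
  have "T (j - i) ^ (\<kappa> ^ i) = x ^ (\<kappa> ^ (j - i) * \<kappa> ^ i) + x ^ (\<kappa> ^ i)"
    unfolding T_def kappa_add by (simp add: power_mult)
  also have "\<kappa> ^ (j - i) * \<kappa> ^ i = \<kappa> ^ j" using ij(1) by (simp flip: power_add)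
  finally have "T (j - i) ^ (\<kappa> ^ i) = a * w" using ij(3) by (simp add: add.commute mult.commute)
  then have "T (j - i) ^ (\<kappa> ^ i) \<in> m" using prime_idD(3)[OF m ij(2) w(1)] by simp
  then have "T (j - i) \<in> m" by (rule prime_id_power[OF m T_A])
  then show ?thesis using ij(1) by (intro exI[of _ "j - i"]) auto
qed

definition loc :: "'b set \<Rightarrow> 'b set" where
  "loc m = {g / h | g h. g \<in> A \<and> h \<in> A \<and> h \<notin> m}"

lemma locI: "g \<in> A \<Longrightarrow> h \<in> A \<Longrightarrow> h \<notin> m \<Longrightarrow> g / h \<in> loc m"
  unfolding loc_def by blast

lemma locE:
  assumes "prime_id m" "z \<in> loc m"
  obtains g h where "g \<in> A" "h \<in> A" "h \<notin> m" "h \<noteq> 0" "z = g / h"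
  using assms prime_id_0 unfolding loc_def by blast

end

locale curve_prime = curve +
  fixes m N
  assumes m: "prime_id m" and N: "N \<ge> 1" and T_m: "T N \<in> m"
begin

lemmas m_A = prime_idD(1)[OF m] and m_add = prime_idD(2)[OF m] and m_mult = prime_idD(3)[OF m]
  and one_m = prime_idD(4)[OF m] and m_prime = prime_idD(5)[OF m] and m_0 = prime_id_0[OF m]

lemma unit_mult_m: "g \<in> A \<Longrightarrow> g \<notin> m \<Longrightarrow> h \<in> A \<Longrightarrow> h \<notin> m \<Longrightarrow> g * h \<in> A \<and> g * h \<notin> m"
  using m_prime A_mult by blast

lemma one_plus_m: "g \<in> m \<Longrightarrow> 1 + g \<notin> m"
  using m_add[of g "1 + g"] one_m by (auto simp: add.left_commute)

lemma loc_add: assumes "a \<in> loc m" "b \<in> loc m" shows "a + b \<in> loc m"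
proof -
  obtain g h where 1: "g \<in> A" "h \<in> A" "h \<notin> m" "h \<noteq> 0" "a = g / h" by (rule locE[OF m assms(1)])
  obtain g' h' where 2: "g' \<in> A" "h' \<in> A" "h' \<notin> m" "h' \<noteq> 0" "b = g' / h'" by (rule locE[OF m assms(2)])
  have "a + b = (g * h' + g' * h) / (h * h')" using 1 2 by (simp add: field_simps)
  then show ?thesis using 1 2 unit_mult_m[of h h'] by (auto intro: locI A_add A_mult)
qed

lemma loc_mult: assumes "a \<in> loc m" "b \<in> loc m" shows "a * b \<in> loc m"
proof -
  obtain g h where 1: "g \<in> A" "h \<in> A" "h \<notin> m" "h \<noteq> 0" "a = g / h" by (rule locE[OF m assms(1)])
  obtain g' h' where 2: "g' \<in> A" "h' \<in> A" "h' \<notin> m" "h' \<noteq> 0" "b = g' / h'" by (rule locE[OF m assms(2)])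
  have "a * b = (g * g') / (h * h')" using 1 2 by simp
  then show ?thesis using 1 2 unit_mult_m[of h h'] by (auto intro: locI A_add A_mult)
qed

lemma A_loc: "a \<in> A \<Longrightarrow> a \<in> loc m"
  using locI[of a 1 m] A_1 one_m by simp

lemma loc_K: "z \<in> loc m \<Longrightarrow> z \<in> K"
  unfolding loc_def using K_I by blast



text \<open>Here \<open>T N\<close> turns out to have a simple zero at \<open>m\<close>: the element
  \<open>w ^ (\<kappa> ^ (2 * N)) + w\<close> is divisible by \<open>T N\<close>, and for
  \<open>w\<close> in \<open>m\<close> it is \<open>w\<close> times the unit
  \<open>1 + w ^ Suc r\<close>.\<close>

lemma m_step:
  assumes "w \<in> m"
  shows "\<exists>a\<in>A. \<exists>h\<in>A. h \<notin> m \<and> w * h = T N * a"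
proof -
  have w: "w \<in> A" using m_A assms by blast
  obtain a where a: "a \<in> A" "w ^ (\<kappa> ^ (2 * N)) + w = T N * a" using A_frob[OF w] by blast
  obtain r where r: "\<kappa> ^ (2 * N) = Suc (Suc r)"
    using kappa_pow_gt1[of "2 * N"] N by (metis One_nat_def Suc_lessE less_imp_Suc_add mult_2 trans_le_add1)
  have "w ^ Suc r \<in> m" using prime_id_power'[OF m assms] by blast
  then have "1 + w ^ Suc r \<notin> m" by (rule one_plus_m)
  moreover have "w * (1 + w ^ Suc r) = T N * a"
    using a(2) unfolding r by (simp add: algebra_simps)
  moreover have "1 + w ^ Suc r \<in> A" using A_1 A_add A_power[OF w] by blast
  ultimately show ?thesis using a(1) by blast
qed

text \<open>
  Division by \<open>T N\<close> terminates: by the pigeonhole principle \<open>w\<close> divides some \<open>T N ^ i + T N ^ j\<close> with \<open>i < j\<close>,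
  that is, \<open>T N ^ i\<close> up to a unit at \<open>m\<close>.
\<close>

lemma m_decomp:
  assumes "w \<in> A" "w \<noteq> 0"
  shows "\<exists>i g h. g \<in> A \<and> g \<notin> m \<and> h \<in> A \<and> h \<notin> m \<and> w * h = T N ^ i * g"
proof (rule ccontr)
  assume contra: "\<not> ?thesis"
  have step: "\<exists>a\<in>A. \<exists>h\<in>A. h \<notin> m \<and> w * h = T N ^ e * a" for e
  proof (induction e)
    case 0
    then show ?case using A_1 one_m assms by (intro bexI[of _ w] bexI[of _ 1]) auto
  next
    case (Suc e)
    then obtain a h where ah: "a \<in> A" "h \<in> A" "h \<notin> m" "w * h = T N ^ e * a" by blast
    then have "a \<in> m" using contra by blast
    then obtain a' h' where ah': "a' \<in> A" "h' \<in> A" "h' \<notin> m" "a * h' = T N * a'" using m_step by blast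
    have "w * (h * h') = T N ^ e * (a * h')" using ah(4) by (simp add: mult_ac)
    also have "\<dots> = T N ^ Suc e * a'" unfolding ah'(4) by (simp add: mult_ac)
    finally show ?case using ah ah' unit_mult_m[of h h'] by blast
  qed
  obtain i j a where ij: "i < j" "a \<in> A" "T N ^ i + T N ^ j = w * a"
    using pigeonhole[OF assms, of "\<lambda>i. T N ^ i"] T_A A_power by blast
  obtain b h where bh: "b \<in> A" "h \<in> A" "h \<notin> m" "w * h = T N ^ Suc i * b" using step by blast
  let ?u = "1 + T N ^ (j - i)"
  have "T N ^ j = T N ^ i * T N ^ (j - i)" using ij(1) by (simp flip: power_add)
  then have "T N ^ i * ?u = w * a" using ij(3) by (simp add: algebra_simps)
  then have "T N ^ i * (?u * h) = T N ^ i * (T N * b * a)"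
    using bh(4) by (simp add: mult_ac)
  then have eq: "?u * h = T N * b * a" using T_wt[OF N] by simp
  have "?u \<notin> m" using ij(1) by (intro one_plus_m prime_id_power'[OF m T_m]) auto
  then have "?u * h \<notin> m" using unit_mult_m[of ?u h] bh A_add A_1 A_power T_A by blast
  moreover have "T N * b * a \<in> m"
    using m_mult[OF A_mult[OF bh(1) ij(2)] T_m] by (simp add: mult_ac)
  ultimately show False using eq by simp
qed

lemma K_decomp:
  assumes "z \<in> K" "z \<noteq> 0"
  shows "\<exists>i g h. g \<in> A \<and> g \<notin> m \<and> h \<in> A \<and> h \<notin> m \<and> z = T N powi i * (g / h)"
proof -
  obtain u v where uv: "u \<in> A" "v \<in> A" "v \<noteq> 0" "z = u / v" by (rule K_E[OF assms(1)])
  have "u \<noteq> 0" using uv assms by auto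
  obtain i g h where 1: "g \<in> A" "g \<notin> m" "h \<in> A" "h \<notin> m" "u * h = T N ^ i * g"
    using m_decomp[OF uv(1) \<open>u \<noteq> 0\<close>] by blast
  obtain i' g' h' where 2: "g' \<in> A" "g' \<notin> m" "h' \<in> A" "h' \<notin> m" "v * h' = T N ^ i' * g'"
    using m_decomp[OF uv(2,3)] by blast
  have nz: "g \<noteq> 0" "h \<noteq> 0" "g' \<noteq> 0" "h' \<noteq> 0" "T N \<noteq> 0" using 1 2 m_0 T_wt[OF N] by auto
  have "u = T N ^ i * g / h" "v = T N ^ i' * g' / h'" using 1 2 nz by (simp_all add: field_simps)
  then have "z = (T N ^ i * g / h) / (T N ^ i' * g' / h')" using uv(4) by simp
  also have "\<dots> = T N powi (int i - int i') * ((g * h') / (h * g'))"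
    using nz by (simp add: power_int_diff field_simps)
  finally have "z = T N powi (int i - int i') * ((g * h') / (h * g'))" .
  then show ?thesis using unit_mult_m[of g h'] unit_mult_m[of h g'] 1 2 by blast
qed

lemma inverse_m_notin: "w \<in> m \<Longrightarrow> w \<noteq> 0 \<Longrightarrow> inverse w \<notin> loc m"
proof
  assume w: "w \<in> m" "w \<noteq> 0" "inverse w \<in> loc m"
  then obtain g h where gh: "g \<in> A" "h \<in> A" "h \<notin> m" "h \<noteq> 0" "inverse w = g / h" using locE[OF m] by metis
  then have "h = g * w" using w by (simp add: field_simps)
  then show False using gh m_mult w by simp
qed

lemma loc_place: "loc m \<in> places k K"
  unfolding places_def mem_Collect_eq subring_type_iff
proof (intro conjI ballI)
  show "k \<subset> loc m"
  proof (rule psubsetI)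
    show "k \<noteq> loc m" using wt_const[of x] x_nz wt_x q_pos A_loc[OF x_A] by auto
  qed (use k_A A_loc in blast)
  have "inverse (T N) \<in> K" using A_K[OF T_A] by (rule K_inverse)
  then show "loc m \<subset> K" using loc_K inverse_m_notin[OF T_m] T_wt[OF N] by blast
  show "z \<in> loc m \<or> inverse z \<in> loc m" if zK: "z \<in> K" for z
  proof (cases "z = 0")
    case True
    then show ?thesis using A_loc A_0 by auto
  next
    case False
    then obtain i g h where z: "g \<in> A" "g \<notin> m" "h \<in> A" "h \<notin> m" "z = T N powi i * (g / h)"
      using K_decomp[OF zK] by blast
    have Tl: "T N powi j \<in> loc m" if "j \<ge> 0" for j
      using that A_loc[OF A_power[OF T_A]] by (auto simp: power_int_def)
    show ?thesis
    proof (cases "i \<ge> 0")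
      case True
      then show ?thesis using loc_mult[OF Tl[of i] locI[of g h m]] z by simp
    next
      case False
      have "inverse z = T N powi (- i) * (h / g)"
        using z by (simp add: power_int_minus field_class.field_divide_inverse mult_ac)
      then show ?thesis using loc_mult[OF Tl[of "- i"] locI[of h g m]] z(1-4) False by simp
    qed
  qed
qed (use A_loc A_1 loc_add loc_mult in \<open>auto simp: uminus_id\<close>)

sublocale place_of k K "loc m"
  by unfold_locales (rule loc_place)

lemma m_M: "w \<in> m \<Longrightarrow> w \<in> M"
  using inverse_m_notin[of w] A_loc m_A by (auto simp: max_ideal_def)

lemma frac_unit: assumes "g \<in> A" "g \<notin> m" "h \<in> A" "h \<notin> m" shows "g / h \<in> loc m - M"
proof -
  have "g \<noteq> 0" "h \<noteq> 0" using assms m_0 by auto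
  then show ?thesis unfolding unit_iff using assms by (auto intro: locI)
qed

lemma A_M_iff: "w \<in> A \<Longrightarrow> w \<in> M \<longleftrightarrow> w \<in> m"
  using m_M frac_unit[of w 1] A_1 one_m by auto

sublocale discrete_place k K "loc m" "T N"
proof unfold_locales
  show decomp: "\<exists>n u. u \<in> loc m - M \<and> z = T N powi n * u" if "z \<in> K" "z \<noteq> 0" for z
    using K_decomp[OF that] frac_unit by blast
  show "uniformizer (loc m) (T N)"
    using m_M[OF T_m] decomp by (rule uniformizerI)
qed

text \<open>As in a finite field, \<open>h ^ r\<close> with
  \<open>r = \<kappa> ^ (2 * N) - 2\<close> inverts \<open>h\<close> modulo \<open>T N\<close>, so a
  fraction has the same residue as an element of \<open>A\<close>.\<close>

lemma residue_A:
  assumes "z \<in> loc m"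
  shows "\<exists>a\<in>A. z + a \<in> M"
proof -
  obtain g h where gh: "g \<in> A" "h \<in> A" "h \<notin> m" "h \<noteq> 0" "z = g / h" by (rule locE[OF m assms])
  obtain r where r: "\<kappa> ^ (2 * N) = Suc (Suc r)"
    using kappa_pow_gt1[of "2 * N"] N by (metis One_nat_def Suc_lessE less_imp_Suc_add mult_2 trans_le_add1)
  obtain a where a: "a \<in> A" "h ^ Suc (Suc r) + h = T N * a" using A_frob[OF gh(2), of N] unfolding r by blast
  have "z + g * h ^ r = g * (h ^ Suc (Suc r) + h) / (h * h)"
    using gh by (simp add: field_simps)
  also have "\<dots> = T N * ((g * a) / (h * h))" unfolding a(2) by simp
  also have "\<dots> \<in> M"
    using unit_mult_m[of h h] gh a by (intro M_mult t_M locI A_mult) auto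
  finally show ?thesis using gh by (intro bexI[of _ "g * h ^ r"]) (auto intro: A_mult A_power)
qed

end

section \<open>Valuation rings containing x\<close>

locale curve_place = curve +
  fixes V
  assumes V_pl: "V \<in> places k K"
begin

sublocale place_of k K V
  by unfold_locales (rule V_pl)

text \<open>By the curve equation \<open>y\<close> is integral over \<open>k[x]\<close>. If it had a
  pole, division of the equation by \<open>y ^ q\<close> would show that 1 lies in
  \<open>M\<close>.\<close>

lemma A_sub_V: assumes xV: "x \<in> V" shows "A \<subseteq> V"
proof -
  have yV: "y \<in> V"
  proof (rule ccontr)
    assume "y \<notin> V"
    then have yM: "inverse y \<in> M" using V_cases[OF A_K[OF y_A]] by (auto simp: max_ideal_def)
    have "(y ^ q + y) * inverse y ^ q = 1 + inverse y ^ (q - 1)"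
    proof -
      have "y ^ q * inverse y ^ q = 1" using y_nz by (simp flip: power_mult_distrib)
      moreover have "inverse y ^ q = inverse y * inverse y ^ (q - 1)"
        using q_pos by (simp flip: power_Suc)
      then have "y * inverse y ^ q = inverse y ^ (q - 1)" using y_nz by simp
      ultimately show ?thesis by (simp add: algebra_simps)
    qed
    moreover have "(y ^ q + y) * inverse y ^ q \<in> M"
    proof -
      have "inverse y ^ q = inverse y * inverse y ^ (q - 1)"
        using q_pos by (simp flip: power_Suc)
      then have "inverse y ^ q \<in> M" using M_mult[OF yM V_power[OF M_V[OF yM]]] by simp
      moreover have "y ^ q + y \<in> V"
        unfolding curve_eq using xV k_V a0_k by (intro V_add V_mult V_power) auto
      ultimately show ?thesis by (rule M_mult')
    qed
    moreover have "inverse y ^ (q - 1) = inverse y * inverse y ^ (q - 2)"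
      using q_ge2 by (simp flip: power_Suc add: Suc_diff_le numeral_2_eq_2 Suc_diff_Suc)
    then have "inverse y ^ (q - 1) \<in> M" using M_mult[OF yM V_power[OF M_V[OF yM]]] by simp
    ultimately have "1 \<in> M" using M_add[of "1 + inverse y ^ (q - 1)" "inverse y ^ (q - 1)"] by (simp add: add.assoc)
    then show False using one_notin_M by simp
  qed
  show ?thesis
  proof
    fix w assume "w \<in> A"
    then show "w \<in> V"
    proof (induction rule: A_induct)
      case (mono c i j)
      then show ?case using xV yV k_V by (intro V_mult V_power) auto
    qed (rule V_add)
  qed
qed

text \<open>The contraction is nonzero because \<open>V\<close> is a proper subring of
  \<open>K\<close>: the denominator of an element outside \<open>V\<close> cannot be a unit of
  \<open>V\<close>.\<close>

lemma center_prime: assumes xV: "x \<in> V" shows "prime_id (A \<inter> M)"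
  unfolding prime_id_def
proof (intro conjI ballI impI)
  show "1 \<notin> A \<inter> M" using one_notin_M by blast
  obtain z where z: "z \<in> K" "z \<notin> V" using V_psub_K by blast
  obtain g h where gh: "g \<in> A" "h \<in> A" "h \<noteq> 0" "z = g / h" by (rule K_E[OF z(1)])
  have "h \<in> M"
  proof (rule ccontr)
    assume "h \<notin> M"
    then have "g * inverse h \<in> V" using unit_inverse[of h] gh A_sub_V[OF xV] V_mult by blast
    then show False using z gh by (simp add: field_class.field_divide_inverse)
  qed
  then show "\<exists>w\<in>A \<inter> M. w \<noteq> 0" using gh by blast
  show "a + b \<in> A \<inter> M" if "a \<in> A \<inter> M" "b \<in> A \<inter> M" for a b
    using that A_add M_add by simp
  show "a * b \<in> A \<inter> M" if "a \<in> A" "b \<in> A \<inter> M" for a b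
    using that A_mult[of a b] M_mult'[of b a] A_sub_V[OF xV] by auto
  show "a \<in> A \<inter> M \<or> b \<in> A \<inter> M" if "a \<in> A" "b \<in> A" "a * b \<in> A \<inter> M" for a b
    using that M_prime[of a b] A_sub_V[OF xV] by auto
qed blast

text \<open>A discrete valuation ring is a maximal proper subring of its field. Concretely, for
  \<open>z\<close> in \<open>V\<close> outside the localisation, \<open>inverse z\<close> is a
  multiple of \<open>T N\<close>, hence lies in \<open>M\<close>, although \<open>z\<close> is in
  \<open>V\<close>.\<close>

lemma finite_place_eq: assumes xV: "x \<in> V" shows "V = loc (A \<inter> M)"
proof -
  obtain N where N: "N \<ge> 1" "T N \<in> A \<inter> M" using prime_id_T[OF center_prime[OF xV]] by blast
  interpret P: curve_prime k A x y a0 n q wt "A \<inter> M" N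
    by unfold_locales (use N center_prime[OF xV] in auto)
  have unitV: "g / h \<in> V" if "g \<in> A" "h \<in> A" "h \<notin> A \<inter> M" for g h
    using unit_inverse[of h] that A_sub_V[OF xV] V_mult
    by (auto simp: field_class.field_divide_inverse)
  show ?thesis
  proof (intro equalityI subsetI)
    fix z assume "z \<in> loc (A \<inter> M)"
    then show "z \<in> V" using unitV by (auto simp: loc_def)
  next
    fix z assume z: "z \<in> V"
    show "z \<in> loc (A \<inter> M)"
    proof (rule ccontr)
      assume nz: "z \<notin> loc (A \<inter> M)"
      then have "inverse z \<in> P.M" "z \<noteq> 0"
        using P.V_cases[OF V_K[OF z]] P.V_zero by (auto simp: max_ideal_def)
      then obtain v where v: "v \<in> loc (A \<inter> M)" "inverse z = T N * v"
        using P.unif by (auto simp: uniformizer_def)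
      have "v \<in> V" using v(1) unitV by (auto simp: loc_def)
      then have "inverse z \<in> M" using v(2) M_mult[of "T N" v] N by simp
      then have "inverse z * z \<in> M" by (rule M_mult) (rule z)
      then show False using one_notin_M \<open>z \<noteq> 0\<close> by simp
    qed
  qed
qed

end

section \<open>The place at infinity\<close>

locale curve_pole = curve_place +
  assumes x_pole: "x \<notin> V"
begin

definition \<tau> where "\<tau> = x / y"

lemma ix_M: "inverse x \<in> M"
  using V_cases[OF A_K[OF x_A]] x_pole by (auto simp: max_ideal_def)

lemma M_pow: "a \<in> M \<Longrightarrow> i > 0 \<Longrightarrow> a ^ i \<in> M"
  using M_mult[of a "a ^ (i - 1)"] V_power[OF M_V] by (cases i) auto

lemma unit_near_one: "a \<in> M \<Longrightarrow> 1 + a \<in> V - M"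
  by (rule unit_add[OF one_unit])

text \<open>The curve equation makes this a unit congruent to \<open>1\<close>, see \<open>s_one\<close>; it controls \<open>x\<close> and \<open>y\<close> by \<open>x_tau\<close> and \<open>y_tau\<close>.\<close>

definition s where "s = y ^ q / x ^ (q + 1)"

lemma s_eq: "s + y * inverse x ^ (q + 1) = 1 + a0 * inverse x ^ (q - 1)"
proof -
  obtain r where r: "q = Suc r" using q_pos by (cases q) auto
  have "s + y * inverse x ^ (q + 1) = (y ^ q + y) * inverse x ^ (q + 1)"
    unfolding s_def by (simp add: divide_inverse power_inverse algebra_simps)
  also have "\<dots> = 1 + a0 * inverse x ^ (q - 1)"
    unfolding curve_eq using x_nz unfolding r by (simp add: field_simps power2_eq_square)
  finally show ?thesis .
qed

lemma a0_ix_M: "a0 * inverse x ^ (q - 1) \<in> M"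
  using M_mult'[OF M_pow[OF ix_M] k_V[OF a0_k]] q_ge2 by simp

text \<open>Otherwise \<open>s_eq\<close>, the curve equation divided by \<open>x ^ (q + 1)\<close>,
  would equate an element of \<open>M\<close> with a unit.\<close>

lemma y_pole: "y \<notin> V"
proof
  assume yV: "y \<in> V"
  have "inverse x ^ (q + 1) \<in> M" by (rule M_pow[OF ix_M]) simp
  then have "y * inverse x ^ (q + 1) \<in> M" "y ^ q * inverse x ^ (q + 1) \<in> M"
    using yV V_power by (auto intro: M_mult')
  then have "s + y * inverse x ^ (q + 1) \<in> M"
    unfolding s_def by (intro M_add) (simp_all add: divide_inverse power_inverse)
  then show False using unit_near_one[OF a0_ix_M] unfolding s_eq by simp
qed

lemma iy_M: "inverse y \<in> M"
  using V_cases[OF A_K[OF y_A]] y_pole by (auto simp: max_ideal_def)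

text \<open>With \<open>y ^ q\<close> factored out of the left side, \<open>s_eq\<close> reads
  \<open>s * d = r\<close> where \<open>d\<close> and \<open>r\<close> are both congruent to 1
  modulo \<open>M\<close>.\<close>

lemma s_unit: "s \<in> V - M" and s_one: "s + 1 \<in> M"
proof -
  define d where "d = 1 + inverse y ^ (q - 1)"
  define r where "r = 1 + a0 * inverse x ^ (q - 1)"
  have iyq: "inverse y ^ (q - 1) \<in> M" using M_pow[OF iy_M, of "q - 1"] q_ge2 by simp
  then have d: "d \<in> V - M" unfolding d_def by (rule unit_near_one)
  have r: "r \<in> V - M" unfolding r_def by (rule unit_near_one[OF a0_ix_M])
  obtain l where l: "q = Suc l" using q_pos by (cases q) auto
  have "s * d = s + y * inverse x ^ (q + 1)"
    unfolding s_def d_def using y_nz x_nz unfolding l by (simp add: field_simps)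
  then have sd: "s * d = r" unfolding s_eq r_def .
  have "d \<noteq> 0" using d M_zero by auto
  then have s': "s = r * inverse d" using sd by (simp add: field_simps)
  show "s \<in> V - M" unfolding s' by (rule unit_mult[OF r unit_inverse[OF d]])
  have "s + 1 = (r + d) * inverse d" using s' \<open>d \<noteq> 0\<close> by (simp add: field_simps)
  moreover have "r + d = a0 * inverse x ^ (q - 1) + inverse y ^ (q - 1)"
    unfolding r_def d_def by (simp add: algebra_simps add_ac)
  then have "r + d \<in> M" using M_add[OF a0_ix_M iyq] by simp
  then have "(r + d) * inverse d \<in> M" using unit_inverse[OF d] by (intro M_mult) auto
  ultimately show "s + 1 \<in> M" by simp
qed

lemma s_nz: "s \<noteq> 0"
  using s_unit unit_iff by blast

lemma tau_nz: "\<tau> \<noteq> 0"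
  unfolding \<tau>_def using x_nz y_nz by simp

lemma x_tau: "x * \<tau> ^ q = inverse s" and y_tau: "y * \<tau> ^ (q + 1) = inverse s"
proof -
  show "x * \<tau> ^ q = inverse s" unfolding \<tau>_def s_def using x_nz y_nz by (simp add: field_simps)
  then show "y * \<tau> ^ (q + 1) = inverse s" unfolding \<tau>_def using x_nz y_nz by (simp add: field_simps)
qed

text \<open>By \<open>x_tau\<close> the power \<open>\<tau> ^ q\<close> is \<open>inverse x\<close>
  times a unit, and a valuation ring contains every element of \<open>K\<close> that has a power in
  \<open>M\<close>.\<close>

lemma tau_M: "\<tau> \<in> M"
proof -
  have "\<tau> ^ q = inverse x * (x * \<tau> ^ q)" using x_nz by simp
  then have "\<tau> ^ q = inverse x * inverse s" unfolding x_tau .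
  then have tq: "\<tau> ^ q \<in> M" using M_mult[OF ix_M] unit_inverse[OF s_unit] by simp
  have "\<tau> \<in> V"
  proof (rule ccontr)
    assume "\<tau> \<notin> V"
    moreover have "\<tau> \<in> K" unfolding \<tau>_def by (intro K_I x_A y_A)
    ultimately have "inverse \<tau> \<in> V" using V_cases by blast
    then have "\<tau> ^ q * inverse \<tau> ^ q \<in> M" by (intro M_mult[OF tq] V_power)
    then show False using one_notin_M tau_nz by (simp add: power_inverse)
  qed
  then show ?thesis using tq by (rule M_prime_power)
qed

lemma near_one_mult: "u \<in> V \<Longrightarrow> u + 1 \<in> M \<Longrightarrow> v \<in> V \<Longrightarrow> v + 1 \<in> M \<Longrightarrow> u * v + 1 \<in> M"
proof -
  assume *: "u \<in> V" "u + 1 \<in> M" "v \<in> V" "v + 1 \<in> M"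
  have eq: "u * v + 1 = u * (v + 1) + (u + 1)" by (simp add: algebra_simps)
  show ?thesis unfolding eq by (rule M_add[OF M_mult'[OF *(4,1)] *(2)])
qed

lemma near_one_power: "u \<in> V \<Longrightarrow> u + 1 \<in> M \<Longrightarrow> u ^ i + 1 \<in> M"
  by (induction i) (auto intro: near_one_mult V_power M_zero)

text \<open>Because \<open>x * \<tau> ^ q\<close> and \<open>y * \<tau> ^ (q + 1)\<close> are
  congruent to 1, the leading monomial contributes its coefficient \<open>c\<close>; the terms of
  lower weight keep a positive power of \<open>\<tau>\<close> and vanish.\<close>

lemma lead_coeff_pole:
  assumes "w \<in> A" "w \<noteq> 0"
  shows "\<exists>c\<in>k. c \<noteq> 0 \<and> w * \<tau> ^ wt w + c \<in> M"
  using assms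
proof (induction "wt w" arbitrary: w rule: less_induct)
  case less
  obtain c i j where c: "c \<in> k" "c \<noteq> 0" "wt w = q * i + (q + 1) * j"
    "w + c * x ^ i * y ^ j = 0 \<or> wt (w + c * x ^ i * y ^ j) < wt w"
    using leading[OF less.prems] by blast
  let ?m = "c * x ^ i * y ^ j" and ?u = "inverse s ^ i * inverse s ^ j"
  have sV: "inverse s \<in> V" "inverse s + 1 \<in> M"
  proof -
    show "inverse s \<in> V" using unit_inverse[OF s_unit] by blast
    have "inverse s + 1 = (s + 1) * inverse s" using s_nz by (simp add: field_simps)
    then show "inverse s + 1 \<in> M" using M_mult[OF s_one \<open>inverse s \<in> V\<close>] by simp
  qed
  have u: "?u + 1 \<in> M" using sV by (intro near_one_mult near_one_power V_power)
  have "?m * \<tau> ^ wt w = c * ((x * \<tau> ^ q) ^ i * (y * \<tau> ^ (q + 1)) ^ j)"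
  proof -
    have "\<tau> ^ wt w = (\<tau> ^ q) ^ i * (\<tau> ^ (q + 1)) ^ j" unfolding c(3) by (metis power_add power_mult)
    then show ?thesis unfolding power_mult_distrib by (simp only: mult_ac)
  qed
  also have "\<dots> = c * ?u" unfolding x_tau y_tau ..
  finally have "?m * \<tau> ^ wt w + c = c * (?u + 1)" by (simp add: algebra_simps)
  then have m: "?m * \<tau> ^ wt w + c \<in> M" using M_mult'[OF u k_V[OF c(1)]] by simp
  let ?v = "w + ?m"
  have v: "?v * \<tau> ^ wt w \<in> M"
  proof (cases "?v = 0")
    case True
    then show ?thesis using M_zero by simp
  next
    case False
    then have lt: "wt ?v < wt w" using c by simp
    have vA: "?v \<in> A" using less.prems(1) mono_A[OF c(1)] by (rule A_add)
    obtain c' where c': "c' \<in> k" "?v * \<tau> ^ wt ?v + c' \<in> M" using less.hyps[OF lt vA False] by blast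
    have "(?v * \<tau> ^ wt ?v + c') + c' \<in> V" by (rule V_add[OF M_V[OF c'(2)] k_V[OF c'(1)]])
    then have "?v * \<tau> ^ wt ?v \<in> V" by (simp add: add.assoc)
    moreover have "\<tau> ^ (wt w - wt ?v) \<in> M" using lt by (intro M_pow tau_M) simp
    ultimately have "?v * \<tau> ^ wt ?v * \<tau> ^ (wt w - wt ?v) \<in> M" by (rule M_mult'[rotated])
    then show ?thesis using lt by (simp add: mult.assoc flip: power_add)
  qed
  have eq: "w * \<tau> ^ wt w + c = ?v * \<tau> ^ wt w + (?m * \<tau> ^ wt w + c)"
    by (simp add: algebra_simps)
  have "w * \<tau> ^ wt w + c \<in> M" unfolding eq by (rule M_add[OF v m])
  then show ?case using c by blast
qed

lemma A_pole_unit: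
  assumes "w \<in> A" "w \<noteq> 0"
  shows "w * \<tau> ^ wt w \<in> V - M"
proof -
  obtain c where c: "c \<in> k" "c \<noteq> 0" "w * \<tau> ^ wt w + c \<in> M" using lead_coeff_pole[OF assms] by blast
  have "c + (w * \<tau> ^ wt w + c) \<in> V - M" by (rule unit_add[OF k_unit[OF c(1,2)] c(3)])
  moreover have "c + (w * \<tau> ^ wt w + c) = w * \<tau> ^ wt w" by (metis add.commute add_self_left)
  ultimately show ?thesis by simp
qed

lemma pole_decomp:
  assumes "g \<in> A" "h \<in> A" "g \<noteq> 0" "h \<noteq> 0"
  shows "\<exists>u. u \<in> V - M \<and> g / h = \<tau> powi (int (wt h) - int (wt g)) * u"
proof (intro exI[of _ "(g * \<tau> ^ wt g) * inverse (h * \<tau> ^ wt h)"] conjI)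
  show "(g * \<tau> ^ wt g) * inverse (h * \<tau> ^ wt h) \<in> V - M"
    by (rule unit_mult[OF A_pole_unit[OF assms(1,3)] unit_inverse[OF A_pole_unit[OF assms(2,4)]]])
  show "g / h = \<tau> powi (int (wt h) - int (wt g)) * (g * \<tau> ^ wt g * inverse (h * \<tau> ^ wt h))"
    using assms tau_nz by (simp add: power_int_diff field_simps)
qed

sublocale discrete_place k K V \<tau>
proof unfold_locales
  show decomp: "\<exists>n u. u \<in> V - M \<and> z = \<tau> powi n * u" if z: "z \<in> K" "z \<noteq> 0" for z
  proof -
    obtain g h where gh: "g \<in> A" "h \<in> A" "h \<noteq> 0" "z = g / h" by (rule K_E[OF z(1)])
    then have "g \<noteq> 0" using z by auto
    then show ?thesis using pole_decomp[OF gh(1,2) _ gh(3)] gh(4) by blast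
  qed
  show "uniformizer V \<tau>" by (rule uniformizerI[OF tau_M decomp])
qed

lemma pole_val:
  assumes "g \<in> A" "h \<in> A" "g \<noteq> 0" "h \<noteq> 0"
  shows "place_val V (g / h) = int (wt h) - int (wt g)"
  using pole_decomp[OF assms] place_val_eq[OF unif] by auto

lemma pole_val_A: "g \<in> A \<Longrightarrow> g \<noteq> 0 \<Longrightarrow> place_val V g = - int (wt g)"
  using pole_val[of g 1] A_1 wt_1 by simp

text \<open>A unit \<open>g / h\<close> has \<open>wt g = wt h\<close>, and its residue is the
  quotient of the two leading coefficients. Hence the pole has degree 1.\<close>

lemma residue_k:
  assumes "z \<in> V"
  shows "\<exists>c\<in>k. z + c \<in> M"
proof (cases "z \<in> M")
  case True
  then show ?thesis using k_zero by (intro bexI[of _ 0]) auto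
next
  case False
  then have z: "z \<noteq> 0" "z \<in> K" using M_zero V_K assms by auto
  obtain g h where gh: "g \<in> A" "h \<in> A" "h \<noteq> 0" "z = g / h" by (rule K_E[OF z(2)])
  have "g \<noteq> 0" using gh z by auto
  have "place_val V z = 0" using val_unit assms False by blast
  then have eq: "wt g = wt h" using pole_val[OF gh(1,2) \<open>g \<noteq> 0\<close> gh(3)] gh(4) by simp
  obtain c where c: "c \<in> k" "c \<noteq> 0" "g * \<tau> ^ wt g + c \<in> M" using lead_coeff_pole[OF gh(1) \<open>g \<noteq> 0\<close>] by blast
  obtain d where d: "d \<in> k" "d \<noteq> 0" "h * \<tau> ^ wt g + d \<in> M" using lead_coeff_pole[OF gh(2,3)] unfolding eq by blast
  define g' h' where "g' = g * \<tau> ^ wt g" and "h' = h * \<tau> ^ wt g"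
  have h'u: "h' \<in> V - M" unfolding h'_def eq using A_pole_unit gh by blast
  have h'0: "h' \<noteq> 0" using h'u unit_iff by blast
  have zgh: "z = g' / h'" unfolding gh(4) g'_def h'_def using tau_nz by simp
  have "z + c / d = (g' * d + c * h') * (inverse h' * inverse d)"
    unfolding zgh using h'0 d(2) by (simp add: field_simps)
  also have "g' * d + c * h' = (g' + c) * d + c * (h' + d)"
    by (simp add: algebra_simps)
  finally have "z + c / d = ((g' + c) * d + c * (h' + d)) * (inverse h' * inverse d)" .
  also have "\<dots> \<in> M"
  proof (rule M_mult)
    show "(g' + c) * d + c * (h' + d) \<in> M"
      using c d unfolding g'_def[symmetric] h'_def[symmetric]
      by (metis M_add M_mult M_mult' k_V)
    show "inverse h' * inverse d \<in> V" using unit_inverse[OF h'u] kinv[OF d(1)] k_V V_mult by blast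
  qed
  finally have "z + c / d \<in> M" .
  moreover have "c / d \<in> k" using c d kmult kinv by (simp add: field_class.field_divide_inverse)
  ultimately show ?thesis by blast
qed

end

section \<open>Existence and uniqueness of the place at infinity; intersection of local
  rings\<close>

context curve
begin

text \<open>The locale \<open>curve_pole\<close> describes a place where \<open>x\<close> has a
  pole, provided that there is one; this explicit ring supplies it.\<close>

definition pole_loc :: "'b set" where
  "pole_loc = {g / h | g h. g \<in> A \<and> h \<in> A \<and> h \<noteq> 0 \<and> (g = 0 \<or> wt g \<le> wt h)}"

lemma pole_locE:
  assumes "z \<in> pole_loc"
  obtains g h where "g \<in> A" "h \<in> A" "h \<noteq> 0" "g = 0 \<or> wt g \<le> wt h" "z = g / h"
  using assms unfolding pole_loc_def by blast

lemma pole_locI: "g \<in> A \<Longrightarrow> h \<in> A \<Longrightarrow> h \<noteq> 0 \<Longrightarrow> g = 0 \<or> wt g \<le> wt h \<Longrightarrow> g / h \<in> pole_loc"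
  unfolding pole_loc_def by blast

lemma x_notin_pole_loc: "x \<notin> pole_loc"
proof
  assume "x \<in> pole_loc"
  then obtain g h where gh: "g \<in> A" "h \<in> A" "h \<noteq> 0" "g = 0 \<or> wt g \<le> wt h" "x = g / h"
    by (rule pole_locE)
  then have g: "g = x * h" by (simp add: field_simps)
  then have "g \<noteq> 0" "wt g = q + wt h" using x_nz gh(3) wt_mult[OF x_A gh(2) x_nz gh(3)] wt_x by auto
  then show False using gh(4) q_pos by simp
qed

lemma pole_loc_place: "pole_loc \<in> places k K"
  unfolding places_def mem_Collect_eq subring_type_iff
proof (intro conjI ballI)
  have wt_le: "g' * h = 0 \<or> wt (g' * h) \<le> wt (h' * h)"
    if "g' \<in> A" "h \<in> A" "h' \<in> A" "h \<noteq> 0" "h' \<noteq> 0" "g' = 0 \<or> wt g' \<le> wt h'" for g' h h'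
    using that by (cases "g' = 0") (auto simp: wt_mult)
  fix a b assume "a \<in> pole_loc" "b \<in> pole_loc"
  then obtain g h g' h' where 1: "g \<in> A" "h \<in> A" "h \<noteq> 0" "g = 0 \<or> wt g \<le> wt h" "a = g / h"
    and 2: "g' \<in> A" "h' \<in> A" "h' \<noteq> 0" "g' = 0 \<or> wt g' \<le> wt h'" "b = g' / h'"
    by (metis pole_locE)
  have "a * b = (g * g') / (h * h')" using 1 2 by simp
  moreover have "g * g' = 0 \<or> wt (g * g') \<le> wt (h * h')"
    using 1 2 by (cases "g = 0"; cases "g' = 0") (auto simp: wt_mult)
  ultimately show "a * b \<in> pole_loc" using 1 2 by (auto intro!: pole_locI A_mult)
  have "a + b = (g * h' + g' * h) / (h * h')" using 1 2 by (simp add: field_simps)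
  \<comment> \<open>The bound in \<open>L\<close> is strict, hence \<open>Suc\<close>.\<close>
  moreover have "g * h' + g' * h \<in> L (Suc (wt (h * h')))"
    using wt_le[of g h' h] wt_le[of g' h h'] 1 2
    by (intro L_add) (auto simp: L_def less_Suc_eq_le mult.commute[of h' h] intro: A_mult)
  ultimately show "a + b \<in> pole_loc" using 1 2 by (auto intro!: pole_locI A_mult simp: L_def less_Suc_eq_le)
next
  show "k \<subset> pole_loc"
  proof (rule psubsetI)
    show "k \<subseteq> pole_loc"
    proof
      fix c assume c: "c \<in> k"
      then have "c = 0 \<or> wt c \<le> wt 1" using wt_const[of c] by (cases "c = 0") auto
      moreover have "c \<in> A" using c k_A by blast
      ultimately show "c \<in> pole_loc" using pole_locI[of c 1] A_1 by simp
    qed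
    have "1 / x \<in> pole_loc" using x_A A_1 x_nz wt_1 by (intro pole_locI) auto
    moreover have "1 / x \<notin> k"
    proof
      assume "1 / x \<in> k"
      then have "inverse (1 / x) \<in> k" by (rule kinv)
      then show False using wt_const[of x] x_nz wt_x q_pos by simp
    qed
    ultimately show "k \<noteq> pole_loc" by blast
  qed
  have "pole_loc \<subseteq> K" unfolding pole_loc_def using K_I by blast
  then show "pole_loc \<subset> K" using x_notin_pole_loc A_K[OF x_A] by blast
  show "z \<in> pole_loc \<or> inverse z \<in> pole_loc" if zK: "z \<in> K" for z
  proof -
    obtain g h where gh: "g \<in> A" "h \<in> A" "h \<noteq> 0" "z = g / h" by (rule K_E[OF zK])
    show ?thesis
    proof (cases "g = 0 \<or> wt g \<le> wt h")
      case True
      then show ?thesis using gh pole_locI by blast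
    next
      case False
      then have "h / g \<in> pole_loc" using gh by (intro pole_locI) auto
      then show ?thesis using gh by simp
    qed
  qed
  show "1 \<in> pole_loc" using pole_locI[of 1 1] A_1 by simp
qed (simp add: uminus_id)

text \<open>At any pole of \<open>x\<close> the valuation of \<open>g / h\<close> is
  \<open>wt h - wt g\<close>, an expression in which \<open>V\<close> does not occur.\<close>

lemma pole_place_unique:
  assumes "V \<in> places k K" "x \<notin> V"
  shows "V = pole_loc"
proof -
  interpret P: curve_pole k A x y a0 n q wt V
    by unfold_locales (use assms in auto)
  show ?thesis
  proof (intro equalityI subsetI)
    fix z assume z: "z \<in> V"
    obtain g h where gh: "g \<in> A" "h \<in> A" "h \<noteq> 0" "z = g / h" by (rule K_E[OF P.V_K[OF z]])
    have "g = 0 \<or> wt g \<le> wt h"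
      using P.pole_val[OF gh(1,2) _ gh(3)] P.val_nonneg_iff[OF P.V_K[OF z]] z gh by (cases "g = 0") auto
    then show "z \<in> pole_loc" using gh pole_locI by blast
  next
    fix z assume "z \<in> pole_loc"
    then obtain g h where gh: "g \<in> A" "h \<in> A" "h \<noteq> 0" "g = 0 \<or> wt g \<le> wt h" "z = g / h"
      by (rule pole_locE)
    then show "z \<in> V"
      using P.pole_val[OF gh(1,2) _ gh(3)] P.val_nonneg_iff[of z] P.V_zero K_I[OF gh(1,2)]
      by (cases "g = 0") auto
  qed
qed

text \<open>Zorn's lemma gives a maximal proper ideal \<open>J\<close> above \<open>I\<close>. By
  maximality \<open>J\<close> and any \<open>a\<close> outside it generate the unit ideal, and this
  makes \<open>J\<close> prime. The element \<open>w\<close> keeps it nonzero.\<close>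

lemma exists_prime_id:
  assumes I: "I \<subseteq> A" "\<And>a b. a \<in> I \<Longrightarrow> b \<in> I \<Longrightarrow> a + b \<in> I" "\<And>a b. a \<in> A \<Longrightarrow> b \<in> I \<Longrightarrow> a * b \<in> I"
    "1 \<notin> I" "w \<in> I" "w \<noteq> 0"
  shows "\<exists>m. prime_id m \<and> I \<subseteq> m"
proof -
  define ideals where "ideals = {J. I \<subseteq> J \<and> J \<subseteq> A \<and> (\<forall>a\<in>J. \<forall>b\<in>J. a + b \<in> J) \<and>
    (\<forall>a\<in>A. \<forall>b\<in>J. a * b \<in> J) \<and> 1 \<notin> J}"
  have "\<exists>J\<in>ideals. \<forall>Y\<in>ideals. J \<subseteq> Y \<longrightarrow> Y = J"
  proof (rule subset_Zorn_nonempty)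
    have "I \<in> ideals" unfolding ideals_def mem_Collect_eq
      using I(1-4) by (intro conjI ballI subset_refl) auto
    then show "ideals \<noteq> {}" by blast
    fix C assume C: "C \<noteq> {}" "subset.chain ideals C"
    then have ideal: "J \<in> ideals" if "J \<in> C" for J
      using that by (auto simp: subset.chain_def)
    have directed: "Z \<subseteq> Y \<or> Y \<subseteq> Z" if "Z \<in> C" "Y \<in> C" for Z Y
      using C(2) that by (auto simp: subset.chain_def)
    have "a + b \<in> \<Union>C" if ab: "a \<in> \<Union>C" "b \<in> \<Union>C" for a b
    proof -
      obtain Z Y where XY: "Z \<in> C" "a \<in> Z" "Y \<in> C" "b \<in> Y" using ab by blast
      from directed[OF XY(1,3)] show ?thesis
      proof
        assume "Z \<subseteq> Y"
        then have "a + b \<in> Y" using XY ideal[OF XY(3)] by (auto simp: ideals_def)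
        then show ?thesis using XY by blast
      next
        assume "Y \<subseteq> Z"
        then have "a + b \<in> Z" using XY ideal[OF XY(1)] by (auto simp: ideals_def)
        then show ?thesis using XY by blast
      qed
    qed
    moreover have "a * b \<in> \<Union>C" if ab: "a \<in> A" "b \<in> \<Union>C" for a b
    proof -
      obtain Y where "Y \<in> C" "b \<in> Y" using ab by blast
      then have "a * b \<in> Y" using ideal[of Y] ab(1) by (simp add: ideals_def)
      then show ?thesis using \<open>Y \<in> C\<close> by blast
    qed
    moreover have "I \<subseteq> \<Union>C"
    proof -
      obtain Y where "Y \<in> C" using C(1) by blast
      then have "I \<subseteq> Y" using ideal[of Y] by (simp add: ideals_def)
      then show ?thesis using \<open>Y \<in> C\<close> by blast
    qed
    moreover have "J \<subseteq> A \<and> 1 \<notin> J" if "J \<in> C" for J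
      using ideal[OF that] by (simp add: ideals_def)
    then have "\<Union>C \<subseteq> A" "1 \<notin> \<Union>C" by blast+
    ultimately show "\<Union>C \<in> ideals" unfolding ideals_def mem_Collect_eq by (intro conjI ballI)
  qed
  then obtain J where J: "J \<in> ideals" and max: "\<And>Z. Z \<in> ideals \<Longrightarrow> J \<subseteq> Z \<Longrightarrow> Z = J" by blast
  have J': "I \<subseteq> J" "J \<subseteq> A" "\<And>a b. a \<in> J \<Longrightarrow> b \<in> J \<Longrightarrow> a + b \<in> J"
    "\<And>a b. a \<in> A \<Longrightarrow> b \<in> J \<Longrightarrow> a * b \<in> J" "1 \<notin> J"
    using J by (simp_all add: ideals_def)
  have ext: "\<exists>j\<in>J. \<exists>c\<in>A. 1 = j + a * c" if a: "a \<in> A" "a \<notin> J" for a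
  proof (rule ccontr)
    assume contra: "\<not> ?thesis"
    let ?X = "{j + a * c | j c. j \<in> J \<and> c \<in> A}"
    have sub: "J \<subseteq> ?X" using A_0 by force
    have "?X \<in> ideals"
      unfolding ideals_def
    proof (rule CollectI, intro conjI ballI)
      show "I \<subseteq> ?X" using sub J' by blast
      show "?X \<subseteq> A" using J'(2) a(1) by (auto intro!: A_add A_mult)
      fix u v assume "u \<in> ?X" "v \<in> ?X"
      then obtain j c j' c' where *: "j \<in> J" "c \<in> A" "u = j + a * c" "j' \<in> J" "c' \<in> A" "v = j' + a * c'" by blast
      have "u + v = (j + j') + a * (c + c')" unfolding * by (simp add: algebra_simps)
      then show "u + v \<in> ?X" using J'(3)[OF *(1,4)] A_add[OF *(2,5)] by blast
    next
      fix u v assume "u \<in> A" "v \<in> ?X"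
      then obtain j c where *: "j \<in> J" "c \<in> A" "v = j + a * c" by blast
      have "u * v = u * j + a * (u * c)" unfolding * by (simp add: algebra_simps)
      then show "u * v \<in> ?X" using J'(4)[OF \<open>u \<in> A\<close> *(1)] A_mult[OF \<open>u \<in> A\<close> *(2)] by blast
    next
      show "1 \<notin> ?X" using contra by blast
    qed
    then have "?X = J" using max sub by blast
    moreover have "0 \<in> J" using J'(4)[OF A_0] I(5) J'(1) by auto
    then have "a \<in> ?X" using A_1 by force
    ultimately show False using a by simp
  qed
  have "a \<in> J \<or> b \<in> J" if ab: "a \<in> A" "b \<in> A" "a * b \<in> J" for a b
  proof (rule ccontr)
    assume nb: "\<not> (a \<in> J \<or> b \<in> J)"
    then obtain j c where jc: "j \<in> J" "c \<in> A" "1 = j + a * c" using ext[OF ab(1)] by blast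
    have "b = (j + a * c) * b" using jc(3) by simp
    then have "b = b * j + c * (a * b)" by (simp add: algebra_simps)
    moreover have "b * j \<in> J" "c * (a * b) \<in> J" using J'(4) ab jc by auto
    ultimately have "b \<in> J" using J'(3) by metis
    then show False using nb by blast
  qed
  moreover have "\<exists>w\<in>J. w \<noteq> 0" using I(5,6) J'(1) by blast
  ultimately have "prime_id J" unfolding prime_id_def
    using J'(2-5) by (intro conjI ballI impI) auto
  then show ?thesis using J'(1) by blast
qed

text \<open>The denominators of \<open>z\<close> form an ideal. Were it proper, it would lie in some
  prime \<open>m\<close>, although \<open>z\<close> has a denominator outside
  \<open>m\<close>.\<close>

lemma inter_loc:
  assumes "z \<in> K" "\<And>m. prime_id m \<Longrightarrow> z \<in> loc m"
  shows "z \<in> A"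
proof -
  define I where "I = {h \<in> A. h * z \<in> A}"
  obtain g h where gh: "g \<in> A" "h \<in> A" "h \<noteq> 0" "z = g / h" by (rule K_E[OF assms(1)])
  have "1 \<in> I"
  proof (rule ccontr)
    assume "1 \<notin> I"
    have "\<exists>m. prime_id m \<and> I \<subseteq> m"
    proof (rule exists_prime_id)
      show "h \<in> I" unfolding I_def using gh by simp
      show "h \<noteq> 0" "1 \<notin> I" by fact+
    qed (auto simp: I_def distrib_right mult.assoc intro: A_add A_mult)
    then obtain m where m: "prime_id m" "I \<subseteq> m" by blast
    obtain g' h' where g'h': "g' \<in> A" "h' \<in> A" "h' \<notin> m" "h' \<noteq> 0" "z = g' / h'"
      by (rule locE[OF m(1) assms(2)[OF m(1)]])
    then have "h' \<in> I" unfolding I_def by simp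
    then show False using m g'h' by blast
  qed
  then show ?thesis unfolding I_def by simp
qed

end

section \<open>Riemann-Roch spaces\<close>

context place_of
begin

text \<open>In this form it is literally a coset of the quotient ring, so the carrier of
  \<open>residue_field V\<close> is the image of \<open>V\<close> under
  \<open>residue\<close>.\<close>

definition residue :: "'a \<Rightarrow> 'a set" where "residue z = (\<lambda>a. a + z) ` M"

lemma residue_eq_iff: "residue z = residue w \<longleftrightarrow> z - w \<in> M"
proof
  assume "residue z = residue w"
  moreover have "z \<in> residue z" unfolding residue_def using M_zero by force
  ultimately obtain a where "a \<in> M" "z = a + w" unfolding residue_def by blast
  then show "z - w \<in> M" by simp
next
  have *: "residue z \<subseteq> residue w" if "z - w \<in> M" for z w
  proof
    fix v assume "v \<in> residue z"
    then obtain a where "a \<in> M" "v = a + z" unfolding residue_def by blast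
    then have "v = (a + (z - w)) + w" "a + (z - w) \<in> M" using that M_add by auto
    then show "v \<in> residue w" unfolding residue_def by blast
  qed
  assume "z - w \<in> M"
  moreover have "w - z \<in> M" using M_uminus[OF \<open>z - w \<in> M\<close>] by simp
  ultimately show "residue z = residue w" using * by blast
qed

lemma residue_inj_k: "inj_on residue k"
proof (rule inj_onI)
  fix c d assume cd: "c \<in> k" "d \<in> k" "residue c = residue d"
  then have "c - d \<in> M" by (simp add: residue_eq_iff)
  moreover have "c - d \<in> k" using k_add[OF cd(1) k_uminus[OF cd(2)]] by simp
  ultimately show "c = d" using k_unit[of "c - d"] by auto
qed

text \<open>The degree is a dimension over the image of \<open>k\<close> in the quotient. This image
  is a subfield with \<open>card k\<close> elements because \<open>M\<close> contains no nonzero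
  constant.\<close>

lemma card_residue_field:
  assumes fin: "finite (residue ` V)"
  shows "card (residue ` V) = card k ^ place_degree k V"
proof -
  define R where "R = (ring_of_type_algebra :: 'a ring)\<lparr>carrier := V\<rparr>"
  interpret T: field "ring_of_type_algebra :: 'a ring" by rule
  have sub: "subring V (ring_of_type_algebra :: 'a ring)" using V_place by (simp add: places_def)
  have "ring R" unfolding R_def by (rule T.subring_is_ring[OF sub])
  interpret R: ring R by fact
  have simps: "carrier R = V" "\<And>a b. a \<oplus>\<^bsub>R\<^esub> b = a + b" "\<And>a b. a \<otimes>\<^bsub>R\<^esub> b = a * b" "\<one>\<^bsub>R\<^esub> = 1" "\<zero>\<^bsub>R\<^esub> = 0"
    unfolding R_def by (simp_all add: ring_of_type_algebra_def)
  have inv: "\<ominus>\<^bsub>R\<^esub> a = - a" if "a \<in> V" for a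
    using R.minus_equality[of "- a" a] that V_uminus by (simp add: simps)
  have "ideal M R"
  proof (rule idealI)
    show "subgroup M (add_monoid R)"
      by (rule R.add.subgroupI) (use M_V M_zero M_add M_uminus inv in \<open>auto simp: simps simp flip: a_inv_def\<close>)
  qed (auto simp: simps intro: M_mult M_mult' \<open>ring R\<close>)
  interpret I: ideal M R by fact
  define Q where "Q = residue_field V"
  have Q: "Q = R Quot M" unfolding Q_def residue_field_def R_def ..
  have hom: "(+>\<^bsub>R\<^esub>) M \<in> ring_hom R Q" unfolding Q by (rule I.rcos_ring_hom)
  interpret Q: ring Q unfolding Q by (rule I.quotient_is_ring)
  interpret H: ring_hom_ring R Q "(+>\<^bsub>R\<^esub>) M"
    by (intro ring_hom_ringI2 hom) unfold_locales
  have rc: "M +>\<^bsub>R\<^esub> z = residue z" for z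
    unfolding a_r_coset_def' residue_def simps by auto
  have carr: "carrier Q = residue ` V"
    unfolding Q FactRing_def A_RCOSETS_def' by (auto simp: simps rc)
  have "field (R\<lparr>carrier := k\<rparr>)" using T.subfield_iff(2)[OF subfield_k] by (simp add: R_def)
  then have subk: "subfield k R" by (rule R.subfield_iff(1)) (use k_V in \<open>auto simp: simps\<close>)
  have "\<one>\<^bsub>Q\<^esub> \<noteq> \<zero>\<^bsub>Q\<^esub>"
  proof -
    have "residue 1 \<noteq> M" using residue_eq_iff[of 1 0] one_notin_M by (simp add: residue_def)
    then show ?thesis unfolding Q by (simp add: FactRing_def simps rc)
  qed
  from H.img_is_subfield(2)[OF subk this] have sf: "subfield (residue ` k) Q" by (simp add: rc)
  have "card (carrier Q) = card (residue ` k) ^ ring.dim Q (residue ` k) (carrier Q)"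
  proof (rule Q.card_eq_power_dim[OF sf])
    show "c \<otimes>\<^bsub>Q\<^esub> a \<in> carrier Q" if "c \<in> residue ` k" "a \<in> carrier Q" for c a
      using that k_V carr by (intro Q.m_closed) auto
    show "finite (residue ` k)" using finite_k by simp
    show "finite (carrier Q)" using fin carr by simp
  qed auto
  moreover have "place_degree k V = ring.dim Q (residue ` k) (carrier Q)"
    unfolding place_degree_def Q_def[symmetric] R_def[symmetric] rc ..
  ultimately show ?thesis unfolding carr by (simp add: card_image[OF residue_inj_k])
qed

lemma place_degree_one_iff:
  assumes fin: "finite (residue ` V)"
  shows "place_degree k V = 1 \<longleftrightarrow> (\<forall>z\<in>V. \<exists>c\<in>k. z - c \<in> M)"
proof -
  have sub: "residue ` k \<subseteq> residue ` V" using k_V by blast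
  have "place_degree k V = 1 \<longleftrightarrow> card k ^ place_degree k V = card k ^ 1"
    using card_k_ge2 by (subst power_inject_exp) auto
  also have "\<dots> \<longleftrightarrow> card (residue ` V) = card (residue ` k)"
    using card_residue_field[OF fin] by (simp add: card_image[OF residue_inj_k])
  also have "\<dots> \<longleftrightarrow> residue ` V = residue ` k"
    using card_subset_eq[OF fin sub] by metis
  also have "\<dots> \<longleftrightarrow> residue ` V \<subseteq> residue ` k" using sub by blast
  also have "\<dots> \<longleftrightarrow> (\<forall>z\<in>V. \<exists>c\<in>k. residue z = residue c)" by (simp add: image_subset_iff image_iff)
  finally show ?thesis by (simp add: residue_eq_iff)
qed

end

section \<open>Growth of Riemann-Roch spaces\<close>

context subfield_pair
begin

text \<open>The two facts about places from which the growth estimates follow for any function field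
  over \<open>k\<close>; for the curve they are established in \<open>nice\<close>.\<close>

definition places_discrete_finite :: bool where
  "places_discrete_finite \<longleftrightarrow> (\<forall>V\<in>places k K. (\<exists>t. discrete_place k K V t) \<and> finite (place_of.residue V ` V))"

abbreviation "RR \<equiv> riemann_roch_space k K"

lemma RR_iff: "z \<in> RR D \<longleftrightarrow> z \<in> K \<and> (\<forall>V\<in>places k K. z = 0 \<or> place_val V z \<ge> - D V)"
  unfolding riemann_roch_space_def by blast

lemma RR_mono: "(\<And>V. D V \<le> D' V) \<Longrightarrow> RR D \<subseteq> RR D'"
  unfolding RR_iff subset_iff by (meson neg_le_iff_le order_trans)

context
  assumes nice: places_discrete_finite
begin

lemma RR_closed:
  shows "0 \<in> RR D" and "a \<in> RR D \<Longrightarrow> b \<in> RR D \<Longrightarrow> a + b \<in> RR D"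
    and "a \<in> RR D \<Longrightarrow> - a \<in> RR D"
    and "c \<in> k \<Longrightarrow> a \<in> RR D \<Longrightarrow> c * a \<in> RR D"
proof -
  show "0 \<in> RR D" by (simp add: RR_iff K_zero)
  have ex: "\<exists>t. discrete_place k K V t" if "V \<in> places k K" for V
    using nice that by (auto simp: places_discrete_finite_def)
  show "a + b \<in> RR D" if ab: "a \<in> RR D" "b \<in> RR D"
    unfolding RR_iff
  proof (intro conjI ballI)
    show "a + b \<in> K" using ab by (auto simp: RR_iff K_add)
    fix V assume V: "V \<in> places k K"
    then obtain t where "discrete_place k K V t" using ex by blast
    then interpret discrete_place k K V t .
    have "a = 0 \<or> place_val V a \<ge> - D V" "b = 0 \<or> place_val V b \<ge> - D V" "a \<in> K" "b \<in> K"
      using ab V by (auto simp: RR_iff)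
    then have "a * t powi (- (- D V)) \<in> V" "b * t powi (- (- D V)) \<in> V"
      using val_ge_iff0 by blast+
    then have "(a + b) * t powi (- (- D V)) \<in> V" by (simp add: distrib_right V_add)
    then show "a + b = 0 \<or> place_val V (a + b) \<ge> - D V" using val_ge_iff0[OF \<open>a + b \<in> K\<close>] by blast
  qed
  show smult: "c * a \<in> RR D" if ca: "c \<in> k" "a \<in> RR D" for c
    unfolding RR_iff
  proof (intro conjI ballI)
    show "c * a \<in> K" using ca k_sub_K by (auto simp: RR_iff K_mult)
    fix V assume V: "V \<in> places k K"
    then obtain t where "discrete_place k K V t" using ex by blast
    then interpret discrete_place k K V t .
    have "a = 0 \<or> place_val V a \<ge> - D V" "a \<in> K" using ca V by (auto simp: RR_iff)
    then have "a * t powi (- (- D V)) \<in> V" using val_ge_iff0 by blast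
    then have "c * a * t powi (- (- D V)) \<in> V" using V_mult[OF k_V[OF ca(1)]] by (simp add: mult.assoc)
    then show "c * a = 0 \<or> place_val V (c * a) \<ge> - D V" using val_ge_iff0[OF \<open>c * a \<in> K\<close>] by blast
  qed
  show "- a \<in> RR D" if "a \<in> RR D"
    using smult[OF k_uminus[OF k_one] that] by simp
qed

lemma card_RR:
  assumes "finite (RR D)"
  shows "card (RR D) = card k ^ ring.dim ring_of_type_algebra k (RR D)"
proof -
  interpret T: field "ring_of_type_algebra :: 'b ring" by rule
  show ?thesis
    by (rule T.card_eq_power_dim[OF subfield_k finite_k]) (use assms RR_closed in auto)
qed

text \<open>Send \<open>z\<close> to the residue of \<open>z * t powi (D V + 1)\<close>, its leading
  coefficient at \<open>V\<close>. Elements with the same image differ by an element of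
  \<open>RR D\<close>, and the number of images is at most the size of the residue field.\<close>

lemma RR_step:
  assumes V: "V \<in> places k K" and fin: "finite (RR (D(V := D V + 1)))"
  shows "card (RR (D(V := D V + 1))) \<le> card (RR D) * card k ^ place_degree k V"
proof -
  let ?D = "D(V := D V + 1)"
  obtain t where "discrete_place k K V t" and finr: "finite (place_of.residue V ` V)"
    using nice V by (auto simp: places_discrete_finite_def)
  then interpret discrete_place k K V t by blast
  define f where "f = (\<lambda>z. residue (z * t powi (D V + 1)))"
  have finD: "finite (RR D)" by (rule finite_subset[OF RR_mono fin]) simp
  have img: "f ` RR ?D \<subseteq> residue ` V"
  proof
    fix u assume "u \<in> f ` RR ?D"
    then obtain z where z: "z \<in> RR ?D" "u = f z" by blast
    then have "z = 0 \<or> place_val V z \<ge> - (D V + 1)" "z \<in> K" using V by (auto simp: RR_iff)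
    then have "z * t powi (- (- (D V + 1))) \<in> V" using val_ge_iff0 by blast
    then have "z * t powi (D V + 1) \<in> V" by (simp only: minus_minus)
    then show "u \<in> residue ` V" unfolding z(2) f_def by (rule imageI)
  qed
  have "card (RR ?D) \<le> card (f ` RR ?D) * card (RR D)"
  proof (rule card_le_image_mult[OF fin finD])
    fix g h assume gh: "g \<in> RR ?D" "h \<in> RR ?D" "f g = f h"
    then have "h * t powi (D V + 1) - g * t powi (D V + 1) \<in> M" using residue_eq_iff f_def by metis
    then have M: "(h - g) * t powi (- (- (D V + 1))) \<in> M" by (simp only: left_diff_distrib minus_minus)
    have hg: "h - g \<in> RR ?D" using RR_closed(2)[OF gh(2) RR_closed(3)[OF gh(1)]] by simp
    then have hgK: "h - g \<in> K" by (simp add: RR_iff)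
    show "h - g \<in> RR D" unfolding RR_iff
    proof (intro conjI ballI)
      fix W assume W: "W \<in> places k K"
      show "h - g = 0 \<or> place_val W (h - g) \<ge> - D W"
      proof (cases "W = V")
        case True
        then show ?thesis using val_Suc_iff0[OF hgK, of "- (D V + 1)"] M by simp
      next
        case False
        have "h - g = 0 \<or> place_val W (h - g) \<ge> - ?D W" using hg W unfolding RR_iff by blast
        then show ?thesis using False by simp
      qed
    qed (rule hgK)
  qed
  also have "\<dots> \<le> card (residue ` V) * card (RR D)"
    using card_mono[OF finr img] by simp
  finally show ?thesis using card_residue_field[OF finr] by (simp add: mult.commute)
qed

text \<open>\<open>D\<close> is raised to \<open>D'\<close> by one unit at one place at a
  time.\<close>

lemma RR_growth:
  assumes "finite S" "S \<subseteq> places k K" "\<And>V. D V \<le> D' V" "\<And>V. V \<notin> S \<Longrightarrow> D V = D' V" "finite (RR D')"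
  shows "card (RR D') \<le> card (RR D) * card k ^ (\<Sum>V\<in>S. nat (D' V - D V) * place_degree k V)"
  using assms
proof (induction "\<Sum>V\<in>S. nat (D' V - D V)" arbitrary: D rule: less_induct)
  case less
  show ?case
  proof (cases "D = D'")
    case False
    then obtain V where V: "V \<in> S" "D V < D' V"
      using less.prems(3,4) by (metis ext order.not_eq_order_implies_strict)
    let ?E = "D(V := D V + 1)"
    have EV: "nat (D' V - D V) = Suc (nat (D' V - ?E V))" using V by simp
    have fin: "finite (RR ?E)"
      by (rule finite_subset[OF RR_mono less.prems(5)]) (use V less.prems(3) in auto)
    have rest: "(\<Sum>W\<in>S. nat (D' W - D W) * f W) = (\<Sum>W\<in>S. nat (D' W - ?E W) * f W) + f V" for f :: "_ \<Rightarrow> nat"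
    proof -
      have "(\<Sum>W\<in>S. nat (D' W - D W) * f W) = nat (D' V - D V) * f V + (\<Sum>W\<in>S - {V}. nat (D' W - D W) * f W)"
        by (rule sum.remove[OF less.prems(1) V(1)])
      moreover have "(\<Sum>W\<in>S. nat (D' W - ?E W) * f W) = nat (D' V - ?E V) * f V + (\<Sum>W\<in>S - {V}. nat (D' W - ?E W) * f W)"
        by (rule sum.remove[OF less.prems(1) V(1)])
      moreover have "(\<Sum>W\<in>S - {V}. nat (D' W - ?E W) * f W) = (\<Sum>W\<in>S - {V}. nat (D' W - D W) * f W)"
        by (rule sum.cong) auto
      ultimately show ?thesis unfolding EV by simp
    qed
    have "card (RR D') \<le> card (RR ?E) * card k ^ (\<Sum>W\<in>S. nat (D' W - ?E W) * place_degree k W)"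
    proof (rule less.hyps)
      show "(\<Sum>W\<in>S. nat (D' W - ?E W)) < (\<Sum>W\<in>S. nat (D' W - D W))"
        using rest[of "\<lambda>_. 1"] by simp
    qed (use less.prems V in auto)
    also have "\<dots> \<le> card (RR D) * card k ^ place_degree k V * card k ^ (\<Sum>W\<in>S. nat (D' W - ?E W) * place_degree k W)"
      using RR_step[of V D] less.prems(2) V fin by (intro mult_right_mono) auto
    also have "\<dots> = card (RR D) * card k ^ (\<Sum>W\<in>S. nat (D' W - D W) * place_degree k W)"
      unfolding rest[of "place_degree k"] by (simp add: power_add mult_ac)
    finally show ?thesis .
  qed simp
qed

lemma divisor_degree_eq:
  assumes "finite S" "{V. D V \<noteq> 0} \<subseteq> S"
  shows "divisor_degree k D = (\<Sum>V\<in>S. D V * int (place_degree k V))"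
  unfolding divisor_degree_def by (rule sum.mono_neutral_left) (use assms in auto)

text \<open>Adding a place raises the degree by its degree and the dimension by at most as much. So
  a bound for \<open>deg D - l(D)\<close> passes down from any larger divisor with finite
  Riemann-Roch space.\<close>

lemma riemann_monotone:
  assumes D: "D \<in> divisors k K" "D' \<in> divisors k K" "\<And>V. D V \<le> D' V" and fin: "finite (RR D')"
  shows "divisor_degree k D - int (ring.dim ring_of_type_algebra k (RR D))
       \<le> divisor_degree k D' - int (ring.dim ring_of_type_algebra k (RR D'))"
proof -
  let ?l = "\<lambda>D. ring.dim ring_of_type_algebra k (RR D)"
  define S where "S = {V. D V \<noteq> 0} \<union> {V. D' V \<noteq> 0}"
  have S: "finite S" "S \<subseteq> places k K" using D by (auto simp: S_def divisors_def)
  have finD: "finite (RR D)" by (rule finite_subset[OF RR_mono[OF D(3)] fin])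
  let ?e = "\<Sum>V\<in>S. nat (D' V - D V) * place_degree k V"
  have "card k ^ ?l D' \<le> card k ^ ?l D * card k ^ ?e"
    using RR_growth[OF S D(3) _ fin] card_RR[OF fin] card_RR[OF finD] by (auto simp: S_def)
  then have "card k ^ ?l D' \<le> card k ^ (?l D + ?e)" by (simp add: power_add)
  then have "?l D' \<le> ?l D + ?e" using card_k_ge2 by (subst (asm) power_increasing_iff) auto
  then have "int (?l D') \<le> int (?l D) + int ?e" by linarith
  moreover have "int ?e = (\<Sum>V\<in>S. (D' V - D V) * int (place_degree k V))"
    unfolding of_nat_sum of_nat_mult using D(3) by (intro sum.cong) auto
  moreover have "\<dots> = divisor_degree k D' - divisor_degree k D"
    using divisor_degree_eq[OF S(1), of D] divisor_degree_eq[OF S(1), of D']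
    by (simp add: S_def left_diff_distrib sum_subtractf)
  ultimately show ?thesis by linarith
qed

end

end

section \<open>Residues on the curve and the zeros of T N\<close>

context curve_prime
begin

lemma residue_loc: "residue ` loc m = residue ` A"
proof
  show "residue ` loc m \<subseteq> residue ` A"
  proof (rule image_subsetI)
    fix z assume "z \<in> loc m"
    then obtain a where "a \<in> A" "z + a \<in> M" using residue_A by blast
    then have "residue z = residue a" by (simp add: residue_eq_iff minus_eq_plus)
    then show "residue z \<in> residue ` A" using \<open>a \<in> A\<close> by simp
  qed
qed (use A_loc in blast)

lemma finite_residues: "finite (residue ` loc m)"
proof -
  have "residue (g + T N * a) = residue g" if "a \<in> A" for g a
    using M_mult[OF t_M A_loc[OF that]] by (simp add: residue_eq_iff)
  then have "finite (residue ` A)"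
    using coset_count[of "T N" "\<kappa> ^ N" residue] T_A T_wt[OF N] by simp
  then show ?thesis by (simp add: residue_loc)
qed

lemma near_one_prod: "(\<And>i. i \<in> I \<Longrightarrow> f i \<in> A \<and> f i + 1 \<in> m) \<Longrightarrow> prod f I + 1 \<in> m"
proof (induction I rule: infinite_finite_induct)
  case (insert i I)
  have eq: "prod f (insert i I) + 1 = f i * (prod f I + 1) + (f i + 1)"
    using insert.hyps by (simp add: algebra_simps)
  have "prod f I + 1 \<in> m" using insert.IH insert.prems by simp
  then show ?case unfolding eq using insert.prems[of i] m_add m_mult by blast
qed (use m_0 in auto)

lemma m_sum: "(\<And>i. i \<in> I \<Longrightarrow> f i \<in> m) \<Longrightarrow> sum f I \<in> m"
  by (induction I rule: infinite_finite_induct) (auto intro: m_0 m_add)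

end

context curve_pole
begin

lemma residue_pole: "residue ` V = residue ` k"
proof
  show "residue ` V \<subseteq> residue ` k"
  proof (rule image_subsetI)
    fix z assume "z \<in> V"
    then obtain c where "c \<in> k" "z + c \<in> M" using residue_k by blast
    then have "residue z = residue c" by (simp add: residue_eq_iff minus_eq_plus)
    then show "residue z \<in> residue ` k" using \<open>c \<in> k\<close> by simp
  qed
qed (use k_V in blast)

lemma finite_residues: "finite (residue ` V)"
  using finite_k by (simp add: residue_pole)

lemma place_degree_pole: "place_degree k V = 1"
  using place_degree_one_iff[OF finite_residues] residue_k by (auto simp: minus_eq_plus)

end

context curve
begin

lemma curve_primeI: "prime_id m \<Longrightarrow> N \<ge> 1 \<Longrightarrow> T N \<in> m \<Longrightarrow> curve_prime k A x y a0 n q wt m N"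
  by unfold_locales

lemma curve_poleI: "V \<in> places k K \<Longrightarrow> x \<notin> V \<Longrightarrow> curve_pole k A x y a0 n q wt V"
  by unfold_locales

lemma pole_loc_curve_pole: "curve_pole k A x y a0 n q wt pole_loc"
  by (rule curve_poleI[OF pole_loc_place x_notin_pole_loc])

definition center :: "'b set \<Rightarrow> 'b set" where "center V = A \<inter> max_ideal V"

lemma center_place:
  assumes V: "V \<in> places k K" and x: "x \<in> V"
  shows "prime_id (center V)" and "V = loc (center V)" and "A \<subseteq> V"
proof -
  interpret P: curve_place k A x y a0 n q wt V by unfold_locales (rule V)
  show "prime_id (center V)" unfolding center_def by (rule P.center_prime[OF x])
  show "V = loc (center V)" unfolding center_def by (rule P.finite_place_eq[OF x])
  show "A \<subseteq> V" by (rule P.A_sub_V[OF x])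
qed

definition zeros :: "nat \<Rightarrow> 'b set set" where
  "zeros N = {V \<in> places k K. x \<in> V \<and> T N \<in> max_ideal V}"

lemma zerosD:
  assumes "V \<in> zeros N" "N \<ge> 1"
  shows "V \<in> places k K" "x \<in> V" "T N \<in> center V" "curve_prime k A x y a0 n q wt (center V) N"
    and "V = loc (center V)" "A \<subseteq> V"
  using assms center_place T_A by (auto simp: zeros_def center_def[symmetric] intro!: curve_primeI)
     (auto simp: center_def)

lemma finite_place_zeros:
  assumes "V \<in> places k K" "x \<in> V"
  shows "\<exists>N\<ge>1. V \<in> zeros N"
  using prime_id_T[OF center_place(1)[OF assms]] assms by (auto simp: zeros_def center_def)

text \<open>Passing to multiples of \<open>N\<close> keeps the zeros, so that one common
  \<open>N\<close> serves finitely many places.\<close>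

lemma zeros_mult:
  assumes "V \<in> zeros N" "N \<ge> 1"
  shows "V \<in> zeros (N * Suc e)"
proof -
  interpret P: curve_prime k A x y a0 n q wt "center V" N by (rule zerosD(4)[OF assms])
  have "T (N * Suc e) \<in> center V"
  proof (induction e)
    case 0
    then show ?case using P.T_m by simp
  next
    case (Suc e)
    have "\<kappa> ^ (N * Suc (Suc e)) = \<kappa> ^ (N * Suc e) * \<kappa> ^ N"
      by (metis add.commute mult_Suc_right power_add)
    then have "T (N * Suc (Suc e)) = T (N * Suc e) ^ (\<kappa> ^ N) + T N"
      by (simp only: T_def power_mult kappa_add) (simp add: add.assoc)
    moreover have "\<kappa> ^ N > 0" using kappa_ge2 by simp
    ultimately show ?case using P.m_add[OF prime_id_power'[OF P.m Suc] P.T_m] by simp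
  qed
  then show ?thesis using zerosD[OF assms] by (auto simp: zeros_def center_def)
qed

lemma zeros_discrete:
  assumes "V \<in> zeros N" "N \<ge> 1"
  shows "discrete_place k K V (T N)" and "finite (place_of.residue V ` V)" and "place_of.residue V ` V = place_of.residue V ` A"
proof -
  interpret P: curve_prime k A x y a0 n q wt "center V" N by (rule zerosD(4)[OF assms])
  show "discrete_place k K V (T N)" "finite (place_of.residue V ` V)" "place_of.residue V ` V = place_of.residue V ` A"
    using P.discrete_place_axioms P.finite_residues P.residue_loc zerosD(5)[OF assms] by simp_all
qed

lemma nice: places_discrete_finite
  unfolding places_discrete_finite_def
proof
  fix V assume V: "V \<in> places k K"
  show "(\<exists>t. discrete_place k K V t) \<and> finite (place_of.residue V ` V)"
  proof (cases "x \<in> V")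
    case True
    then show ?thesis using finite_place_zeros[OF V] zeros_discrete by blast
  next
    case False
    then interpret P: curve_pole k A x y a0 n q wt V using V by (intro curve_poleI)
    show ?thesis using P.discrete_place_axioms P.finite_residues by blast
  qed
qed

text \<open>Modulo \<open>T N\<close> the power \<open>b ^ Suc r\<close>, with exponent
  \<open>\<kappa> ^ (2 * N) - 1\<close>, behaves like an idempotent: it is 1 at a prime that does
  not contain \<open>b\<close> and 0 at a prime that does.\<close>

lemma separate_primes:
  assumes m: "prime_id m" "prime_id m'" and N: "N \<ge> 1" "T N \<in> m" "T N \<in> m'" and neq: "m \<noteq> m'"
  shows "\<exists>a\<in>A. a \<in> m' \<and> a + 1 \<in> m"
proof -
  obtain r where r: "\<kappa> ^ (2 * N) = Suc (Suc r)"
    using kappa_pow_gt1[of "2 * N"] N by (metis One_nat_def Suc_lessE less_imp_Suc_add mult_2 trans_le_add1)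
  have unit: "b ^ Suc r + 1 \<in> m" if b: "prime_id m" "T N \<in> m" "b \<in> A" "b \<notin> m" for b m
  proof -
    obtain a where a: "a \<in> A" "b ^ Suc (Suc r) + b = T N * a" using A_frob[OF b(3), of N] unfolding r by blast
    have "b * (b ^ Suc r + 1) = a * T N" using a(2) by (simp add: algebra_simps)
    then have "b * (b ^ Suc r + 1) \<in> m" using prime_idD(3)[OF b(1) a(1) b(2)] by simp
    moreover have "b ^ Suc r + 1 \<in> A" by (intro A_add A_1 A_power b)
    ultimately show ?thesis using prime_idD(5)[OF b(1,3)] b(4) by blast
  qed
  have E: "b ^ Suc r + 1 \<in> A" if "b \<in> A" for b using A_add A_1 A_power[OF that] by blast
  consider b where "b \<in> m'" "b \<notin> m" | b where "b \<in> m" "b \<notin> m'" using neq by blast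
  then show ?thesis
  proof cases
    case 1
    then have "b \<in> A" using prime_idD(1)[OF m(2)] by blast
    then show ?thesis using unit[OF m(1) N(2) _ 1(2)] prime_id_power'[OF m(2) 1(1)] A_power by blast
  next
    \<comment> \<open>With the roles of the primes exchanged, the complementary idempotent
      \<open>b ^ Suc r + 1\<close> separates them.\<close>
    case 2
    then have b: "b \<in> A" using prime_idD(1)[OF m(1)] by blast
    have "b ^ Suc r + 1 + 1 \<in> m" using prime_id_power'[OF m(1) 2(1), of "Suc r"] by (simp add: add.assoc)
    then show ?thesis using unit[OF m(2) N(3) b 2(2)] E[OF b] by blast
  qed
qed

text \<open>By interpolation the residues at the places in \<open>S\<close> can be prescribed
  independently by elements of \<open>A\<close>. All of them ignore multiples of \<open>T N\<close>,
  whose weight is \<open>q * \<kappa> ^ N\<close>, so \<open>coset_count\<close> bounds the number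
  of residue tuples.\<close>

lemma crt_bound:
  assumes N: "N \<ge> 1" and S: "finite S" "S \<subseteq> zeros N"
  shows "(\<Prod>V\<in>S. card (place_of.residue V ` V)) \<le> \<kappa> ^ (q * \<kappa> ^ N)"
proof -
  have prime: "curve_prime k A x y a0 n q wt (center V) N" if "V \<in> S" for V
    using zerosD(4) S N that by blast
  have loc: "V = loc (center V)" if "V \<in> S" for V
    using zerosD(5) S N that by blast
  have residue_eq: "place_of.residue V g = place_of.residue V h \<longleftrightarrow> g + h \<in> center V" if V: "V \<in> S" and gh: "g \<in> A" "h \<in> A" for V g h
  proof -
    interpret P: curve_prime k A x y a0 n q wt "center V" N by (rule prime[OF V])
    show ?thesis using P.residue_eq_iff[of g h] gh P.A_M_iff[OF A_add[OF gh]] loc[OF V]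
      by (simp add: minus_eq_plus)
  qed
  have "\<exists>e\<in>A. e + 1 \<in> center V \<and> (\<forall>W\<in>S - {V}. e \<in> center W)" if V: "V \<in> S" for V
  proof -
    interpret P: curve_prime k A x y a0 n q wt "center V" N by (rule prime[OF V])
    have "\<exists>a\<in>A. a \<in> center W \<and> a + 1 \<in> center V" if W: "W \<in> S - {V}" for W
    proof -
      interpret Q: curve_prime k A x y a0 n q wt "center W" N by (rule prime) (use W in auto)
      have "center V \<noteq> center W" using loc[OF V] loc[of W] W by auto
      then show ?thesis using separate_primes[OF P.m Q.m N P.T_m Q.T_m] by blast
    qed
    then obtain a where a: "\<And>W. W \<in> S - {V} \<Longrightarrow> a W \<in> A \<and> a W \<in> center W \<and> a W + 1 \<in> center V" by metis
    \<comment> \<open>The product of the separating elements is 1 at \<open>V\<close> and 0 at every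
      other place in \<open>S\<close>.\<close>
    define e where "e = prod a (S - {V})"
    have "e \<in> A" unfolding e_def using a by (intro A_prod) auto
    moreover have "e + 1 \<in> center V" unfolding e_def using a by (intro P.near_one_prod) auto
    moreover have "e \<in> center W" if W: "W \<in> S - {V}" for W
    proof -
      interpret Q: curve_prime k A x y a0 n q wt "center W" N by (rule prime) (use W in auto)
      have "e = prod a (S - {V} - {W}) * a W"
        unfolding e_def using prod.remove[of "S - {V}" W a] S(1) W by (simp add: mult.commute)
      moreover have "prod a (S - {V} - {W}) \<in> A" using a by (intro A_prod) auto
      ultimately show ?thesis using Q.m_mult a[OF W] by simp
    qed
    ultimately show ?thesis by blast
  qed
  then obtain e where e: "\<And>V. V \<in> S \<Longrightarrow> e V \<in> A \<and> e V + 1 \<in> center V \<and> (\<forall>W\<in>S - {V}. e V \<in> center W)" by metis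
  define f where "f = (\<lambda>g. \<lambda>V\<in>S. place_of.residue V g)"
  have "PiE S (\<lambda>V. place_of.residue V ` V) \<subseteq> f ` A"
  proof
    fix \<phi> assume \<phi>: "\<phi> \<in> PiE S (\<lambda>V. place_of.residue V ` V)"
    have "\<exists>c\<in>A. place_of.residue V c = \<phi> V" if V: "V \<in> S" for V
    proof -
      have "V \<in> zeros N" using S V by blast
      then have "\<phi> V \<in> place_of.residue V ` A"
        unfolding zeros_discrete(3)[OF \<open>V \<in> zeros N\<close> N, symmetric] by (intro PiE_mem[OF \<phi> V])
      then show ?thesis by auto
    qed
    then obtain c where c: "\<And>V. V \<in> S \<Longrightarrow> c V \<in> A \<and> place_of.residue V (c V) = \<phi> V" by metis
    define g where "g = (\<Sum>V\<in>S. c V * e V)"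
    have gA: "g \<in> A" unfolding g_def using c e by (intro A_sum A_mult) auto
    have "place_of.residue W g = \<phi> W" if W: "W \<in> S" for W
    proof -
      interpret Q: curve_prime k A x y a0 n q wt "center W" N by (rule prime[OF W])
      have "g + c W = c W * (e W + 1) + (\<Sum>V\<in>S - {W}. c V * e V)"
        unfolding g_def using sum.remove[OF S(1) W, of "\<lambda>V. c V * e V"] by (simp add: algebra_simps)
      moreover have "c W * (e W + 1) \<in> center W" using Q.m_mult c[OF W] e[OF W] by blast
      moreover have "c V * e V \<in> center W" if "V \<in> S - {W}" for V
        using Q.m_mult[of "c V" "e V"] c[of V] e[of V] that W by blast
      then have "(\<Sum>V\<in>S - {W}. c V * e V) \<in> center W" by (rule Q.m_sum)
      ultimately have "g + c W \<in> center W" using Q.m_add by simp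
      then show ?thesis using residue_eq[OF W gA, of "c W"] c[OF W] by simp
    qed
    then have "f g = \<phi>" using \<phi> unfolding f_def by (intro ext) (auto simp: PiE_iff extensional_def)
    then show "\<phi> \<in> f ` A" using gA by blast
  qed
  moreover have "finite (f ` A) \<and> card (f ` A) \<le> \<kappa> ^ (q * \<kappa> ^ N)"
  proof (rule coset_count)
    show "f (g + T N * a) = f g" if "g \<in> A" "a \<in> A" for g a
    proof -
      have "place_of.residue V (g + T N * a) = place_of.residue V g" if V: "V \<in> S" for V
      proof -
        interpret P: curve_prime k A x y a0 n q wt "center V" N by (rule prime[OF V])
        have "g + T N * a + g = a * T N" by (metis add.commute add_self_left mult.commute)
        then have "g + T N * a + g \<in> center V" using P.m_mult[OF \<open>a \<in> A\<close> P.T_m] by (simp only:)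
        then show ?thesis
          using residue_eq[OF V A_add[OF \<open>g \<in> A\<close> A_mult[OF T_A \<open>a \<in> A\<close>]] \<open>g \<in> A\<close>] by blast
      qed
      then show ?thesis unfolding f_def by (intro restrict_ext)
    qed
  qed (use T_A T_wt[OF N] in auto)
  ultimately have "card (PiE S (\<lambda>V. place_of.residue V ` V)) \<le> \<kappa> ^ (q * \<kappa> ^ N)"
    by (meson card_mono le_trans)
  then show ?thesis by (simp add: card_PiE S(1))
qed

lemma card_residues_zeros:
  assumes "V \<in> zeros N" "N \<ge> 1"
  shows "card (place_of.residue V ` V) = \<kappa> ^ place_degree k V" and "place_degree k V \<ge> 1"
proof -
  interpret P: discrete_place k K V "T N" by (rule zeros_discrete(1)[OF assms])
  show *: "card (place_of.residue V ` V) = \<kappa> ^ place_degree k V"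
    using P.card_residue_field[OF zeros_discrete(2)[OF assms]] card_k by (simp add: \<kappa>_def)
  have "card (P.residue ` k) \<le> card (P.residue ` V)"
    using zeros_discrete(2)[OF assms] P.k_V by (intro card_mono) auto
  then have "\<kappa> \<le> \<kappa> ^ place_degree k V"
    using * card_k by (simp add: card_image[OF P.residue_inj_k] \<kappa>_def)
  then show "place_degree k V \<ge> 1" using kappa_ge2 by (cases "place_degree k V") auto
qed

text \<open>The bound is uniform over finite sets of zeros and each zero has degree at least 1, so
  finiteness of \<open>zeros N\<close> follows from it as well.\<close>

lemma zeros_degree:
  assumes N: "N \<ge> 1"
  shows "finite (zeros N)" and "(\<Sum>V\<in>zeros N. place_degree k V) \<le> q * \<kappa> ^ N"
proof -
  have bound: "(\<Sum>V\<in>S. place_degree k V) \<le> q * \<kappa> ^ N" if S: "S \<subseteq> zeros N" "finite S" for S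
  proof -
    have "\<kappa> ^ (\<Sum>V\<in>S. place_degree k V) = (\<Prod>V\<in>S. card (place_of.residue V ` V))"
      unfolding power_sum using card_residues_zeros(1) S N by (intro prod.cong) auto
    also have "\<dots> \<le> \<kappa> ^ (q * \<kappa> ^ N)" by (rule crt_bound[OF N S(2,1)])
    finally show ?thesis using kappa_ge2 by (subst (asm) power_increasing_iff) auto
  qed
  have "finite (zeros N) \<and> card (zeros N) \<le> q * \<kappa> ^ N"
  proof (rule finite_if_finite_subsets_card_bdd)
    fix S assume S: "S \<subseteq> zeros N" "finite S"
    have "card S = (\<Sum>V\<in>S. 1)" by simp
    also have "\<dots> \<le> (\<Sum>V\<in>S. place_degree k V)"
      using card_residues_zeros(2) S N by (intro sum_mono) auto
    finally show "card S \<le> q * \<kappa> ^ N" using bound[OF S] by simp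
  qed
  then show "finite (zeros N)" ..
  then show "(\<Sum>V\<in>zeros N. place_degree k V) \<le> q * \<kappa> ^ N" using bound by blast
qed

end

section \<open>Genus and rational places\<close>

context curve
begin

text \<open>The \<open>- 1\<close> matches the strict bound in \<open>L\<close>: pole order at most
  \<open>q * B - 1\<close> means weight below \<open>q * B\<close>.\<close>

definition big_divisor :: "nat \<Rightarrow> nat \<Rightarrow> nat \<Rightarrow> 'b set \<Rightarrow> int" where
  "big_divisor B N c V = (if V = pole_loc then int (q * B) - 1 else if V \<in> zeros N then int c else 0)"

lemma pole_loc_notin_zeros: "pole_loc \<notin> zeros N"
  using x_notin_pole_loc by (auto simp: zeros_def)

text \<open>Multiplication by \<open>T N ^ c\<close> clears the permitted poles: it has valuation
  \<open>c\<close> at each zero of \<open>T N\<close>, is a unit at the other finite places, and has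
  pole order \<open>q * (c * \<kappa> ^ N)\<close> at infinity.\<close>

lemma big_divisor_val:
  assumes N: "N \<ge> 1" and z: "z \<in> K" "z \<noteq> 0" and V: "V \<in> places k K"
  shows "place_val V z \<ge> - big_divisor B N c V \<longleftrightarrow>
    (if V = pole_loc then place_val V (T N ^ c * z) \<ge> - int (q * (B + c * \<kappa> ^ N)) + 1 else T N ^ c * z \<in> V)"
proof (cases "x \<in> V")
  case True
  then have ne: "V \<noteq> pole_loc" using x_notin_pole_loc by blast
  obtain t where "discrete_place k K V t" using nice V by (auto simp: places_discrete_finite_def)
  then interpret discrete_place k K V t .
  have Tc: "T N ^ c \<in> K" "T N ^ c \<noteq> 0" using A_K[OF A_power[OF T_A]] T_wt[OF N] by auto
  have mult: "place_val V (T N ^ c * z) = place_val V (T N ^ c) + place_val V z"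
    by (rule val_mult[OF Tc z])
  have "place_val V (T N ^ c) = big_divisor B N c V"
  proof (cases "V \<in> zeros N")
    case True
    interpret Z: discrete_place k K V "T N" by (rule zeros_discrete(1)[OF True N])
    show ?thesis using Z.val_powi_t[of "int c"] ne True by (simp add: big_divisor_def)
  next
    case False
    then have "T N \<in> V - M" using V \<open>x \<in> V\<close> center_place(3)[OF V \<open>x \<in> V\<close>] T_A by (auto simp: zeros_def)
    then show ?thesis using val_unit[OF unit_power] ne False by (simp add: big_divisor_def)
  qed
  moreover have "T N ^ c * z \<in> V \<longleftrightarrow> place_val V (T N ^ c * z) \<ge> 0"
    using val_nonneg_iff[of "T N ^ c * z"] Tc z K_mult by simp
  ultimately show ?thesis using mult ne by auto
next
  case False
  then have eq: "V = pole_loc" by (rule pole_place_unique[OF V])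
  interpret P: curve_pole k A x y a0 n q wt pole_loc by (rule pole_loc_curve_pole)
  have Tc: "T N ^ c \<in> A" "T N ^ c \<noteq> 0" using A_power[OF T_A] T_wt[OF N] by auto
  have "place_val V (T N ^ c * z) = place_val V (T N ^ c) + place_val V z"
    unfolding eq by (rule P.val_mult[OF A_K[OF Tc(1)] Tc(2) z])
  moreover have "place_val V (T N ^ c) = - int (q * (c * \<kappa> ^ N))"
    unfolding eq using P.pole_val_A[OF Tc] wt_power[OF T_A] T_wt[OF N] by (simp add: mult_ac)
  ultimately show ?thesis using eq by (simp add: big_divisor_def algebra_simps)
qed

text \<open>\<open>A\<close> is the ring of functions whose only pole is at infinity, because it is
  the intersection of its localisations.\<close>

lemma regular_iff: "z \<in> A \<longleftrightarrow> z \<in> K \<and> (\<forall>V\<in>places k K. V \<noteq> pole_loc \<longrightarrow> z \<in> V)"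
proof
  assume "z \<in> A"
  then show "z \<in> K \<and> (\<forall>V\<in>places k K. V \<noteq> pole_loc \<longrightarrow> z \<in> V)"
    using A_K pole_place_unique center_place(3) by blast
next
  assume z: "z \<in> K \<and> (\<forall>V\<in>places k K. V \<noteq> pole_loc \<longrightarrow> z \<in> V)"
  show "z \<in> A"
  proof (rule inter_loc)
    fix m assume m: "prime_id m"
    obtain N where N: "N \<ge> 1" "T N \<in> m" using prime_id_T[OF m] by blast
    interpret P: curve_prime k A x y a0 n q wt m N by (rule curve_primeI[OF m N])
    have "loc m \<noteq> pole_loc" using P.A_loc[OF x_A] x_notin_pole_loc by blast
    then show "z \<in> loc m" using z P.loc_place by blast
  qed (use z in blast)
qed

lemma RR_big:
  assumes N: "N \<ge> 1"
  shows "z \<in> RR (big_divisor B N c) \<longleftrightarrow> z \<in> K \<and> T N ^ c * z \<in> L (q * (B + c * \<kappa> ^ N))"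
proof (cases "z = 0")
  case True
  then show ?thesis using RR_closed(1)[OF nice] K_zero A_0 by (simp add: L_def)
next
  case False
  show ?thesis
  proof (cases "z \<in> K")
    case zK: True
    let ?w = "T N ^ c * z"
    have w: "?w \<in> K" "?w \<noteq> 0" using zK False A_K[OF A_power[OF T_A]] K_mult T_wt[OF N] by auto
    interpret P: curve_pole k A x y a0 n q wt pole_loc by (rule pole_loc_curve_pole)
    have "z \<in> RR (big_divisor B N c) \<longleftrightarrow>
      place_val pole_loc ?w \<ge> - int (q * (B + c * \<kappa> ^ N)) + 1 \<and> (\<forall>V\<in>places k K. V \<noteq> pole_loc \<longrightarrow> ?w \<in> V)"
      unfolding RR_iff using big_divisor_val[OF N zK False] pole_loc_place zK False by auto
    also have "\<dots> \<longleftrightarrow> ?w \<in> A \<and> place_val pole_loc ?w \<ge> - int (q * (B + c * \<kappa> ^ N)) + 1"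
      using regular_iff[of ?w] w by blast
    also have "\<dots> \<longleftrightarrow> ?w \<in> L (q * (B + c * \<kappa> ^ N))"
      using P.pole_val_A[of ?w] w(2) unfolding L_def by (auto simp: int_ops(7)[symmetric] simp del: of_nat_mult)
    finally show ?thesis using zK by blast
  qed (simp add: RR_iff)
qed

lemma card_RR_big:
  assumes N: "N \<ge> 1" and B: "q \<le> B"
  shows "finite (RR (big_divisor B N c))"
    and "card (RR (big_divisor B N c)) = \<kappa> ^ (q * (B + c * \<kappa> ^ N) - genus)"
    and "genus \<le> q * (B + c * \<kappa> ^ N)"
proof -
  let ?T = "T N ^ c" and ?L = "L (q * (B + c * \<kappa> ^ N))"
  have T0: "?T \<noteq> 0" using T_wt[OF N] by simp
  have "RR (big_divisor B N c) = (\<lambda>w. w / ?T) ` ?L"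
  proof (intro equalityI subsetI)
    fix z assume "z \<in> RR (big_divisor B N c)"
    then have "?T * z \<in> ?L" unfolding RR_big[OF N] by blast
    then show "z \<in> (\<lambda>w. w / ?T) ` ?L" using T0 by (auto intro!: image_eqI[of _ _ "?T * z"])
  next
    fix z assume "z \<in> (\<lambda>w. w / ?T) ` ?L"
    then obtain w where w: "w \<in> ?L" "z = w / ?T" by blast
    then have "z \<in> K" using K_I A_power[OF T_A] by (auto simp: L_def)
    then show "z \<in> RR (big_divisor B N c)" unfolding RR_big[OF N] using w T0 by simp
  qed
  moreover have "inj_on (\<lambda>w. w / ?T) ?L" using T0 by (auto simp: inj_on_def)
  ultimately show "finite (RR (big_divisor B N c))"
    and "card (RR (big_divisor B N c)) = \<kappa> ^ (q * (B + c * \<kappa> ^ N) - genus)"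
    and "genus \<le> q * (B + c * \<kappa> ^ N)"
    using finite_L card_L[of "B + c * \<kappa> ^ N"] B by (simp_all add: card_image)
qed

lemma dim_RR_big:
  assumes N: "N \<ge> 1" and B: "q \<le> B"
  shows "int (ring.dim ring_of_type_algebra k (RR (big_divisor B N c))) = int (q * (B + c * \<kappa> ^ N)) - int genus"
proof -
  have "\<kappa> ^ ring.dim ring_of_type_algebra k (RR (big_divisor B N c)) = \<kappa> ^ (q * (B + c * \<kappa> ^ N) - genus)"
    using card_RR[OF nice card_RR_big(1)[OF assms]] card_RR_big(2)[OF assms] card_k by (simp add: \<kappa>_def)
  then have "ring.dim ring_of_type_algebra k (RR (big_divisor B N c)) = q * (B + c * \<kappa> ^ N) - genus"
    using kappa_ge2 by (subst (asm) power_inject_exp) auto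
  then show ?thesis using card_RR_big(3)[OF assms, of c] by (simp add: of_nat_diff)
qed

lemma big_divisor_in:
  assumes N: "N \<ge> 1"
  shows "big_divisor B N c \<in> divisors k K"
    and "divisor_degree k (big_divisor B N c) = int (q * B) - 1 + int c * int (\<Sum>V\<in>zeros N. place_degree k V)"
proof -
  let ?S = "insert pole_loc (zeros N)"
  have supp: "{V. big_divisor B N c V \<noteq> 0} \<subseteq> ?S" by (auto simp: big_divisor_def)
  have fin: "finite ?S" using zeros_degree(1)[OF N] by simp
  have "?S \<subseteq> places k K" using pole_loc_place by (auto simp: zeros_def)
  then show "big_divisor B N c \<in> divisors k K"
    unfolding divisors_def using finite_subset[OF supp fin] supp by blast
  interpret P: curve_pole k A x y a0 n q wt pole_loc by (rule pole_loc_curve_pole)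
  have "divisor_degree k (big_divisor B N c) = (\<Sum>V\<in>?S. big_divisor B N c V * int (place_degree k V))"
    by (rule divisor_degree_eq[OF nice fin supp])
  also have "\<dots> = (int (q * B) - 1) + (\<Sum>V\<in>zeros N. big_divisor B N c V * int (place_degree k V))"
    using zeros_degree(1)[OF N] pole_loc_notin_zeros P.place_degree_pole by (simp add: big_divisor_def)
  also have "(\<Sum>V\<in>zeros N. big_divisor B N c V * int (place_degree k V)) = (\<Sum>V\<in>zeros N. int c * int (place_degree k V))"
    using pole_loc_notin_zeros by (intro sum.cong) (auto simp: big_divisor_def)
  finally show "divisor_degree k (big_divisor B N c) = int (q * B) - 1 + int c * int (\<Sum>V\<in>zeros N. place_degree k V)"
    by (simp add: sum_distrib_left)
qed

lemma divisor_le_big: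
  assumes D: "D \<in> divisors k K"
  shows "\<exists>B N c. q \<le> B \<and> N \<ge> 1 \<and> (\<forall>V. D V \<le> big_divisor B N c V)"
proof -
  define S where "S = {V. D V \<noteq> 0}"
  have S: "finite S" "S \<subseteq> places k K" using D by (auto simp: S_def divisors_def)
  have "\<forall>V\<in>S - {pole_loc}. \<exists>N\<ge>1. V \<in> zeros N"
    using S pole_place_unique finite_place_zeros by blast
  then obtain NN where NN: "\<And>V. V \<in> S - {pole_loc} \<Longrightarrow> NN V \<ge> 1 \<and> V \<in> zeros (NN V)" by metis
  \<comment> \<open>A common multiple of the individual exponents, so that \<open>zeros_mult\<close>
    applies to all places of the support.\<close>
  define N where "N = prod NN (S - {pole_loc})"
  have N: "N \<ge> 1" unfolding N_def using NN by (intro prod_ge_1) auto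
  have zeros: "V \<in> zeros N" if V: "V \<in> S - {pole_loc}" for V
  proof -
    have "N = NN V * prod NN (S - {pole_loc} - {V})"
      unfolding N_def using prod.remove[of "S - {pole_loc}" V NN] S(1) V by simp
    moreover have "prod NN (S - {pole_loc} - {V}) \<ge> 1" using NN by (intro prod_ge_1) auto
    then obtain e where "prod NN (S - {pole_loc} - {V}) = Suc e" by (metis One_nat_def Suc_le_D)
    ultimately show ?thesis using zeros_mult[of V "NN V" e] NN[OF V] by simp
  qed
  define c where "c = (\<Sum>V\<in>S. nat (D V))"
  have c: "D V \<le> int c" for V
  proof (cases "V \<in> S")
    case True
    then have "nat (D V) \<le> c" unfolding c_def using S(1) by (intro member_le_sum) auto
    then show ?thesis by linarith
  qed (simp add: S_def)
  \<comment> \<open>This gives both \<open>q \<le> B\<close> and \<open>c \<le> q * B - 1\<close>,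
    the coefficient at infinity.\<close>
  define B where "B = Suc c + q"
  have "int c \<le> int (q * B) - 1"
  proof -
    have "B \<le> q * B" using q_pos by simp
    then have "Suc c \<le> q * B" unfolding B_def by linarith
    then show ?thesis by linarith
  qed
  then have "D V \<le> big_divisor B N c V" for V
    using c[of V] zeros[of V] unfolding big_divisor_def S_def by force
  moreover have "q \<le> B" unfolding B_def by simp
  ultimately show ?thesis using N by blast
qed

text \<open>The maximum is attained for \<open>c = 0\<close>, at a multiple of the place at
  infinity. For larger \<open>c\<close> the zeros of \<open>T N\<close> add at most
  \<open>c * q * \<kappa> ^ N\<close> to the degree, which is exactly what they add to the
  dimension.\<close>

theorem genus_curve: "has_genus k K genus"
  unfolding has_genus_def Let_def
proof (intro conjI ballI)
  have "divisor_degree k (big_divisor q 1 0) - int (ring.dim ring_of_type_algebra k (RR (big_divisor q 1 0))) + 1 = int genus"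
    using big_divisor_in(2)[of 1 q 0] dim_RR_big[of 1 q 0] by simp
  then show "\<exists>D\<in>divisors k K. divisor_degree k D - int (ring.dim ring_of_type_algebra k (RR D)) + 1 = int genus"
    using big_divisor_in(1)[of 1 q 0] by blast
next
  fix D assume D: "D \<in> divisors k K"
  obtain B N c where *: "q \<le> B" "N \<ge> 1" "\<And>V. D V \<le> big_divisor B N c V" using divisor_le_big[OF D] by blast
  have "divisor_degree k D - int (ring.dim ring_of_type_algebra k (RR D))
    \<le> divisor_degree k (big_divisor B N c) - int (ring.dim ring_of_type_algebra k (RR (big_divisor B N c)))"
    by (rule riemann_monotone[OF nice D big_divisor_in(1)[OF *(2)] *(3) card_RR_big(1)[OF *(2,1)]])
  also have "\<dots> = int genus - 1 + (int c * int (\<Sum>V\<in>zeros N. place_degree k V) - int (q * (c * \<kappa> ^ N)))"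
    unfolding big_divisor_in(2)[OF *(2)] dim_RR_big[OF *(2,1)] by (simp add: algebra_simps)
  also have "int c * int (\<Sum>V\<in>zeros N. place_degree k V) \<le> int c * int (q * \<kappa> ^ N)"
    using zeros_degree(2)[OF *(2)] by (intro mult_left_mono) (simp_all only: of_nat_le_iff of_nat_0_le_iff)
  then have "int c * int (\<Sum>V\<in>zeros N. place_degree k V) - int (q * (c * \<kappa> ^ N)) \<le> 0"
    by (simp add: mult_ac)
  finally show "divisor_degree k D - int (ring.dim ring_of_type_algebra k (RR D)) + 1 \<le> int genus" by linarith
qed

section \<open>Rational points and rational places\<close>

definition points :: "('b \<times> 'b) set" where
  "points = {(a, b). a \<in> k \<and> b \<in> k \<and> b ^ q + b = a ^ (q + 1) + a0 * a ^ 2}"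

definition is_ev :: "('b \<Rightarrow> 'b) \<Rightarrow> 'b \<Rightarrow> 'b \<Rightarrow> bool" where
  "is_ev e a b \<longleftrightarrow> (\<forall>c\<in>k. e c = c) \<and> e x = a \<and> e y = b \<and>
     (\<forall>g\<in>A. e g \<in> k \<and> (\<forall>h\<in>A. e (g + h) = e g + e h \<and> e (g * h) = e g * e h))"

text \<open>On \<open>A\<close> an evaluation is determined by its values on \<open>k\<close>,
  \<open>x\<close> and \<open>y\<close>, so the choice is immaterial there.\<close>

definition ev :: "'b \<times> 'b \<Rightarrow> 'b \<Rightarrow> 'b" where
  "ev P = (SOME e. is_ev e (fst P) (snd P))"

definition point_ideal :: "'b \<times> 'b \<Rightarrow> 'b set" where
  "point_ideal P = {w \<in> A. ev P w = 0}"

lemma ev_is_ev: assumes "P \<in> points" shows "is_ev (ev P) (fst P) (snd P)"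
proof -
  have "fst P \<in> k" "snd P \<in> k" "snd P ^ q + snd P = fst P ^ (q + 1) + a0 * fst P ^ 2"
    using assms by (auto simp: points_def)
  from evaluation[OF this] have "\<exists>e. is_ev e (fst P) (snd P)" unfolding is_ev_def .
  then show ?thesis unfolding ev_def by (rule someI_ex)
qed

lemma ev_simps:
  assumes "P \<in> points"
  shows "c \<in> k \<Longrightarrow> ev P c = c" "ev P x = fst P" "ev P y = snd P" "g \<in> A \<Longrightarrow> ev P g \<in> k"
    "g \<in> A \<Longrightarrow> h \<in> A \<Longrightarrow> ev P (g + h) = ev P g + ev P h"
    "g \<in> A \<Longrightarrow> h \<in> A \<Longrightarrow> ev P (g * h) = ev P g * ev P h"
  using ev_is_ev[OF assms] unfolding is_ev_def by blast+

lemma ev_power: "P \<in> points \<Longrightarrow> g \<in> A \<Longrightarrow> ev P (g ^ i) = ev P g ^ i"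
  by (induction i) (simp_all add: ev_simps k1 A_power)

lemma point_ideal_prime: assumes P: "P \<in> points" shows "prime_id (point_ideal P)"
  unfolding prime_id_def
proof (intro conjI ballI impI)
  have Pk: "fst P \<in> k" "snd P \<in> k" using P by (auto simp: points_def)
  show "point_ideal P \<subseteq> A" by (auto simp: point_ideal_def)
  show "a + b \<in> point_ideal P" if "a \<in> point_ideal P" "b \<in> point_ideal P" for a b
    using that ev_simps(5)[OF P] A_add by (simp add: point_ideal_def)
  show "a * b \<in> point_ideal P" if "a \<in> A" "b \<in> point_ideal P" for a b
    using that ev_simps(6)[OF P] A_mult by (simp add: point_ideal_def)
  show "1 \<notin> point_ideal P" using ev_simps(1)[OF P k1] by (simp add: point_ideal_def)
  show "a \<in> point_ideal P \<or> b \<in> point_ideal P" if "a \<in> A" "b \<in> A" "a * b \<in> point_ideal P" for a b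
    using that ev_simps(6)[OF P that(1,2)] by (simp add: point_ideal_def)
  have fA: "fst P \<in> A" using Pk k_A by blast
  \<comment> \<open>This function vanishes at \<open>P\<close>; it is nonzero because
    \<open>x\<close> has positive weight and so is not a constant.\<close>
  have "x + fst P \<in> point_ideal P"
    using ev_simps(5)[OF P x_A fA] ev_simps(2)[OF P] ev_simps(1)[OF P Pk(1)] A_add[OF x_A fA]
    by (simp add: point_ideal_def)
  moreover have "x + fst P \<noteq> 0"
    using wt_const[of x] x_nz wt_x q_pos Pk by (auto simp: add_eq_0_char2)
  ultimately show "\<exists>w\<in>point_ideal P. w \<noteq> 0" by blast
qed

lemma point_place:
  assumes P: "P \<in> points"
  shows "loc (point_ideal P) \<in> places k K" "x \<in> loc (point_ideal P)"
    "center (loc (point_ideal P)) = point_ideal P" "place_degree k (loc (point_ideal P)) = 1"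
proof -
  obtain N where N: "N \<ge> 1" "T N \<in> point_ideal P" using prime_id_T[OF point_ideal_prime[OF P]] by blast
  interpret P: curve_prime k A x y a0 n q wt "point_ideal P" N by (rule curve_primeI[OF point_ideal_prime[OF P] N])
  show "loc (point_ideal P) \<in> places k K" by (rule P.loc_place)
  show "x \<in> loc (point_ideal P)" by (rule P.A_loc[OF x_A])
  show "center (loc (point_ideal P)) = point_ideal P"
    using P.A_M_iff P.m_A by (auto simp: center_def)
  show "place_degree k (loc (point_ideal P)) = 1"
    unfolding P.place_degree_one_iff[OF P.finite_residues]
  proof
    fix z assume "z \<in> loc (point_ideal P)"
    then obtain a where a: "a \<in> A" "z + a \<in> P.M" using P.residue_A by blast
    have c: "ev P a \<in> k" by (rule ev_simps(4)[OF P a(1)])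
    then have cA: "ev P a \<in> A" using k_A by blast
    have "ev P (a + ev P a) = 0" using ev_simps(5)[OF P a(1) cA] ev_simps(1)[OF P c] by simp
    then have "a + ev P a \<in> P.M" using P.m_M A_add[OF a(1) cA] by (simp add: point_ideal_def)
    then have "(z + a) + (a + ev P a) \<in> P.M" using P.M_add[OF a(2)] by blast
    then have "z - ev P a \<in> P.M" by (simp add: minus_eq_plus add.assoc)
    then show "\<exists>c\<in>k. z - c \<in> P.M" using c by blast
  qed
qed

text \<open>The residues \<open>a\<close> and \<open>b\<close> of \<open>x\<close> and
  \<open>y\<close> are constants. The difference of the two sides of the curve equation at
  \<open>(a, b)\<close> lies in \<open>k\<close> and in \<open>M\<close>, hence is 0. Evaluation at
  \<open>(a, b)\<close> then agrees with reduction modulo \<open>M\<close>.\<close>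

lemma rational_place_point:
  assumes V: "V \<in> places k K" "x \<in> V" and deg: "place_degree k V = 1"
  shows "\<exists>P\<in>points. V = loc (point_ideal P)"
proof -
  obtain N where N: "N \<ge> 1" "V \<in> zeros N" using finite_place_zeros[OF V] by blast
  interpret P: place_of k K V by unfold_locales (rule V(1))
  have AV: "A \<subseteq> V" by (rule center_place(3)[OF V])
  have res: "\<exists>c\<in>k. z + c \<in> P.M" if "z \<in> V" for z
    using that deg P.place_degree_one_iff[OF zeros_discrete(2)[OF N(2,1)]] by (simp add: minus_eq_plus)
  obtain a where a: "a \<in> k" "x + a \<in> P.M" using res[OF V(2)] by blast
  obtain b where b: "b \<in> k" "y + b \<in> P.M" using res[of y] AV y_A by blast
  have kM: "c = 0" if "c \<in> k" "c \<in> P.M" for c using P.k_unit[of c] that by blast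
  have cong_mult: "u * v + u' * v' \<in> P.M" if "u + u' \<in> P.M" "v + v' \<in> P.M" "u' \<in> V" "v \<in> V" for u v u' v'
  proof -
    have eq: "u * v + u' * v' = (u + u') * v + u' * (v + v')"
      by (simp add: algebra_simps)
    show ?thesis unfolding eq using P.M_add P.M_mult P.M_mult' that by blast
  qed
  have cong_add: "(u + v) + (u' + v') \<in> P.M" if "u + u' \<in> P.M" "v + v' \<in> P.M" for u v u' v'
    using P.M_add[OF that] by (simp add: add_ac)
  have cong_power: "u ^ i + u' ^ i \<in> P.M" if "u + u' \<in> P.M" "u \<in> V" "u' \<in> V" for u u' i
    by (induction i) (auto intro: cong_mult that P.V_power P.M_zero)
  have aV: "a \<in> V" "b \<in> V" "y \<in> V" "a0 \<in> V" using a b P.k_V a0_k AV y_A by auto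
  have 1: "(y ^ q + y) + (b ^ q + b) \<in> P.M" by (intro cong_add cong_power b aV)
  have a0M: "a0 + a0 \<in> P.M" using P.M_zero by simp
  have 2: "(x ^ (q + 1) + a0 * x ^ 2) + (a ^ (q + 1) + a0 * a ^ 2) \<in> P.M"
    by (intro cong_add cong_mult cong_power a V aV a0M P.V_power)
  let ?d = "(b ^ q + b) + (a ^ (q + 1) + a0 * a ^ 2)"
  \<comment> \<open>The curve equation rewrites the part of \<open>2\<close> in \<open>x\<close> as
    \<open>y ^ q + y\<close>, which then cancels.\<close>
  have "((y ^ q + y) + (b ^ q + b)) + ((y ^ q + y) + (a ^ (q + 1) + a0 * a ^ 2)) \<in> P.M"
    using P.M_add[OF 1 2] unfolding curve_eq .
  then have "?d \<in> P.M" by (metis add.assoc add.commute add_self_left)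
  moreover have kpow: "c ^ i \<in> k" if "c \<in> k" for c i using that k1 kmult by (induction i) auto
  then have "?d \<in> k" by (intro kadd kmult kpow a(1) b(1) a0_k)
  ultimately have "?d = 0" using kM by blast
  then have P: "(a, b) \<in> points" using a b by (simp add: points_def add_eq_0_char2)
  have ev: "w + ev (a, b) w \<in> P.M" if "w \<in> A" for w
    using that
  proof (induction rule: A_induct)
    case (mono c i j)
    have cA: "c \<in> A" using mono k_A by blast
    have "ev (a, b) (c * x ^ i * y ^ j) = c * a ^ i * b ^ j"
      using ev_simps[OF P] ev_power[OF P] mono cA x_A y_A by (simp add: A_mult A_power)
    moreover have "c + c \<in> P.M" using P.M_zero by simp
    then have "c * x ^ i * y ^ j + c * a ^ i * b ^ j \<in> P.M"
      using a(2) b(2) aV V mono P.k_V by (intro cong_mult cong_power P.V_mult P.V_power) auto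
    ultimately show ?case by simp
  next
    case (add u v)
    then show ?case using cong_add[of u "ev (a, b) u" v "ev (a, b) v"] ev_simps(5)[OF P] by simp
  qed
  have "center V = point_ideal (a, b)"
  proof (intro equalityI subsetI)
    fix w assume w: "w \<in> center V"
    then have wA: "w \<in> A" "w \<in> P.M" by (auto simp: center_def)
    have "w + (w + ev (a, b) w) \<in> P.M" by (rule P.M_add[OF wA(2) ev[OF wA(1)]])
    then have "ev (a, b) w = 0" using kM[OF ev_simps(4)[OF P wA(1)]] by simp
    then show "w \<in> point_ideal (a, b)" using wA by (simp add: point_ideal_def)
  next
    fix w assume "w \<in> point_ideal (a, b)"
    then show "w \<in> center V" using ev[of w] by (simp add: point_ideal_def center_def)
  qed
  then show ?thesis using center_place(2)[OF V] P by metis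
qed

text \<open>Each \<open>w\<close> is congruent to the constant \<open>ev P w\<close> modulo the
  ideal, so the ideal determines the evaluation and thereby the coordinates.\<close>

lemma point_loc_inj: "inj_on (\<lambda>P. loc (point_ideal P)) points"
proof (rule inj_onI)
  fix P Q assume PQ: "P \<in> points" "Q \<in> points" "loc (point_ideal P) = loc (point_ideal Q)"
  then have eq: "point_ideal P = point_ideal Q" using point_place(3) by metis
  have coord: "ev Q w = ev P w" if "w \<in> A" for w
  proof -
    have c: "ev P w \<in> k" by (rule ev_simps(4)[OF PQ(1) that])
    then have cA: "ev P w \<in> A" using k_A by blast
    have "w + ev P w \<in> point_ideal P"
      using ev_simps(5)[OF PQ(1) that cA] ev_simps(1)[OF PQ(1) c] A_add[OF that cA] by (simp add: point_ideal_def)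
    then have "ev Q (w + ev P w) = 0" unfolding eq by (simp add: point_ideal_def)
    then show ?thesis
      using ev_simps(5)[OF PQ(2) that cA] ev_simps(1)[OF PQ(2) c] by (simp add: add_eq_0_char2)
  qed
  show "P = Q" using coord[OF x_A] coord[OF y_A] ev_simps(2,3)[OF PQ(1)] ev_simps(2,3)[OF PQ(2)]
    by (simp add: prod_eq_iff)
qed

theorem card_rational_places: "card (rational_places k K) = card points + 1"
proof -
  interpret P: curve_pole k A x y a0 n q wt pole_loc by (rule pole_loc_curve_pole)
  have "rational_places k K = insert pole_loc ((\<lambda>P. loc (point_ideal P)) ` points)"
  proof (intro equalityI subsetI)
    fix V assume "V \<in> rational_places k K"
    then have V: "V \<in> places k K" "place_degree k V = 1" by (auto simp: rational_places_def)
    show "V \<in> insert pole_loc ((\<lambda>P. loc (point_ideal P)) ` points)"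
      using pole_place_unique[OF V(1)] rational_place_point[OF V(1) _ V(2)] by blast
  next
    fix V assume "V \<in> insert pole_loc ((\<lambda>P. loc (point_ideal P)) ` points)"
    then show "V \<in> rational_places k K"
      using point_place P.place_degree_pole pole_loc_place by (auto simp: rational_places_def)
  qed
  moreover have "pole_loc \<notin> (\<lambda>P. loc (point_ideal P)) ` points"
    using x_notin_pole_loc point_place(2) by auto
  moreover have "finite points"
    by (rule finite_subset[of _ "k \<times> k"]) (use finite_k in \<open>auto simp: points_def\<close>)
  ultimately show ?thesis using card_image[OF point_loc_inj] by simp
qed

end

section \<open>The function field\<close>

locale rhom =
  fixes h :: "'c::comm_ring_1 \<Rightarrow> 'd::comm_ring_1"
  assumes h_add: "h (a + b) = h a + h b" and h_mult: "h (a * b) = h a * h b" and h_one: "h 1 = 1"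
begin

lemma h_zero: "h 0 = 0"
  using h_add[of 0 0] by simp

lemma h_uminus: "h (- a) = - h a"
  using h_add[of a "- a"] h_zero by (simp add: eq_neg_iff_add_eq_0 add.commute)

lemma h_diff: "h (a - b) = h a - h b"
  using h_add[of a "- b"] h_uminus by simp

lemma h_power: "h (a ^ i) = h a ^ i"
  by (induction i) (simp_all add: h_one h_mult)

lemma h_sum: "h (sum f I) = (\<Sum>i\<in>I. h (f i))"
  by (induction I rule: infinite_finite_induct) (simp_all add: h_zero h_add)

text \<open>Since \<open>sub z\<close> is again a ring homomorphism, the construction can be
  iterated; two rounds evaluate a polynomial in \<open>X\<close> and \<open>Y\<close>.\<close>

definition sub :: "'d \<Rightarrow> 'c poly \<Rightarrow> 'd" where
  "sub z p = poly (map_poly h p) z"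

lemma sub_pCons: "sub z (pCons a p) = h a + z * sub z p"
  unfolding sub_def by (simp add: map_poly_pCons h_zero)

lemma sub_zero: "sub z 0 = 0"
  unfolding sub_def by simp

lemma sub_const: "sub z [:a:] = h a"
  by (simp add: sub_pCons sub_zero)

lemma sub_add: "sub z (p + r) = sub z p + sub z r"
  by (induction p r rule: poly_induct2) (simp_all add: sub_pCons sub_zero h_add algebra_simps)

lemma sub_smult: "sub z (smult a p) = h a * sub z p"
  by (induction p) (simp_all add: sub_pCons sub_zero h_mult algebra_simps)

lemma sub_mult: "sub z (p * r) = sub z p * sub z r"
  by (induction p) (simp_all add: mult_pCons_left sub_pCons sub_zero sub_add sub_smult h_zero algebra_simps)

lemma sub_one: "sub z 1 = 1"
  using sub_const[of z 1] by (simp add: h_one one_pCons)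

lemma rhom_sub: "rhom (sub z)"
  by unfold_locales (rule sub_add sub_mult sub_one)+

lemma sub_monom: "sub z (Polynomial.monom a i) = h a * z ^ i"
  by (induction i) (simp_all add: monom_0 monom_Suc sub_const sub_pCons sub_zero h_zero algebra_simps)

end

text \<open>
  The substitution \<open>X \<mapsto> T\<^sup>q\<close>, \<open>Y \<mapsto> T ^ (q + 1)\<close>. It maps monomials with \<open>j < q\<close> to distinct powers of \<open>T\<close>, and the two
  leading terms of the curve equation to the same power, so reduction modulo the equation does not change the
  coefficient of highest weight.
\<close>

definition wpoly_sub :: "nat \<Rightarrow> 'a::field poly poly \<Rightarrow> 'a poly" where
  "wpoly_sub q g = poly (map_poly (\<lambda>c. pcompose c (Polynomial.monom 1 q)) g) (Polynomial.monom 1 (q + 1))"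

lemma pcompose_power: "pcompose (p ^ i) r = pcompose p r ^ i"
  by (induction i) (simp_all add: pcompose_mult pcompose_1)

lemma pcompose_monom: "pcompose (Polynomial.monom a i) (r :: 'a::comm_ring_1 poly) = smult a (r ^ i)"
  by (simp add: monom_altdef pcompose_smult pcompose_power pcompose_pCons)

section \<open>Weights and division with remainder by the curve equation\<close>

locale weighted =
  fixes q :: nat and a0 :: "'a::field"
  assumes q2: "q \<ge> 2"
begin

abbreviation "\<Phi> \<equiv> (wpoly_sub q :: 'a poly poly \<Rightarrow> 'a poly)"

definition f :: "'a poly poly" where "f = curve_poly q (S_poly q a0)"

lemma rhom_comp: "rhom (\<lambda>c :: 'a poly. pcompose c (Polynomial.monom 1 q))"
  by unfold_locales (simp_all add: pcompose_add pcompose_mult pcompose_1)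

lemma Phi_eq: "\<Phi> = rhom.sub (\<lambda>c :: 'a poly. pcompose c (Polynomial.monom 1 q)) (Polynomial.monom 1 (q + 1))"
  by (simp add: fun_eq_iff wpoly_sub_def rhom.sub_def[OF rhom_comp])

sublocale Phi: rhom \<Phi>
  unfolding Phi_eq by (rule rhom.rhom_sub[OF rhom_comp])

lemma Phi_monom: "\<Phi> (Polynomial.monom c j) = pcompose c (Polynomial.monom 1 q) * Polynomial.monom 1 ((q + 1) * j)"
  unfolding Phi_eq rhom.sub_monom[OF rhom_comp] by (simp add: monom_power)

lemma Phi_monom_monom: "\<Phi> (Polynomial.monom (Polynomial.monom c i) j) = Polynomial.monom c (q * i + (q + 1) * j)"
  unfolding Phi_monom pcompose_monom by (simp add: monom_power smult_monom mult_monom)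

text \<open>Unlike the degree of \<open>\<Phi> g\<close>, this bound is not lowered by cancellation
  between monomials of equal weight, which can occur once exponents \<open>j \<ge> q\<close> are
  present.\<close>

definition Wle :: "nat \<Rightarrow> 'a poly poly \<Rightarrow> bool" where
  "Wle m g \<longleftrightarrow> (\<forall>i j. poly.coeff (poly.coeff g j) i \<noteq> 0 \<longrightarrow> q * i + (q + 1) * j \<le> m)"

lemma Wle_diff: "Wle m g \<Longrightarrow> Wle m g' \<Longrightarrow> Wle m (g - g')"
  unfolding Wle_def by (metis coeff_diff diff_zero)

lemma Wle_mult: assumes "Wle m g" "Wle m' g'" shows "Wle (m + m') (g * g')"
  unfolding Wle_def
proof (intro allI impI)
  fix i j assume nz: "poly.coeff (poly.coeff (g * g') j) i \<noteq> 0"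
  then have "(\<Sum>l\<le>j. poly.coeff (poly.coeff g l * poly.coeff g' (j - l)) i) \<noteq> 0"
    by (simp add: coeff_mult coeff_sum)
  then obtain l where l: "l \<le> j" "poly.coeff (poly.coeff g l * poly.coeff g' (j - l)) i \<noteq> 0"
    by (metis (mono_tags, lifting) atMost_iff sum.not_neutral_contains_not_neutral)
  then have "(\<Sum>e\<le>i. poly.coeff (poly.coeff g l) e * poly.coeff (poly.coeff g' (j - l)) (i - e)) \<noteq> 0"
    by (simp add: coeff_mult)
  then obtain e where e: "e \<le> i" "poly.coeff (poly.coeff g l) e * poly.coeff (poly.coeff g' (j - l)) (i - e) \<noteq> 0"
    by (metis (mono_tags, lifting) atMost_iff sum.not_neutral_contains_not_neutral)
  have "q * e + (q + 1) * l \<le> m" "q * (i - e) + (q + 1) * (j - l) \<le> m'"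
    using assms e(2) unfolding Wle_def by auto
  moreover have "q * i + (q + 1) * j = (q * e + (q + 1) * l) + (q * (i - e) + (q + 1) * (j - l))"
  proof -
    have "i = e + (i - e)" "j = l + (j - l)" using e l by auto
    then show ?thesis by (metis (no_types, lifting) add.assoc add.left_commute distrib_left)
  qed
  ultimately show "q * i + (q + 1) * j \<le> m + m'" by linarith
qed

lemma ex_Wle: "\<exists>m. Wle m g"
proof -
  define N where "N = (\<Sum>j\<le>Polynomial.degree g. Polynomial.degree (poly.coeff g j))"
  have "Wle (q * N + (q + 1) * Polynomial.degree g) g"
    unfolding Wle_def
  proof (intro allI impI)
    fix i j assume nz: "poly.coeff (poly.coeff g j) i \<noteq> 0"
    then have j: "j \<le> Polynomial.degree g" by (intro le_degree) auto
    have "i \<le> Polynomial.degree (poly.coeff g j)" using nz by (rule le_degree)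
    also have "\<dots> \<le> N" unfolding N_def using j by (intro member_le_sum) auto
    finally show "q * i + (q + 1) * j \<le> q * N + (q + 1) * Polynomial.degree g"
      using j by (intro add_mono mult_left_mono) auto
  qed
  then show ?thesis ..
qed

lemma Phi_expand:
  assumes "Polynomial.degree g \<le> d" "\<And>j. Polynomial.degree (poly.coeff g j) \<le> N"
  shows "\<Phi> g = (\<Sum>j\<le>d. \<Sum>i\<le>N. Polynomial.monom (poly.coeff (poly.coeff g j) i) (q * i + (q + 1) * j))"
proof -
  have "g = (\<Sum>j\<le>d. Polynomial.monom (poly.coeff g j) j)"
    using poly_as_sum_of_monoms'[OF assms(1)] by simp
  also have "\<dots> = (\<Sum>j\<le>d. \<Sum>i\<le>N. Polynomial.monom (Polynomial.monom (poly.coeff (poly.coeff g j) i) i) j)"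
  proof (rule sum.cong[OF refl])
    fix j
    have "Polynomial.monom (poly.coeff g j) j = Polynomial.monom (\<Sum>i\<le>N. Polynomial.monom (poly.coeff (poly.coeff g j) i) i) j"
      using poly_as_sum_of_monoms'[OF assms(2)[of j]] by simp
    then show "Polynomial.monom (poly.coeff g j) j = (\<Sum>i\<le>N. Polynomial.monom (Polynomial.monom (poly.coeff (poly.coeff g j) i) i) j)"
      by (simp add: monom_sum)
  qed
  finally have "\<Phi> g = \<Phi> \<dots>" by (rule arg_cong)
  then show ?thesis by (simp add: Phi.h_sum Phi_monom_monom)
qed

lemma degree_coeff_bound: "\<exists>N. \<forall>j. Polynomial.degree (poly.coeff (g :: 'a poly poly) j) \<le> N"
proof -
  have "Polynomial.degree (poly.coeff g j) \<le> (\<Sum>j\<le>Polynomial.degree g. Polynomial.degree (poly.coeff g j))" for j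
  proof (cases "j \<le> Polynomial.degree g")
    case True
    then show ?thesis by (intro member_le_sum) auto
  qed (simp add: coeff_eq_0)
  then show ?thesis by blast
qed

lemma Phi_degree_le: assumes "Wle m g" shows "Polynomial.degree (\<Phi> g) \<le> m"
proof -
  obtain N where N: "\<And>j. Polynomial.degree (poly.coeff g j) \<le> N" using degree_coeff_bound[of g] by blast
  show ?thesis unfolding Phi_expand[OF order_refl N]
  proof (intro degree_sum_le finite_atMost)
    fix i j
    show "Polynomial.degree (Polynomial.monom (poly.coeff (poly.coeff g j) i) (q * i + (q + 1) * j)) \<le> m"
      using assms degree_monom_le[of "poly.coeff (poly.coeff g j) i" "q * i + (q + 1) * j"]
      unfolding Wle_def by (cases "poly.coeff (poly.coeff g j) i = 0") (auto intro: order_trans)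
  qed
qed

lemma Phi_coeff:
  assumes g: "Polynomial.degree g < q" and j: "j < q"
  shows "poly.coeff (\<Phi> g) (q * i + (q + 1) * j) = poly.coeff (poly.coeff g j) i"
proof -
  obtain N0 where N0: "\<And>j. Polynomial.degree (poly.coeff g j) \<le> N0" using degree_coeff_bound[of g] by blast
  \<comment> \<open>The summand \<open>i\<close> ensures that the index \<open>i\<close> occurs in
    the expansion.\<close>
  define N where "N = N0 + i"
  have N: "Polynomial.degree (poly.coeff g j) \<le> N" for j using N0[of j] by (simp add: N_def)
  have g': "Polynomial.degree g \<le> q - 1" using g by simp
  let ?c = "\<lambda>j i. poly.coeff (poly.coeff g j) i"
  have "poly.coeff (\<Phi> g) (q * i + (q + 1) * j) =
    (\<Sum>j'\<le>q - 1. \<Sum>i'\<le>N. if q * i' + (q + 1) * j' = q * i + (q + 1) * j then ?c j' i' else 0)"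
    unfolding Phi_expand[OF g' N] by (simp add: coeff_sum)
  also have "\<dots> = (\<Sum>j'\<le>q - 1. \<Sum>i'\<le>N. if j' = j then (if i' = i then ?c j' i' else 0) else 0)"
  proof (intro sum.cong refl)
    fix j' i' assume "j' \<in> {..q - 1}"
    then have "j' < q" using q2 by auto
    then show "(if q * i' + (q + 1) * j' = q * i + (q + 1) * j then ?c j' i' else 0) =
      (if j' = j then (if i' = i then ?c j' i' else 0) else 0)"
      using weights_unique[OF \<open>j' < q\<close> j, of i' i] by auto
  qed
  also have "\<dots> = (\<Sum>j'\<le>q - 1. if j' = j then (\<Sum>i'\<le>N. if i' = i then ?c j' i' else 0) else 0)"
    by (intro sum.cong refl) auto
  also have "\<dots> = ?c j i" using j by (simp add: N_def sum.delta)
  finally show ?thesis .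
qed

lemma reduced_coeff_zero: "Polynomial.degree (g :: 'a poly poly) < q \<Longrightarrow> \<not> j < q \<Longrightarrow> poly.coeff g j = 0"
  by (intro coeff_eq_0) simp

lemma Phi_inj: assumes g: "Polynomial.degree g < q" and 0: "\<Phi> g = 0" shows "g = 0"
proof (intro poly_eqI)
  fix j i
  show "poly.coeff (poly.coeff g j) i = poly.coeff (poly.coeff 0 j) i"
    using Phi_coeff[OF g, of j i] 0 reduced_coeff_zero[OF g, of j] by (cases "j < q") auto
qed

lemma reduced_Wle: assumes g: "Polynomial.degree g < q" shows "Wle (Polynomial.degree (\<Phi> g)) g"
  unfolding Wle_def
proof (intro allI impI)
  fix i j assume nz: "poly.coeff (poly.coeff g j) i \<noteq> 0"
  then have "j < q" using reduced_coeff_zero[OF g, of j] by (cases "j < q") simp_all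
  then show "q * i + (q + 1) * j \<le> Polynomial.degree (\<Phi> g)"
    using nz Phi_coeff[OF g, of j i] by (intro le_degree) simp
qed

lemma reduced_lead:
  assumes g: "Polynomial.degree g < q" "g \<noteq> 0"
  shows "\<exists>i j. j < q \<and> Polynomial.degree (\<Phi> g) = q * i + (q + 1) * j \<and>
    poly.coeff (poly.coeff g j) i = poly.coeff (\<Phi> g) (Polynomial.degree (\<Phi> g))"
proof -
  let ?n = "Polynomial.degree (\<Phi> g)"
  have nz: "poly.coeff (\<Phi> g) ?n \<noteq> 0" using Phi_inj[OF g(1)] g(2) by auto
  obtain N where N: "\<And>j. Polynomial.degree (poly.coeff g j) \<le> N" using degree_coeff_bound[of g] by blast
  have g': "Polynomial.degree g \<le> q - 1" using g by simp
  have "poly.coeff (\<Phi> g) ?n =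
    (\<Sum>j\<le>q - 1. \<Sum>i\<le>N. if q * i + (q + 1) * j = ?n then poly.coeff (poly.coeff g j) i else 0)"
    using arg_cong[OF Phi_expand[OF g' N], of "\<lambda>p. poly.coeff p ?n"] by (simp add: coeff_sum)
  with nz obtain j where j: "j \<in> {..q - 1}"
    "(\<Sum>i\<le>N. if q * i + (q + 1) * j = ?n then poly.coeff (poly.coeff g j) i else 0) \<noteq> 0"
    by (metis (mono_tags, lifting) sum.not_neutral_contains_not_neutral)
  from j(2) obtain i where "(if q * i + (q + 1) * j = ?n then poly.coeff (poly.coeff g j) i else 0) \<noteq> 0"
    by (rule sum.not_neutral_contains_not_neutral)
  then have eq: "q * i + (q + 1) * j = ?n" by (auto split: if_splits)
  have "j < q" using j q2 by auto
  then show ?thesis using eq Phi_coeff[OF g(1), of j i] by (intro exI[of _ i] exI[of _ j]) auto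
qed

lemma f_eq: "f = Polynomial.monom 1 q + Polynomial.monom 1 1
    - Polynomial.monom (Polynomial.monom 1 (q + 1) + Polynomial.monom a0 2) 0"
  unfolding f_def curve_poly_def S_poly_def
  by (simp add: monom_0 distrib_left mult_monom numeral_2_eq_2)

lemma f_degree: "Polynomial.degree f = q" and f_coeff_q: "poly.coeff f q = 1"
proof -
  show 1: "poly.coeff f q = 1" unfolding f_eq using q2 by simp
  show "Polynomial.degree f = q"
  proof (rule antisym)
    show "Polynomial.degree f \<le> q"
      unfolding f_eq using q2 degree_monom_le[of "1 :: 'a poly"]
      by (intro degree_diff_le degree_add_le) (auto intro: order_trans degree_monom_le)
    show "q \<le> Polynomial.degree f" using 1 by (intro le_degree) simp
  qed
qed

lemma f_nz: "f \<noteq> 0"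
  using f_coeff_q by auto

lemma f_Wle: "Wle (q * (q + 1)) f"
  unfolding Wle_def
proof (intro allI impI)
  fix i j assume nz: "poly.coeff (poly.coeff f j) i \<noteq> 0"
  have "(j = q \<and> i = 0) \<or> (j = 1 \<and> i = 0) \<or> (j = 0 \<and> i = q + 1) \<or> (j = 0 \<and> i = 2)"
    using nz unfolding f_eq by (auto split: if_splits simp: coeff_1 one_pCons coeff_pCons split: nat.splits)
  then show "q * i + (q + 1) * j \<le> q * (q + 1)" using q2 by auto
qed

text \<open>\<open>Y ^ q\<close> and \<open>X ^ (q + 1)\<close> have the same image and cancel. What
  remains has degree at most \<open>2 * q\<close>, below the weight \<open>q * (q + 1)\<close> of
  \<open>f\<close>; this gap drives \<open>reduce\<close>.\<close>

lemma Phi_f_degree: "Polynomial.degree (\<Phi> f) \<le> 2 * q"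
proof -
  have "\<Phi> f = Polynomial.monom 1 (q + 1) - Polynomial.monom a0 (2 * q)"
    unfolding f_eq Phi.h_diff Phi.h_add Phi_monom[of "1 :: 'a poly"] Phi_monom[of "_ + _"]
    by (simp add: pcompose_add pcompose_monom pcompose_1 monom_power smult_monom mult_monom algebra_simps)
  then show ?thesis
    using q2 degree_monom_le[of "1::'a" "q + 1"] degree_monom_le[of a0 "2 * q"]
    by (auto intro!: degree_diff_le)
qed

definition subring_set :: "'a set \<Rightarrow> bool" where
  "subring_set k \<longleftrightarrow> 0 \<in> k \<and> 1 \<in> k \<and> (\<forall>a\<in>k. \<forall>b\<in>k. a + b \<in> k \<and> a * b \<in> k) \<and> (\<forall>a\<in>k. - a \<in> k)"

lemma coeff_mult_closed:
  assumes "0 \<in> R" "\<And>a b. a \<in> R \<Longrightarrow> b \<in> R \<Longrightarrow> a + b \<in> R" "\<And>a b. a \<in> R \<Longrightarrow> b \<in> R \<Longrightarrow> a * b \<in> R"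
    and "\<And>i. poly.coeff (p :: 'b::comm_ring_1 poly) i \<in> R" "\<And>i. poly.coeff r i \<in> R"
  shows "poly.coeff (p * r) i \<in> R"
proof -
  have sum: "sum g I \<in> R" if "\<And>i. i \<in> I \<Longrightarrow> g i \<in> R" for g :: "nat \<Rightarrow> 'b" and I
    using that by (induction I rule: infinite_finite_induct) (auto intro: assms(1,2))
  show ?thesis unfolding coeff_mult by (rule sum) (rule assms(3)[OF assms(4,5)])
qed

lemma polys_over_add: "subring_set k \<Longrightarrow> g \<in> polys_over k \<Longrightarrow> h \<in> polys_over k \<Longrightarrow> g + h \<in> polys_over k"
  unfolding polys_over_def subring_set_def by simp

lemma polys_over_diff: "subring_set k \<Longrightarrow> g \<in> polys_over k \<Longrightarrow> h \<in> polys_over k \<Longrightarrow> g - h \<in> polys_over k"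
proof -
  assume k: "subring_set k" and gh: "g \<in> polys_over k" "h \<in> polys_over k"
  have "a - b \<in> k" if "a \<in> k" "b \<in> k" for a b
    using k that unfolding subring_set_def by (metis diff_conv_add_uminus)
  then show ?thesis using gh by (simp add: polys_over_def)
qed

lemma polys_over_mult:
  assumes k: "subring_set k" and gh: "g \<in> polys_over k" "h \<in> polys_over k"
  shows "g * h \<in> polys_over k"
proof -
  let ?R = "{p :: 'a poly. \<forall>i. poly.coeff p i \<in> k}"
  have "poly.coeff (g * h) j \<in> ?R" for j
  proof (rule coeff_mult_closed)
    show "a * b \<in> ?R" if "a \<in> ?R" "b \<in> ?R" for a b
      using that k by (auto intro!: coeff_mult_closed simp: subring_set_def)
  qed (use k gh in \<open>auto simp: subring_set_def polys_over_def\<close>)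
  then show ?thesis by (simp add: polys_over_def)
qed

lemma polys_over_monom: "subring_set k \<Longrightarrow> (\<And>i. poly.coeff c i \<in> k) \<Longrightarrow> Polynomial.monom c j \<in> polys_over k"
  by (simp add: polys_over_def subring_set_def)

lemma f_polys_over: "subring_set k \<Longrightarrow> a0 \<in> k \<Longrightarrow> f \<in> polys_over k"
  unfolding f_eq
  by (intro polys_over_add polys_over_diff polys_over_monom)
     (auto simp: subring_set_def coeff_1 one_pCons coeff_pCons split: nat.splits)

text \<open>Division by \<open>f\<close>, which is monic in \<open>Y\<close>. A subtracted multiple
  \<open>f * h0\<close> has weight at most \<open>m\<close>, but its image under
  \<open>\<Phi>\<close> has degree below \<open>m\<close>, so the coefficient at \<open>m\<close>
  survives.\<close>

lemma reduce:
  assumes k: "subring_set k" "a0 \<in> k" and g: "g \<in> polys_over k" "Wle m g"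
  shows "\<exists>h\<in>polys_over k. \<exists>g'\<in>polys_over k. g = f * h + g' \<and> Polynomial.degree g' < q \<and> Wle m g' \<and>
    poly.coeff (\<Phi> g') m = poly.coeff (\<Phi> g) m"
  using g
proof (induction "Polynomial.degree g" arbitrary: g rule: less_induct)
  case less
  show ?case
  proof (cases "Polynomial.degree g < q")
    case True
    moreover have "0 \<in> polys_over k" using k by (simp add: polys_over_def subring_set_def)
    ultimately show ?thesis using less.prems by (intro bexI[of _ 0] bexI[of _ g]) auto
  next
    case False
    define d where "d = Polynomial.degree g"
    define c where "c = poly.coeff g d"
    define h0 where "h0 = Polynomial.monom c (d - q)"
    define g1 where "g1 = g - f * h0"
    have d: "d \<ge> q" using False d_def by simp
    have gnz: "g \<noteq> 0" using False q2 by auto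
    have cnz: "c \<noteq> 0" unfolding c_def d_def using gnz by simp
    then obtain i0 where i0: "poly.coeff c i0 \<noteq> 0" by (metis leading_coeff_neq_0)
    have weight: "q * i + (q + 1) * d \<le> m" if "poly.coeff c i \<noteq> 0" for i
      using less.prems(2) that unfolding Wle_def c_def by blast
    have qd: "(q + 1) * d = (q + 1) * (d - q) + q * (q + 1)"
    proof -
      have "d = (d - q) + q" using d by simp
      then show ?thesis by (metis add_mult_distrib2 mult.commute)
    qed
    have mge: "q * (q + 1) \<le> m" using weight[OF i0] qd by linarith
    have h0W: "Wle (m - q * (q + 1)) h0"
      unfolding Wle_def h0_def
    proof (intro allI impI)
      fix i j assume "poly.coeff (poly.coeff (Polynomial.monom c (d - q)) j) i \<noteq> 0"
      then have "j = d - q" "poly.coeff c i \<noteq> 0" by (auto split: if_splits)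
      then show "q * i + (q + 1) * j \<le> m - q * (q + 1)" using weight[of i] qd by simp
    qed
    have h0k: "h0 \<in> polys_over k" unfolding h0_def
      using less.prems(1) by (intro polys_over_monom k) (simp add: c_def polys_over_def)
    have fk: "f \<in> polys_over k" by (rule f_polys_over[OF k])
    have fhW: "Wle m (f * h0)" using Wle_mult[OF f_Wle h0W] mge by simp
    have deg_fh: "Polynomial.degree (f * h0) = d" "poly.coeff (f * h0) d = c"
    proof -
      have "h0 \<noteq> 0" unfolding h0_def using cnz by simp
      then show "Polynomial.degree (f * h0) = d"
        using degree_mult_eq[OF f_nz] f_degree d cnz by (simp add: h0_def degree_monom_eq)
      have "f * h0 = Polynomial.monom c (d - q) * f" unfolding h0_def by (rule mult.commute)
      then have "poly.coeff (f * h0) d = poly.coeff (Polynomial.monom c (d - q) * f) d" by (rule arg_cong)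
      then show "poly.coeff (f * h0) d = c" using d f_coeff_q by (simp add: coeff_monom_mult)
    qed
    have "Polynomial.degree g1 \<le> d" unfolding g1_def using deg_fh by (intro degree_diff_le) (auto simp: d_def)
    moreover have "poly.coeff g1 d = 0" unfolding g1_def using deg_fh by (simp add: c_def)
    ultimately have "g1 = 0 \<or> Polynomial.degree g1 < d" by (rule eq_zero_or_degree_less)
    then have less_d: "Polynomial.degree g1 < Polynomial.degree g" using d q2 unfolding d_def by auto
    have g1k: "g1 \<in> polys_over k" unfolding g1_def
      using less.prems(1) fk h0k k by (intro polys_over_diff polys_over_mult)
    have g1W: "Wle m g1" unfolding g1_def by (rule Wle_diff[OF less.prems(2) fhW])
    obtain h g' where hg: "h \<in> polys_over k" "g' \<in> polys_over k" "g1 = f * h + g'" "Polynomial.degree g' < q"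
      "Wle m g'" "poly.coeff (\<Phi> g') m = poly.coeff (\<Phi> g1) m"
      using less.hyps[OF less_d g1k g1W] by blast
    have "poly.coeff (\<Phi> (f * h0)) m = 0"
    proof (rule coeff_eq_0)
      have "Polynomial.degree (\<Phi> (f * h0)) \<le> Polynomial.degree (\<Phi> f) + Polynomial.degree (\<Phi> h0)"
        unfolding Phi.h_mult by (rule degree_mult_le)
      also have "\<dots> \<le> 2 * q + (m - q * (q + 1))" by (intro add_mono Phi_f_degree Phi_degree_le h0W)
      also have "\<dots> < m"
      proof -
        have "2 * q < q * (q + 1)" using q2 by simp
        then show ?thesis using mge by linarith
      qed
      finally show "Polynomial.degree (\<Phi> (f * h0)) < m" .
    qed
    then have "poly.coeff (\<Phi> g1) m = poly.coeff (\<Phi> g) m" unfolding g1_def Phi.h_diff by simp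
    moreover have "g = f * (h + h0) + g'" using hg(3) unfolding g1_def by (simp add: algebra_simps)
    ultimately show ?thesis using hg polys_over_add[OF k(1) hg(1) h0k] by metis
  qed
qed

lemma reduced_dvd_zero: "Polynomial.degree (f * h) < q \<Longrightarrow> h = 0"
  using degree_mult_eq[OF f_nz, of h] f_degree by auto

text \<open>The top coefficient of \<open>\<Phi> g1 * \<Phi> g2\<close> is nonzero and is preserved
  by \<open>reduce\<close>, so the remainder is nonzero and its weight is the sum of the
  weights.\<close>

lemma reduced_product:
  assumes k: "subring_set k" "a0 \<in> k"
    and g: "g1 \<in> polys_over k" "g2 \<in> polys_over k" "Polynomial.degree g1 < q" "Polynomial.degree g2 < q" "g1 \<noteq> 0" "g2 \<noteq> 0"
  shows "\<exists>h\<in>polys_over k. \<exists>g'\<in>polys_over k. g1 * g2 = f * h + g' \<and> Polynomial.degree g' < q \<and> g' \<noteq> 0 \<and>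
    Polynomial.degree (\<Phi> g') = Polynomial.degree (\<Phi> g1) + Polynomial.degree (\<Phi> g2)"
proof -
  let ?m1 = "Polynomial.degree (\<Phi> g1)" and ?m2 = "Polynomial.degree (\<Phi> g2)"
  have nz: "\<Phi> g1 \<noteq> 0" "\<Phi> g2 \<noteq> 0" using Phi_inj g by auto
  have "Wle (?m1 + ?m2) (g1 * g2)" by (intro Wle_mult reduced_Wle g)
  from reduce[OF k polys_over_mult[OF k(1) g(1,2)] this]
  obtain h g' where hg: "h \<in> polys_over k" "g' \<in> polys_over k" "g1 * g2 = f * h + g'" "Polynomial.degree g' < q"
    "Wle (?m1 + ?m2) g'" "poly.coeff (\<Phi> g') (?m1 + ?m2) = poly.coeff (\<Phi> (g1 * g2)) (?m1 + ?m2)" by blast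
  have "poly.coeff (\<Phi> g') (?m1 + ?m2) \<noteq> 0"
    unfolding hg(6) Phi.h_mult coeff_mult_degree_sum using nz by simp
  then have "?m1 + ?m2 \<le> Polynomial.degree (\<Phi> g')" "g' \<noteq> 0" by (auto intro: le_degree simp: Phi.h_zero)
  moreover have "Polynomial.degree (\<Phi> g') \<le> ?m1 + ?m2" by (rule Phi_degree_le[OF hg(5)])
  ultimately show ?thesis using hg by (metis antisym)
qed

lemma subring_UNIV: "subring_set UNIV"
  by (simp add: subring_set_def)

text \<open>Applied over the whole base field rather than \<open>k\<close>, which is what geometric
  irreducibility calls for.\<close>

lemma f_not_dvd_product:
  assumes "Polynomial.degree g1 < q" "Polynomial.degree g2 < q" "g1 \<noteq> 0" "g2 \<noteq> 0"
  shows "\<not> f dvd g1 * g2"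
proof
  assume "f dvd g1 * g2"
  then obtain e where e: "g1 * g2 = f * e" by (rule dvdE)
  have U: "g \<in> polys_over UNIV" for g by (simp add: polys_over_def)
  obtain h g' where hg: "g1 * g2 = f * h + g'" "Polynomial.degree g' < q" "g' \<noteq> 0"
    using reduced_product[OF subring_UNIV UNIV_I U U assms] by blast
  have "g' = f * (e - h)" using hg(1) e by (simp add: algebra_simps)
  then show False using reduced_dvd_zero[of "e - h"] hg by auto
qed

text \<open>Since \<open>f\<close> is monic in \<open>Y\<close>, a factor of degree 0 in
  \<open>Y\<close> is a unit; otherwise both factors have degree below \<open>q\<close>, which
  \<open>f_not_dvd_product\<close> rules out.\<close>

lemma f_irreducible: "Factorial_Ring.irreducible f"
proof (rule Factorial_Ring.irreducibleI)
  show "f \<noteq> 0" by (rule f_nz)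
  show "\<not> f dvd 1"
  proof
    assume "f dvd 1"
    then obtain e where "f * e = 1" by (metis dvdE)
    then show False using reduced_dvd_zero[of e] q2 by simp
  qed
  fix a b assume ab: "f = a * b"
  have nz: "a \<noteq> 0" "b \<noteq> 0" using ab f_nz by auto
  have deg: "Polynomial.degree a + Polynomial.degree b = q" using degree_mult_eq[OF nz] ab f_degree by simp
  have lead: "Polynomial.lead_coeff a * Polynomial.lead_coeff b = 1"
    using lead_coeff_mult[of a b] ab f_degree f_coeff_q by simp
  have unit: "g dvd 1" if g: "Polynomial.degree g = 0" "Polynomial.lead_coeff g * c = 1" for g :: "'a poly poly" and c
  proof -
    have "g = [:Polynomial.lead_coeff g:]" using degree_0_id[OF g(1)] g(1) by simp
    then have "1 = g * [:c:]" using g(2) by (metis mult_pCons_left mult_zero_left pCons_0_0 add_0_right smult_pCons smult_0_right one_pCons)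
    then show ?thesis by (rule dvdI)
  qed
  show "a dvd 1 \<or> b dvd 1"
  proof (rule ccontr)
    assume nu: "\<not> (a dvd 1 \<or> b dvd 1)"
    then have "Polynomial.degree a \<noteq> 0" "Polynomial.degree b \<noteq> 0"
      using unit[OF _ lead] unit[of b "Polynomial.lead_coeff a"] lead by (metis mult.commute)+
    then have "Polynomial.degree a < q" "Polynomial.degree b < q" using deg by auto
    then show False using f_not_dvd_product[of a b] nz ab by auto
  qed
qed

end

section \<open>Generic points in the universal field\<close>

lemma rhom_const: "rhom (const :: 'a::field \<Rightarrow> 'a universal_field)"
proof
  fix a b :: 'a
  have "Fract [:a + b:] 1 = Fract [:a:] 1 + Fract [:b:] 1" by simp
  then show "const (a + b) = const a + const b" unfolding const_def by (metis to_ac_add)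
  have "Fract [:a * b:] 1 = Fract [:a:] 1 * Fract [:b:] 1" by (simp add: mult.commute)
  then show "const (a * b) = const a * const b" unfolding const_def by (metis to_ac_mult)
  have "Fract [:1:] 1 = (1 :: 'a poly fract)" by (simp add: One_fract_def one_pCons)
  then show "const (1 :: 'a) = 1" unfolding const_def by simp
qed

interpretation const: rhom const
  by (rule rhom_const)

lemma const_eq_iff: "const a = const b \<longleftrightarrow> a = b"
  unfolding const_def by (simp add: eq_fract)

lemma inj_const: "inj const"
  by (auto simp: inj_def const_eq_iff)

lemma const_inverse: "const (inverse a) = inverse (const a)"
proof (cases "a = 0")
  case False
  then have "const a * const (inverse a) = 1" by (simp add: const.h_mult[symmetric] const.h_one)
  then show ?thesis by (metis inverse_unique)
qed (simp add: const.h_zero)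

lemma eval2_eq: "eval2 g x y = rhom.sub (const.sub x) y g"
  unfolding eval2_def rhom.sub_def[OF const.rhom_sub] const.sub_def ..

interpretation eval2: rhom "\<lambda>g. eval2 g x y" for x y
  unfolding eval2_eq by (rule rhom.rhom_sub[OF const.rhom_sub])

lemma eval2_monom: "eval2 (Polynomial.monom c j) x y = const.sub x c * y ^ j"
  unfolding eval2_eq by (rule rhom.sub_monom[OF const.rhom_sub])

lemma eval2_monom_monom: "eval2 (Polynomial.monom (Polynomial.monom c i) j) x y = const c * x ^ i * y ^ j"
  by (simp add: eval2_monom const.sub_monom)

lemma const_sub_generic: "const.sub (to_ac (Fract [:0, 1:] 1)) c = to_ac (Fract c 1)"
proof (induction c)
  case 0
  then show ?case by (simp add: const.sub_zero Zero_fract_def[symmetric])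
next
  case (pCons a c)
  have "Fract (pCons a c) 1 = Fract [:a:] 1 + Fract [:0, 1:] 1 * Fract c 1" by simp
  then have "to_ac (Fract (pCons a c) 1) = to_ac (Fract [:a:] 1) + to_ac (Fract [:0, 1:] 1) * to_ac (Fract c 1)"
    by (simp only: to_ac_add to_ac_mult)
  then show ?case unfolding const.sub_pCons pCons.IH by (simp only: const_def)
qed

context weighted
begin

lemma eval2_f: "eval2 f x y = y ^ q + y - (x ^ (q + 1) + const a0 * x ^ 2)"
proof -
  have "const.sub x (Polynomial.monom 1 (q + 1) + Polynomial.monom a0 2) = x ^ (q + 1) + const a0 * x ^ 2"
    unfolding const.sub_add const.sub_monom by (simp add: const.h_one)
  moreover have "const.sub x (1 :: 'a poly) = 1" by (rule const.sub_one)
  ultimately show ?thesis unfolding f_eq eval2.h_diff eval2.h_add eval2_monom by simp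
qed

text \<open>A nonzero polynomial \<open>g1\<close> of least degree in \<open>Y\<close> that vanishes
  at the point has zero pseudo-remainder in \<open>f\<close>, so \<open>g1 * s\<close> is a multiple
  of \<open>f\<close>. As \<open>x\<close> is transcendental, \<open>g1\<close> involves
  \<open>Y\<close>; both factors then have degree below \<open>q\<close>, a contradiction.\<close>

lemma generic_reduced_zero:
  fixes x y :: "'a universal_field"
  assumes x: "x = to_ac (Fract [:0, 1:] 1)" and y: "eval2 f x y = 0"
    and g: "eval2 g x y = 0" "Polynomial.degree g < q"
  shows "g = 0"
proof (rule ccontr)
  assume "g \<noteq> 0"
  let ?P = "\<lambda>d. \<exists>g. g \<noteq> 0 \<and> eval2 g x y = 0 \<and> Polynomial.degree g = d"
  define d where "d = (LEAST d. ?P d)"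
  have ex: "?P (Polynomial.degree g)" using \<open>g \<noteq> 0\<close> g by blast
  obtain g1 where g1: "g1 \<noteq> 0" "eval2 g1 x y = 0" "Polynomial.degree g1 = d"
    using LeastI[of ?P, OF ex] unfolding d_def by blast
  have "d \<le> Polynomial.degree g" unfolding d_def by (rule Least_le[of ?P, OF ex])
  then have dq: "d < q" using g by simp
  have min: "r = 0" if "eval2 r x y = 0" "Polynomial.degree r < d" for r
    using not_less_Least[of "Polynomial.degree r" ?P] that unfolding d_def by blast
  obtain a s where as: "a \<noteq> 0" "smult a f = g1 * s + pseudo_mod f g1" using pseudo_mod(1)[OF g1(1), of f] by blast
  have "pseudo_mod f g1 = 0"
  proof (rule ccontr)
    assume nz: "pseudo_mod f g1 \<noteq> 0"
    have "Polynomial.degree (pseudo_mod f g1) < d" using nz pseudo_mod(2)[OF g1(1), of f] g1(3) by simp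
    have pm: "pseudo_mod f g1 = f * [:a:] - g1 * s" using as(2) by (simp add: algebra_simps)
    have "eval2 (pseudo_mod f g1) x y = 0" unfolding pm eval2.h_diff eval2.h_mult y g1(2) by simp
    then show False using min nz \<open>Polynomial.degree (pseudo_mod f g1) < d\<close> by blast
  qed
  with as have eq: "f * [:a:] = g1 * s" by simp
  then have "s \<noteq> 0" using as(1) f_nz by auto
  have "Polynomial.degree (f * [:a:]) = q" using degree_mult_eq[OF f_nz, of "[:a:]"] as(1) f_degree by simp
  then have "d + Polynomial.degree s = q" unfolding eq using degree_mult_eq[OF g1(1) \<open>s \<noteq> 0\<close>] g1(3) by simp
  moreover have "d \<noteq> 0"
  proof
    assume "d = 0"
    then have g1c: "g1 = Polynomial.monom (poly.coeff g1 0) 0" using g1(3) degree_0_id[of g1] by (simp add: monom_0)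
    have "eval2 g1 x y = to_ac (Fract (poly.coeff g1 0) 1)"
      by (subst g1c) (simp add: eval2_monom x const_sub_generic)
    then have "Fract (poly.coeff g1 0) 1 = 0" using g1(2) by simp
    then have "poly.coeff g1 0 = 0" by (simp add: Zero_fract_def eq_fract)
    then show False using g1c g1(1) by simp
  qed
  ultimately have "Polynomial.degree s < q" by simp
  then show False using f_not_dvd_product[of g1 s] dq g1 \<open>s \<noteq> 0\<close> eq by (metis dvd_triv_left)
qed

text \<open>Take the variable itself for \<open>x\<close> and a root of \<open>f\<close> over it for
  \<open>y\<close>. A polynomial that vanishes there has a vanishing remainder modulo
  \<open>f\<close>, which is 0. This gives the choice in \<open>function_field\<close> its
  meaning.\<close>

lemma generic_point_exists:
  assumes k: "subring_set k" "a0 \<in> k"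
  shows "\<exists>P. generic_point k f P"
proof -
  define x :: "'a universal_field" where "x = to_ac (Fract [:0, 1:] 1)"
  define F where "F = map_poly (\<lambda>c. poly (map_poly const c) x) f"
  have "Polynomial.degree F = q"
    unfolding F_def using f_degree f_coeff_q
    by (subst map_poly_degree_eq) (auto simp: const.sub_def[symmetric] const.sub_one)
  then obtain y where "poly F y = 0" using alg_closed_imp_poly_has_root[of F] q2 by auto
  then have y: "eval2 f x y = 0" by (simp add: eval2_def F_def)
  have "generic_point k f (x, y)"
    unfolding generic_point_def fst_conv snd_conv
  proof (intro ballI iffI)
    fix g assume g: "g \<in> polys_over k" and 0: "eval2 g x y = 0"
    obtain m where m: "Wle m g" using ex_Wle by blast
    obtain h g' where hg: "h \<in> polys_over k" "g = f * h + g'" "Polynomial.degree g' < q"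
      using reduce[OF k g m] by blast
    have "eval2 g' x y = 0" using 0 unfolding hg(2) by (simp add: eval2.h_add eval2.h_mult y)
    then have "g' = 0" using generic_reduced_zero[OF x_def y _ hg(3)] by blast
    then show "\<exists>h\<in>polys_over k. g = f * h" using hg by auto
  next
    fix g assume "\<exists>h\<in>polys_over k. g = f * h"
    then show "eval2 g x y = 0" by (auto simp: eval2.h_mult y)
  qed
  then show ?thesis by blast
qed

end

context curve
begin

lemma K_eq_generate: "K = generate_field ring_of_type_algebra (k \<union> {x, y})"
proof
  interpret T: field "ring_of_type_algebra :: 'b ring" by rule
  let ?G = "generate_field (ring_of_type_algebra :: 'b ring) (k \<union> {x, y})"
  have "subring K (ring_of_type_algebra :: 'b ring)"
    by (auto simp: subring_type_iff K_one K_add K_mult K_uminus)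
  then have "subfield K (ring_of_type_algebra :: 'b ring)" using K_inverse by (rule subfield_typeI)
  moreover have "k \<union> {x, y} \<subseteq> K" using k_sub_K A_K x_A y_A by blast
  ultimately show "?G \<subseteq> K" using T.generate_field_min_subfield1[of "k \<union> {x, y}" K] by simp
  have mult: "a * b \<in> ?G" if "a \<in> ?G" "b \<in> ?G" for a b
    using generate_field.eng_mult[OF that] by simp
  have add: "a + b \<in> ?G" if "a \<in> ?G" "b \<in> ?G" for a b
    using generate_field.eng_add[OF that] by simp
  have one: "1 \<in> ?G" using generate_field.one[of "ring_of_type_algebra :: 'b ring"] by simp
  have inv: "inverse a \<in> ?G" if "a \<in> ?G" for a
  proof (cases "a = 0")
    case False
    then show ?thesis using generate_field.m_inv[OF that] by simp
  qed (use that in simp)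
  have pow: "a ^ i \<in> ?G" if "a \<in> ?G" for a and i :: nat
    by (induction i) (simp_all only: power_0 power_Suc one mult that)
  have A: "w \<in> ?G" if "w \<in> A" for w
    using that
  proof (induction rule: A_induct)
    case (mono c i j)
    then show ?case by (intro mult pow generate_field.incl) auto
  qed (rule add)
  show "K \<subseteq> ?G"
  proof
    fix z assume "z \<in> K"
    then obtain g h where "g \<in> A" "h \<in> A" "z = g / h" by (rule K_E)
    then show "z \<in> ?G" using mult[OF A inv[OF A]] by (simp add: field_class.field_divide_inverse)
  qed
qed

end

section \<open>The coordinate ring of a generic point\<close>

locale generic = weighted q a0 for q :: nat and a0 :: "'a::field" +
  fixes n :: nat and k0 :: "'a set" and x y :: "'a universal_field"
  assumes char2: "CHAR('a) = 2" and n1: "n \<ge> 1" and qn: "q = 2 ^ n"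
    and k0_sub: "subring_set k0" and k0_inv: "\<And>c. c \<in> k0 \<Longrightarrow> inverse c \<in> k0"
    and card_k0: "card k0 = q ^ 4" and k0_frob: "\<And>c. c \<in> k0 \<Longrightarrow> c ^ (q ^ 4) = c"
    and a0_k0: "a0 \<in> k0" and gen: "generic_point k0 f (x, y)"
begin

definition "Red = {g \<in> polys_over k0. Polynomial.degree g < q}"

abbreviation "e \<equiv> \<lambda>g. eval2 g x y"

definition "A = e ` polys_over k0"

definition "rep = inv_into Red e"

definition "wt w = Polynomial.degree (\<Phi> (rep w))"

lemma e_zero_iff: "g \<in> polys_over k0 \<Longrightarrow> e g = 0 \<longleftrightarrow> (\<exists>h\<in>polys_over k0. g = f * h)"
  using gen by (simp add: generic_point_def)

lemma f_k0: "f \<in> polys_over k0"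
  by (rule f_polys_over[OF k0_sub a0_k0])

lemma e_f: "e f = 0"
proof -
  have "1 \<in> polys_over k0"
    using polys_over_monom[OF k0_sub, of 1 0] k0_sub by (auto simp: subring_set_def monom_0 one_pCons coeff_pCons split: nat.splits)
  then show ?thesis using e_zero_iff[OF f_k0] by force
qed

lemma Red_add: "g \<in> Red \<Longrightarrow> h \<in> Red \<Longrightarrow> g + h \<in> Red"
  unfolding Red_def using polys_over_add[OF k0_sub] degree_add_less by blast

lemma Red_diff: "g \<in> Red \<Longrightarrow> h \<in> Red \<Longrightarrow> g - h \<in> Red"
  unfolding Red_def using polys_over_diff[OF k0_sub] degree_diff_less by blast

lemma Red_e_zero: assumes "g \<in> Red" "e g = 0" shows "g = 0"
proof -
  obtain h where "g = f * h" using assms e_zero_iff by (auto simp: Red_def)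
  then show ?thesis using reduced_dvd_zero[of h] assms by (auto simp: Red_def)
qed

lemma inj_e: "inj_on e Red"
proof (rule inj_onI)
  fix g h assume gh: "g \<in> Red" "h \<in> Red" "e g = e h"
  then have "e (g - h) = 0" by (simp add: eval2.h_diff)
  then show "g = h" using Red_e_zero[OF Red_diff[OF gh(1,2)]] by simp
qed

lemma e_reduce: assumes "g \<in> polys_over k0" shows "\<exists>g'\<in>Red. e g = e g'"
proof -
  obtain m where "Wle m g" using ex_Wle by blast
  then obtain h g' where "h \<in> polys_over k0" "g' \<in> polys_over k0" "g = f * h + g'" "Polynomial.degree g' < q"
    using reduce[OF k0_sub a0_k0 assms] by blast
  then show ?thesis by (auto simp: Red_def eval2.h_add eval2.h_mult e_f)
qed

lemma A_eq: "A = e ` Red"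
  unfolding A_def using e_reduce by (auto simp: Red_def)

lemma rep_e: "g \<in> Red \<Longrightarrow> rep (e g) = g"
  unfolding rep_def by (rule inv_into_f_f[OF inj_e])

lemma wt_e: "g \<in> Red \<Longrightarrow> wt (e g) = Polynomial.degree (\<Phi> g)"
  unfolding wt_def by (simp add: rep_e)

lemma mono_Red: "c \<in> k0 \<Longrightarrow> j < q \<Longrightarrow> Polynomial.monom (Polynomial.monom c i) j \<in> Red"
  unfolding Red_def using degree_monom_le[of "Polynomial.monom c i" j] k0_sub
  by (auto intro!: polys_over_monom simp: subring_set_def intro: le_less_trans)

lemma e_mono: "e (Polynomial.monom (Polynomial.monom c i) j) = const c * x ^ i * y ^ j"
  by (rule eval2_monom_monom)

lemma A_mult_aux:
  assumes "g1 \<in> Red" "g2 \<in> Red" "g1 \<noteq> 0" "g2 \<noteq> 0"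
  obtains g' h where "g' \<in> Red" "g1 * g2 = f * h + g'" "h \<in> polys_over k0" "e g1 * e g2 = e g'" "g' \<noteq> 0"
    "Polynomial.degree (\<Phi> g') = Polynomial.degree (\<Phi> g1) + Polynomial.degree (\<Phi> g2)"
proof -
  obtain h g' where hg: "h \<in> polys_over k0" "g' \<in> polys_over k0" "g1 * g2 = f * h + g'" "Polynomial.degree g' < q" "g' \<noteq> 0"
    "Polynomial.degree (\<Phi> g') = Polynomial.degree (\<Phi> g1) + Polynomial.degree (\<Phi> g2)"
    using reduced_product[OF k0_sub a0_k0, of g1 g2] assms by (auto simp: Red_def)
  have "e g1 * e g2 = e (f * h + g')" unfolding hg(3)[symmetric] by (simp add: eval2.h_mult)
  also have "\<dots> = e g'" by (simp add: eval2.h_add eval2.h_mult e_f)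
  finally show ?thesis using that hg by (auto simp: Red_def)
qed

lemma point_sub_closed:
  assumes a: "a \<in> k0" and p: "\<And>i. poly.coeff p i \<in> k0"
  shows "poly p a \<in> k0"
  using p
proof (induction p)
  case 0
  then show ?case using k0_sub by (simp add: subring_set_def)
next
  case (pCons c p)
  have "poly.coeff p i \<in> k0" for i using pCons.prems[of "Suc i"] by simp
  then have "poly p a \<in> k0" by (rule pCons.IH)
  then show ?case using pCons.prems[of 0] a k0_sub by (simp add: subring_set_def)
qed

text \<open>Substitute \<open>(a, b)\<close> into the reduced representative. Sums of reduced
  polynomials are reduced; a product is reduced by subtracting a multiple of \<open>f\<close>, which
  vanishes at \<open>(a, b)\<close>.\<close>

lemma point_evaluation:
  assumes a: "a \<in> k0" and b: "b \<in> k0" and ab: "b ^ q + b = a ^ (q + 1) + a0 * a ^ 2"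
  shows "\<exists>v. (\<forall>c\<in>const ` k0. v c = c) \<and> v x = const a \<and> v y = const b \<and>
    (\<forall>g\<in>A. v g \<in> const ` k0 \<and> (\<forall>h\<in>A. v (g + h) = v g + v h \<and> v (g * h) = v g * v h))"
proof -
  have "rhom (\<lambda>c. poly c a)" by unfold_locales simp_all
  then interpret ia: rhom "\<lambda>c. poly c a" .
  interpret E: rhom "ia.sub b" by (rule ia.rhom_sub)
  have Ef: "ia.sub b f = 0"
    unfolding f_eq E.h_diff E.h_add ia.sub_monom using ab by (simp add: poly_monom)
  have Emono: "ia.sub b (Polynomial.monom (Polynomial.monom c i) j) = c * a ^ i * b ^ j" for c i j
    by (simp add: ia.sub_monom poly_monom)
  have Ek: "ia.sub b g \<in> k0" if g: "g \<in> polys_over k0" for g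
    unfolding ia.sub_def
  proof (rule point_sub_closed[OF b])
    fix i
    have "poly (poly.coeff g i) a \<in> k0" using g by (intro point_sub_closed[OF a]) (simp add: polys_over_def)
    then show "poly.coeff (map_poly (\<lambda>c. poly c a) g) i \<in> k0" by (simp add: coeff_map_poly)
  qed
  define v where "v w = const (ia.sub b (rep w))" for w
  have ve: "v (e g) = const (ia.sub b g)" if "g \<in> Red" for g unfolding v_def using that by (simp add: rep_e)
  have vmono: "v (const c * x ^ i * y ^ j) = const (c * a ^ i * b ^ j)" if "c \<in> k0" "j < q" for c i j
    using ve[OF mono_Red[OF that]] by (simp add: e_mono Emono)
  have one: "1 \<in> k0" using k0_sub by (simp add: subring_set_def)
  show ?thesis
  proof (intro exI[of _ v] conjI ballI)
    show "v c = c" if "c \<in> const ` k0" for c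
      using that vmono[of _ 0 0] q2 by auto
    show "v x = const a" using vmono[OF one, of 0 1] q2 by (simp add: const.h_one)
    show "v y = const b" using vmono[OF one, of 1 0] q2 by (simp add: const.h_one)
    fix u assume "u \<in> A"
    then obtain g where g: "g \<in> Red" "u = e g" by (auto simp: A_eq)
    show "v u \<in> const ` k0" using ve[OF g(1)] Ek g by (auto simp: Red_def)
    fix w assume "w \<in> A"
    then obtain h where h: "h \<in> Red" "w = e h" by (auto simp: A_eq)
    have "u + w = e (g + h)" using g h by (simp add: eval2.h_add)
    then show "v (u + w) = v u + v w"
      using ve[OF Red_add[OF g(1) h(1)]] ve[OF g(1)] ve[OF h(1)] g h by (simp add: E.h_add const.h_add)
    show "v (u * w) = v u * v w"
    proof (cases "g = 0 \<or> h = 0")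
      case True
      have "(0 :: 'a poly poly) \<in> Red" using k0_sub q2 by (simp add: Red_def polys_over_def subring_set_def)
      then have "v 0 = 0" using ve[of 0] by (simp add: eval2.h_zero E.h_zero const.h_zero)
      then show ?thesis using True g h by (auto simp: eval2.h_zero)
    next
      case False
      obtain g' l where g': "g' \<in> Red" "g * h = f * l + g'" "e g * e h = e g'"
        using A_mult_aux[OF g(1) h(1)] False by metis
      have "ia.sub b g * ia.sub b h = ia.sub b (f * l + g')" unfolding g'(2)[symmetric] by (simp add: E.h_mult)
      also have "\<dots> = ia.sub b g'" by (simp add: E.h_add E.h_mult Ef)
      finally show ?thesis using ve[OF g(1)] ve[OF h(1)] ve[OF g'(1)] g h g'(3) by (simp add: const.h_mult[symmetric])
    qed
  qed
qed

lemma leading_term: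
  assumes "w \<in> A" "w \<noteq> 0"
  shows "\<exists>c\<in>const ` k0. \<exists>i j. c \<noteq> 0 \<and> j < q \<and> wt w = q * i + (q + 1) * j \<and>
    (w + c * x ^ i * y ^ j = 0 \<or> wt (w + c * x ^ i * y ^ j) < wt w)"
proof -
  obtain g where g: "g \<in> Red" "w = e g" using assms(1) by (auto simp: A_eq)
  then have gnz: "g \<noteq> 0" using assms(2) by (auto simp: eval2.h_zero)
  have gd: "Polynomial.degree g < q" using g by (simp add: Red_def)
  obtain i j where ij: "j < q" "Polynomial.degree (\<Phi> g) = q * i + (q + 1) * j"
    "poly.coeff (poly.coeff g j) i = poly.coeff (\<Phi> g) (Polynomial.degree (\<Phi> g))"
    using reduced_lead[OF gd gnz] by blast
  define c where "c = poly.coeff (poly.coeff g j) i"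
  have c0: "c \<noteq> 0" using ij(3) Phi_inj[OF gd] gnz unfolding c_def by auto
  have ck: "c \<in> k0" using g(1) unfolding c_def by (simp add: Red_def polys_over_def)
  \<comment> \<open>In characteristic 2, adding the leading monomial once more cancels it.\<close>
  define g2 where "g2 = g + Polynomial.monom (Polynomial.monom c i) j"
  have g2: "g2 \<in> Red" unfolding g2_def by (intro Red_add g mono_Red ck ij)
  have e2: "e g2 = w + const c * x ^ i * y ^ j" by (simp add: g2_def eval2.h_add e_mono g)
  let ?n = "Polynomial.degree (\<Phi> g)"
  have Phi2: "\<Phi> g2 = \<Phi> g + Polynomial.monom c ?n"
    unfolding g2_def Phi.h_add Phi_monom_monom ij(2) ..
  have "Polynomial.degree (\<Phi> g2) \<le> ?n" unfolding Phi2 by (intro degree_add_le degree_monom_le order_refl)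
  moreover have "poly.coeff (\<Phi> g2) ?n = c + c" unfolding Phi2 using ij(3) by (simp add: c_def)
  then have "poly.coeff (\<Phi> g2) ?n = 0" by (simp only: char2_add_self[OF char2])
  ultimately have "\<Phi> g2 = 0 \<or> Polynomial.degree (\<Phi> g2) < ?n" by (rule eq_zero_or_degree_less)
  then have "w + const c * x ^ i * y ^ j = 0 \<or> wt (w + const c * x ^ i * y ^ j) < wt w"
  proof
    assume "\<Phi> g2 = 0"
    then have "g2 = 0" using g2 Phi_inj[of g2] by (simp add: Red_def)
    then show ?thesis using e2 by (simp add: eval2.h_zero)
  next
    assume "Polynomial.degree (\<Phi> g2) < ?n"
    then show ?thesis using wt_e[OF g2] wt_e[OF g(1)] e2 g(2) by simp
  qed
  moreover have "const c \<noteq> 0" using c0 const_eq_iff[of c 0] by (simp add: const.h_zero)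
  ultimately show ?thesis using ij ck wt_e[OF g(1)] g(2) by (intro bexI[of _ "const c"] exI[of _ i] exI[of _ j]) auto
qed

sublocale C: curve "const ` k0" A x y "const a0" n q wt
proof
  have one: "1 \<in> k0" using k0_sub by (simp add: subring_set_def)
  have xe: "x = e (Polynomial.monom (Polynomial.monom 1 1) 0)" and ye: "y = e (Polynomial.monom (Polynomial.monom 1 0) 1)"
    by (simp_all only: e_mono) (simp_all add: const.h_one)
  have "0 < q" "1 < q" using q2 by auto
  then have xR: "Polynomial.monom (Polynomial.monom 1 1) 0 \<in> Red" and yR: "Polynomial.monom (Polynomial.monom 1 0) 1 \<in> Red"
    by (auto intro: mono_Red one simp del: monom_0 monom_eq_1 One_nat_def)
  show "CHAR('a universal_field) = 2"
  proof -
    have "of_nat 2 = (0 :: 'a)" using of_nat_CHAR[where ?'a = 'a] char2 by simp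
    then have "const (1 + 1 :: 'a) = 0" by (simp add: const.h_zero)
    then have "const 1 + const (1 :: 'a) = 0" by (simp only: const.h_add)
    then have "(1 + 1 :: 'a universal_field) = 0" by (simp only: const.h_one)
    then have "of_nat 2 = (0 :: 'a universal_field)" by simp
    then have "CHAR('a universal_field) dvd 2" by (simp only: of_nat_eq_0_iff_char_dvd)
    moreover have "CHAR('a universal_field) \<noteq> 1" by simp
    ultimately show ?thesis using prime_nat_iff two_is_prime_nat by blast
  qed
  show "n \<ge> 1" "q = 2 ^ n" by (rule n1 qn)+
  show "1 \<in> const ` k0" using one const.h_one by (metis image_eqI)
  show "a + b \<in> const ` k0" "a * b \<in> const ` k0" if "a \<in> const ` k0" "b \<in> const ` k0" for a b
    using that k0_sub by (auto simp: subring_set_def const.h_add[symmetric] const.h_mult[symmetric])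
  show "inverse a \<in> const ` k0" if "a \<in> const ` k0" for a
    using that k0_inv by (auto simp: const_inverse[symmetric])
  show "card (const ` k0) = q ^ 4" using card_k0 by (simp add: card_image inj_on_subset[OF inj_const])
  show "c ^ (q ^ 4) = c" if "c \<in> const ` k0" for c
    using that k0_frob by (auto simp: const.h_power[symmetric])
  show "const ` k0 \<subseteq> A"
  proof
    fix c assume "c \<in> const ` k0"
    then obtain d where "d \<in> k0" "c = const d" by blast
    then show "c \<in> A" using mono_Red[of d 0 0] e_mono[of d 0 0] q2 by (auto simp: A_eq intro!: image_eqI)
  qed
  show "x \<in> A" "y \<in> A" using xe xR ye yR unfolding A_eq by blast+
  show "g + h \<in> A" "g * h \<in> A" if "g \<in> A" "h \<in> A" for g h
    using that polys_over_add[OF k0_sub] polys_over_mult[OF k0_sub]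
    by (auto simp: A_def eval2.h_add[symmetric] eval2.h_mult[symmetric])
  show "const a0 \<in> const ` k0" using a0_k0 by blast
  show "y ^ q + y = x ^ (q + 1) + const a0 * x ^ 2" using e_f unfolding eval2_f by simp
  show "wt (g * h) = wt g + wt h" if gh: "g \<in> A" "h \<in> A" "g \<noteq> 0" "h \<noteq> 0" for g h
  proof -
    obtain g1 g2 where R: "g1 \<in> Red" "g = e g1" "g2 \<in> Red" "h = e g2" using gh by (auto simp: A_eq)
    then have "g1 \<noteq> 0" "g2 \<noteq> 0" using gh by (auto simp: eval2.h_zero)
    then obtain g' where "g' \<in> Red" "e g1 * e g2 = e g'"
      "Polynomial.degree (\<Phi> g') = Polynomial.degree (\<Phi> g1) + Polynomial.degree (\<Phi> g2)"
      using A_mult_aux[OF R(1,3)] by metis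
    then show ?thesis using R by (simp add: wt_e)
  qed
  show "wt (g + h) \<le> max (wt g) (wt h)" if gh: "g \<in> A" "h \<in> A" for g h
  proof -
    obtain g1 g2 where R: "g1 \<in> Red" "g = e g1" "g2 \<in> Red" "h = e g2" using gh by (auto simp: A_eq)
    have "g + h = e (g1 + g2)" using R by (simp add: eval2.h_add)
    then show ?thesis using wt_e[OF Red_add[OF R(1,3)]] R by (simp add: wt_e Phi.h_add degree_add_le_max)
  qed
  show "x \<noteq> 0" using Red_e_zero[OF xR] xe by auto
  show "y \<noteq> 0" using Red_e_zero[OF yR] ye by auto
  show "wt x = q" using wt_e[OF xR] xe unfolding Phi_monom_monom by (simp add: degree_monom_eq)
  show "wt y = q + 1" using wt_e[OF yR] ye unfolding Phi_monom_monom by (simp add: degree_monom_eq)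
  show "\<exists>c\<in>const ` k0. \<exists>i j. c \<noteq> 0 \<and> j < q \<and> wt w = q * i + (q + 1) * j \<and>
    (w + c * x ^ i * y ^ j = 0 \<or> wt (w + c * x ^ i * y ^ j) < wt w)" if "w \<in> A" "w \<noteq> 0" for w
    using leading_term[OF that] .
  show "\<exists>v. (\<forall>c\<in>const ` k0. v c = c) \<and> v x = a \<and> v y = b \<and>
    (\<forall>g\<in>A. v g \<in> const ` k0 \<and> (\<forall>h\<in>A. v (g + h) = v g + v h \<and> v (g * h) = v g * v h))"
    if ab: "a \<in> const ` k0" "b \<in> const ` k0" "b ^ q + b = a ^ (q + 1) + const a0 * a ^ 2" for a b
  proof -
    obtain a' b' where ab': "a' \<in> k0" "a = const a'" "b' \<in> k0" "b = const b'" using ab by blast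
    have "const (b' ^ q + b') = const (a' ^ (q + 1) + a0 * a' ^ 2)"
      using ab(3) unfolding ab' by (simp add: const.h_add const.h_mult const.h_power)
    then show ?thesis using point_evaluation[OF ab'(1,3)] unfolding const_eq_iff ab' by blast
  qed
qed

lemma card_points: "card C.points = card {(a, b). a \<in> k0 \<and> b \<in> k0 \<and> b ^ q + b = a ^ (q + 1) + a0 * a ^ 2}"
proof -
  let ?S = "{(a, b). a \<in> k0 \<and> b \<in> k0 \<and> b ^ q + b = a ^ (q + 1) + a0 * a ^ 2}"
  have eq: "const b ^ q + const b = const a ^ (q + 1) + const a0 * const a ^ 2 \<longleftrightarrow> b ^ q + b = a ^ (q + 1) + a0 * a ^ 2" for a b
  proof -
    have "const b ^ q + const b = const a ^ (q + 1) + const a0 * const a ^ 2 \<longleftrightarrow>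
      const (b ^ q + b) = const (a ^ (q + 1) + a0 * a ^ 2)"
      by (simp add: const.h_add const.h_mult const.h_power)
    then show ?thesis unfolding const_eq_iff .
  qed
  have "C.points = map_prod const const ` ?S"
    unfolding C.points_def using eq by (auto simp: image_iff)
  moreover have "inj_on (map_prod const const) ?S"
    by (auto simp: inj_on_def const_eq_iff)
  ultimately show ?thesis by (simp add: card_image)
qed

end

section \<open>Counting points\<close>

text \<open>The two polynomial representations list coefficients in opposite order, hence
  \<open>rev\<close>.\<close>

lemma algebraic_closure_has_root:
  fixes p :: "'a::field poly"
  assumes "algebraic_closure (ring_of_type_algebra :: 'a ring) F" and p: "Polynomial.degree p > 0"
  shows "\<exists>x. poly p x = 0"
proof -
  define L where "L = (ring_of_type_algebra :: 'a ring)"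
  interpret algebraic_closure L F using assms(1) by (simp add: L_def)
  define P where "P = rev (Polynomial.coeffs p)"
  have deg: "Polynomials.degree P = Polynomial.degree p"
    by (auto simp: P_def degree_eq_length_coeffs)
  have P: "P \<in> carrier (poly_ring L)"
    using p by (auto simp: P_def L_def univ_poly_def polynomial_def hd_rev last_coeffs_eq_coeff_degree)
  then have "splitted P" using roots_over_carrier by blast
  then have "roots P \<noteq> {#}" unfolding splitted_def using deg p by auto
  then obtain x where "x \<in># roots P" by blast
  then have x: "is_root P x" using roots_mem_iff_is_root[OF P] by auto
  have ops: "a \<otimes>\<^bsub>L\<^esub> b = a * b" "a \<oplus>\<^bsub>L\<^esub> b = a + b" "a [^]\<^bsub>L\<^esub> i = a ^ i" "\<zero>\<^bsub>L\<^esub> = 0" for a b and i :: nat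
    by (simp_all add: L_def)
  have "eval xs x = poly (Poly (rev xs)) x" for xs
    by (induction xs) (simp_all add: ops Poly_append poly_monom)
  from this[of P] have "eval P x = poly p x" by (simp add: P_def)
  then have "poly p x = 0" using x by (simp add: is_root_def ops)
  then show ?thesis ..
qed

text \<open>Splitting off a root \<open>r\<close> leaves a cofactor with simple roots, and
  simplicity of \<open>r\<close> means that \<open>r\<close> is not one of them.\<close>

lemma card_simple_roots:
  fixes p :: "'a::field poly"
  assumes closed: "\<And>p :: 'a poly. Polynomial.degree p > 0 \<Longrightarrow> \<exists>x. poly p x = 0"
    and "p \<noteq> 0" "\<And>x. poly p x = 0 \<Longrightarrow> poly (pderiv p) x \<noteq> 0"
  shows "card {x. poly p x = 0} = Polynomial.degree p"
  using assms(2,3)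
proof (induction "Polynomial.degree p" arbitrary: p)
  case 0
  then obtain c where "p = [:c:]" by (metis degree_eq_zeroE)
  then show ?case using 0 by simp
next
  case (Suc d)
  then obtain r where "poly p r = 0" using closed[of p] by auto
  then obtain p' where p': "p = [:- r, 1:] * p'" by (metis poly_eq_0_iff_dvd dvdE)
  have nz: "p' \<noteq> 0" using p' Suc.prems(1) by auto
  have "Polynomial.degree p = Suc (Polynomial.degree p')"
    unfolding p' using nz by (subst degree_mult_eq) auto
  then have deg: "d = Polynomial.degree p'" using Suc.hyps(2) by simp
  have der: "poly (pderiv p) x = poly p' x + (x - r) * poly (pderiv p') x" for x
    unfolding p' pderiv_mult by (simp add: pderiv_pCons algebra_simps)
  have "card {x. poly p' x = 0} = Polynomial.degree p'"
  proof (rule Suc.hyps(1)[OF deg nz])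
    fix x assume "poly p' x = 0"
    then have "poly p x = 0" unfolding p' by simp
    then show "poly (pderiv p') x \<noteq> 0" using Suc.prems(2)[of x] der[of x] \<open>poly p' x = 0\<close> by auto
  qed
  moreover have "{x. poly p x = 0} = insert r {x. poly p' x = 0}" unfolding p' by auto
  moreover have "poly p' r \<noteq> 0" using Suc.prems(2)[OF \<open>poly p r = 0\<close>] der[of r] by simp
  moreover have "finite {x. poly p' x = 0}" using nz by (rule poly_roots_finite)
  ultimately show ?case using deg Suc.hyps(2) by simp
qed

section \<open>Additive polynomials and the trace\<close>

locale char2_closed =
  fixes a0 :: "'a::field" and n q :: nat
  assumes char2: "CHAR('a) = 2" and n1: "n \<ge> 1" and qn: "q = 2 ^ n"
    and closed: "\<And>p :: 'a poly. Polynomial.degree p > 0 \<Longrightarrow> \<exists>x. poly p x = 0"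
    and a0_q2: "a0 ^ (q ^ 2) = a0"
begin

lemma two: "(2 :: 'a) = 0"
  using of_nat_CHAR[where ?'a = 'a] char2 by simp

lemmas add_self = char2_add_self[OF char2] and add_eq_0 = char2_add_eq_0_iff[OF char2]
  and frob = char2_frobenius_add[OF char2]

lemma add_left_self: "(c :: 'a) + (c + b) = b"
  by (simp add: add.assoc[symmetric] add_self)

lemma frob_q: "((a :: 'a) + b) ^ (q ^ m) = a ^ (q ^ m) + b ^ (q ^ m)"
  using frob[of a b "n * m"] by (simp add: qn power_mult)

lemma frob_q1: "((a :: 'a) + b) ^ q = a ^ q + b ^ q"
  using frob_q[of a b 1] by simp

lemma q_ge2: "q \<ge> 2"
  using n1 self_le_power[of "2::nat" n] qn by auto

text \<open>In characteristic 2 the derivative is the nonzero constant \<open>w\<close>, so all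
  roots are simple.\<close>

lemma card_additive_roots:
  assumes m: "m \<ge> 1" and w: "w \<noteq> 0"
  shows "card {x :: 'a. x ^ (2 ^ m) + w * x + z = 0} = 2 ^ m"
proof -
  define p where "p = Polynomial.monom 1 (2 ^ m) + [:z, w:]"
  have m2: "(2 :: nat) ^ m \<ge> 2" using m self_le_power[of "2::nat" m] by auto
  have deg: "Polynomial.degree p = 2 ^ m"
    unfolding p_def using m2 by (subst degree_add_eq_left) (auto simp: degree_monom_eq)
  have "of_nat (2 ^ m) = (0 :: 'a)" using two m by (simp add: power_0_left)
  then have "pderiv p = [:w:]" unfolding p_def by (simp add: pderiv_add pderiv_monom pderiv_pCons)
  then have "card {x. poly p x = 0} = Polynomial.degree p"
    using deg m2 w by (intro card_simple_roots closed) auto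
  moreover have "poly p x = x ^ (2 ^ m) + w * x + z" for x
    unfolding p_def by (simp add: poly_monom algebra_simps)
  ultimately show ?thesis using deg by simp
qed

lemma card_q_roots: "w \<noteq> 0 \<Longrightarrow> card {x :: 'a. x ^ q + w * x + z = 0} = q"
  using card_additive_roots[OF n1, of w z] by (simp add: qn)

lemma card_q2_roots: "card {x :: 'a. x ^ (q ^ 2) + x = u} = q ^ 2"
proof -
  have "x ^ (q ^ 2) + x = u \<longleftrightarrow> x ^ (q ^ 2) + 1 * x + u = 0" for x using add_eq_0 by simp
  then show ?thesis using card_additive_roots[of "n * 2" 1 u] n1 by (simp add: qn power_mult)
qed

lemma card_fin_subfield: "m \<ge> 1 \<Longrightarrow> card (fin_subfield (q ^ m) :: 'a set) = q ^ m"
proof -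
  assume m: "m \<ge> 1"
  have "x ^ (q ^ m) = x \<longleftrightarrow> x ^ (q ^ m) + 1 * x + 0 = 0" for x :: 'a using add_eq_0 by simp
  then show ?thesis
    using card_additive_roots[of "n * m" 1 0] n1 m by (simp add: fin_subfield_def qn power_mult)
qed

text \<open>The trace from the field with \<open>q ^ 4\<close> elements to the field with
  \<open>q\<close> elements.\<close>

definition Tr :: "'a \<Rightarrow> 'a" where "Tr z = z + z ^ q + z ^ (q ^ 2) + z ^ (q ^ 3)"

definition rhs :: "'a \<Rightarrow> 'a" where "rhs a = a ^ (q + 1) + a0 * a ^ 2"

lemma pow_qs: "(z :: 'a) ^ (q ^ 2) = (z ^ q) ^ q" "(z :: 'a) ^ (q ^ 3) = ((z ^ q) ^ q) ^ q"
  "(z :: 'a) ^ (q ^ 4) = (((z ^ q) ^ q) ^ q) ^ q"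
  by (simp_all add: power_mult[symmetric] power2_eq_square power3_eq_cube power4_eq_xxxx mult.assoc)

lemma artin_schreier_power: "b ^ q + b = z \<Longrightarrow> b ^ (q ^ 4) = b + Tr z"
proof -
  assume "b ^ q + b = z"
  then have b: "b ^ q = b + z" by (metis add.commute add_left_self)
  show ?thesis unfolding pow_qs Tr_def by (simp add: b frob_q1 add_ac)
qed

text \<open>The equation has \<open>q\<close> roots in the closed field, and the
  \<open>q ^ 4\<close>-th power moves each of them by \<open>Tr z\<close>; so all or none of them
  lie in the subfield.\<close>

lemma card_fiber:
  "card {b \<in> fin_subfield (q ^ 4). b ^ q + b = z} = (if Tr z = 0 then q else 0)"
proof (cases "Tr z = 0")
  case True
  have "{b \<in> fin_subfield (q ^ 4). b ^ q + b = z} = {b. b ^ q + 1 * b + z = 0}"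
    using artin_schreier_power[of _ z] True by (auto simp: fin_subfield_def add_eq_0)
  then show ?thesis using card_q_roots[of 1 z] True by simp
next
  case False
  then have empty: "{b \<in> fin_subfield (q ^ 4). b ^ q + b = z} = {}"
    using artin_schreier_power[of _ z] by (auto simp: fin_subfield_def)
  show ?thesis unfolding empty using False by simp
qed

definition R :: "'a \<Rightarrow> 'a" where "R u = u ^ (q + 1) + a0 * u ^ 2 + a0 ^ q * u ^ (2 * q)"

lemma a0_qq: "(a0 ^ q) ^ q = a0"
  using a0_q2 by (simp add: pow_qs)

text \<open>For the conjugates of \<open>a\<close> the cyclic sum
  \<open>a * a1 + a1 * a2 + a2 * a3 + a3 * a\<close> is \<open>(a + a2) * (a1 + a3)\<close>. The
  coefficients of the squares alternate between \<open>a0\<close> and \<open>a0 ^ q\<close>, so the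
  squares pair up in the same way.\<close>

lemma Tr_rhs:
  assumes "a ^ (q ^ 4) = a"
  shows "Tr (rhs a) = R (a + a ^ (q ^ 2))"
proof -
  define a1 a2 a3 b0 where "a1 = a ^ q" and "a2 = a1 ^ q" and "a3 = a2 ^ q" and "b0 = a0 ^ q"
  have a: "a3 ^ q = a" using assms by (simp add: pow_qs a1_def a2_def a3_def)
  have b0: "b0 ^ q = a0" using a0_qq by (simp add: b0_def)
  have sq: "(z ^ 2) ^ q = (z ^ q) ^ 2" for z :: 'a by (simp add: power_mult[symmetric] mult.commute)
  have r: "rhs a = a * a1 + a0 * a ^ 2" by (simp add: rhs_def a1_def)
  have r1: "rhs a ^ q = a1 * a2 + b0 * a1 ^ 2"
    unfolding r frob_q1 power_mult_distrib sq by (simp add: a1_def a2_def b0_def)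
  have r2: "(rhs a ^ q) ^ q = a2 * a3 + a0 * a2 ^ 2"
    unfolding r1 frob_q1 power_mult_distrib sq b0 by (simp add: a2_def a3_def)
  have r3: "((rhs a ^ q) ^ q) ^ q = a3 * a + b0 * a3 ^ 2"
    unfolding r2 frob_q1 power_mult_distrib sq a by (simp add: b0_def a3_def a)
  have uq: "(a + a2) ^ q = a1 + a3" by (simp add: frob_q1 a1_def a3_def)
  have s2: "(z + z') ^ 2 = z ^ 2 + z' ^ 2" for z z' :: 'a using frob[of z z' 1] by simp
  have "R (a + a2) = (a + a2) ^ q * (a + a2) + a0 * (a + a2) ^ 2 + b0 * ((a + a2) ^ q) ^ 2"
    unfolding R_def b0_def by (simp add: power_mult[symmetric] mult.commute)
  also have "\<dots> = (a * a1 + a0 * a ^ 2) + (a1 * a2 + b0 * a1 ^ 2) + (a2 * a3 + a0 * a2 ^ 2) + (a3 * a + b0 * a3 ^ 2)"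
    unfolding uq s2 by (simp add: algebra_simps)
  also have "\<dots> = rhs a + rhs a ^ q + (rhs a ^ q) ^ q + ((rhs a ^ q) ^ q) ^ q"
    by (intro arg_cong2[where f = plus] r[symmetric] r1[symmetric] r2[symmetric] r3[symmetric])
  also have "\<dots> = Tr (rhs a)" unfolding Tr_def pow_qs ..
  finally show ?thesis by (simp add: pow_qs a2_def a1_def)
qed

section \<open>Zeros of the quadratic form\<close>

context
  assumes tr: "trace_to_F2 n (a0 ^ (q + 1)) = 1"
begin

text \<open>Repeated squaring of \<open>t ^ 2 = t + c\<close> adds up the conjugates of
  \<open>c\<close>. After \<open>n\<close> squarings this is \<open>t ^ q = t + 1\<close>, by the
  trace condition: \<open>t\<close> lies outside the field with \<open>q\<close> elements, and its
  conjugate is the other root.\<close>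

lemma root_exists:
  obtains t where "t * t + t = a0 ^ (q + 1)" "t ^ q = t + 1"
proof -
  let ?c = "a0 ^ (q + 1)"
  have "card {x :: 'a. x ^ (2 ^ 1) + 1 * x + ?c = 0} = 2 ^ 1" by (rule card_additive_roots) auto
  then have "{x :: 'a. x ^ (2 ^ 1) + 1 * x + ?c = 0} \<noteq> {}" by force
  then obtain t where "t * t + t + ?c = 0" by (auto simp: power2_eq_square)
  then have t: "t * t + t = ?c" by (simp add: add_eq_0)
  then have t2: "t ^ 2 = t + ?c" using add_left_self[of t "t * t"] by (simp add: power2_eq_square add.commute)
  have "t ^ (2 ^ m) = t + (\<Sum>i<m. ?c ^ (2 ^ i))" for m
  proof (induction m)
    case (Suc m)
    have s2: "(z + z') ^ 2 = z ^ 2 + z' ^ 2" for z z' :: 'a using frob[of z z' 1] by simp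
    have sum2: "(\<Sum>i\<in>I. g i) ^ 2 = (\<Sum>i\<in>I. g i ^ 2)" for I :: "nat set" and g :: "nat \<Rightarrow> 'a"
      by (induction I rule: infinite_finite_induct) (simp_all add: s2)
    have "t ^ (2 ^ Suc m) = (t ^ (2 ^ m)) ^ 2" by (simp add: power_mult[symmetric] mult.commute)
    also have "\<dots> = t + (?c + (\<Sum>i<m. ?c ^ (2 ^ Suc i)))"
      unfolding Suc s2 sum2 t2 by (simp add: power_mult[symmetric] mult.commute add.assoc)
    also have "?c + (\<Sum>i<m. ?c ^ (2 ^ Suc i)) = (\<Sum>i<Suc m. ?c ^ (2 ^ i))"
      by (subst sum.lessThan_Suc_shift) simp
    finally show ?case .
  qed simp
  from this[of n] have "t ^ q = t + 1" using tr by (simp add: trace_to_F2_def qn)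
  then show ?thesis using that t by blast
qed

lemma a0_nz: "a0 \<noteq> 0"
proof
  assume "a0 = 0"
  then have "trace_to_F2 n (a0 ^ (q + 1)) = 0" by (simp add: trace_to_F2_def power_0_left)
  then show False using tr by simp
qed

text \<open>In \<open>v = b0 * (u ^ q / u)\<close> the form becomes
  \<open>(v + t) * (v + (t + 1))\<close> up to a nonzero factor. Its nonzero zeros are the solutions
  of \<open>u ^ q = w * u\<close> for two values of \<open>w\<close>, with \<open>q - 1\<close>
  solutions each.\<close>

lemma card_isotropic: "card {u \<in> fin_subfield (q ^ 2). R u = 0} = 2 * q - 1"
proof -
  obtain t where t: "t * t + t = a0 ^ (q + 1)" "t ^ q = t + 1" by (rule root_exists)
  define b0 where "b0 = a0 ^ q"
  have b0: "b0 \<noteq> 0" "b0 ^ q = a0" using a0_nz a0_qq by (simp_all add: b0_def)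
  have c: "a0 ^ (q + 1) = a0 * b0" by (simp add: b0_def)
  define W where "W w = {u :: 'a. u \<noteq> 0 \<and> u ^ q = w * u}" for w
  have cardW: "finite (W w) \<and> card (W w) = q - 1" if "w \<noteq> 0" for w
  proof -
    have eq: "{x. x ^ q + w * x + 0 = 0} = insert 0 (W w)"
      using q_ge2 by (auto simp: W_def add_eq_0)
    have "card (insert 0 (W w)) = q" using card_q_roots[OF that, of 0] unfolding eq .
    moreover have "0 \<notin> W w" by (simp add: W_def)
    ultimately show ?thesis using q_ge2 by (metis card.infinite card_insert_disjoint diff_Suc_1 finite_insert not_numeral_le_zero)
  qed
  define w1 w2 where "w1 = t / b0" and "w2 = (t + 1) / b0"
  have tt: "t * (t + 1) = a0 * b0" using t(1) c by (simp add: algebra_simps)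
  then have tnz: "t \<noteq> 0" "t + 1 \<noteq> 0" using a0_nz b0 by auto
  have w: "w1 \<noteq> 0" "w2 \<noteq> 0" "w1 \<noteq> w2" using tnz b0 by (auto simp: w1_def w2_def)
  have t1q: "(t + 1) ^ q = t" unfolding frob_q1 using t(2) add_left_self[of 1 t] by (simp add: add.commute)
  \<comment> \<open>The trace condition enters here: \<open>w1 ^ q\<close> is
    \<open>(t + 1) / a0\<close>, so the product is \<open>t * (t + 1) / (a0 * b0)\<close>. Norm 1
    puts the solutions into the field with \<open>q ^ 2\<close> elements.\<close>
  have norm: "w1 ^ q * w1 = 1" "w2 ^ q * w2 = 1"
    using tt b0 a0_nz t(2) t1q by (simp_all add: w1_def w2_def power_divide field_simps)
  have fin: "u \<in> fin_subfield (q ^ 2)" if "u \<in> W w" "w ^ q * w = 1" for u w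
  proof -
    have u: "u ^ q = w * u" using that by (simp add: W_def)
    have "u ^ (q ^ 2) = w ^ q * (w * u)" unfolding pow_qs u power_mult_distrib ..
    then show ?thesis using that(2) by (simp add: fin_subfield_def mult.assoc[symmetric])
  qed
  have Riff: "R u = 0 \<longleftrightarrow> u ^ q = w1 * u \<or> u ^ q = w2 * u" if "u \<noteq> 0" for u
  proof -
    define v where "v = b0 * (u ^ q / u)"
    have uq: "u ^ q = v * u / b0" using that b0 by (simp add: v_def)
    have "R u = u ^ q * u + a0 * u ^ 2 + b0 * (u ^ q) ^ 2"
      unfolding R_def b0_def by (simp add: power_mult[symmetric] mult.commute)
    also have "\<dots> = (v * v + v + a0 * b0) * (u ^ 2 / b0)"
      unfolding uq using b0 by (simp add: field_simps power2_eq_square)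
    also have "v * v + v + a0 * b0 = (v + t) * (v + (t + 1))"
    proof -
      have "(v + t) * (v + (t + 1)) = v * v + v + t * (t + 1) + (v * t + v * t)" by (simp add: algebra_simps)
      then show ?thesis using tt add_self[of "v * t"] by simp
    qed
    finally have "R u = (v + t) * (v + (t + 1)) * (u ^ 2 / b0)" .
    then have "R u = 0 \<longleftrightarrow> v = t \<or> v = t + 1" using that b0 by (simp add: add_eq_0)
    also have "\<dots> \<longleftrightarrow> u ^ q = w1 * u \<or> u ^ q = w2 * u"
    proof -
      have "v * u / b0 = s / b0 * u \<longleftrightarrow> v = s" for s using that b0(1) by simp
      then show ?thesis unfolding w1_def w2_def uq by simp
    qed
    finally show ?thesis .
  qed
  have R0: "R 0 = 0" using q_ge2 by (simp add: R_def power_0_left)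
  have set: "{u \<in> fin_subfield (q ^ 2). R u = 0} = insert 0 (W w1 \<union> W w2)"
  proof (intro equalityI subsetI)
    fix u assume "u \<in> {u \<in> fin_subfield (q ^ 2). R u = 0}"
    then show "u \<in> insert 0 (W w1 \<union> W w2)" using Riff[of u] by (cases "u = 0") (auto simp: W_def)
  next
    fix u assume u: "u \<in> insert 0 (W w1 \<union> W w2)"
    show "u \<in> {u \<in> fin_subfield (q ^ 2). R u = 0}"
    proof (cases "u = 0")
      case True
      then show ?thesis using R0 q_ge2 by (simp add: fin_subfield_def power_0_left)
    next
      case False
      then have "u \<in> fin_subfield (q ^ 2)" using u fin norm by blast
      then show ?thesis using Riff[OF False] u False by (auto simp: W_def)
    qed
  qed
  have disj: "W w1 \<inter> W w2 = {}" using w(3) by (auto simp: W_def)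
  have "card (W w1 \<union> W w2) = (q - 1) + (q - 1)"
    using card_Un_disjoint[OF _ _ disj] cardW[OF w(1)] cardW[OF w(2)] by simp
  moreover have "0 \<notin> W w1 \<union> W w2" "finite (W w1 \<union> W w2)" using cardW w by (auto simp: W_def)
  ultimately show ?thesis unfolding set using q_ge2 by simp
qed

text \<open>Group the elements by \<open>u = a ^ (q ^ 2) + a\<close>. This \<open>u\<close> is fixed
  by the \<open>q ^ 2\<close>-th power exactly when \<open>a\<close> is fixed by the
  \<open>q ^ 4\<close>-th, and each \<open>u\<close> has \<open>q ^ 2\<close> preimages.\<close>

lemma card_Tr_zero: "card {a \<in> fin_subfield (q ^ 4). Tr (rhs a) = 0} = (2 * q - 1) * q ^ 2"
proof -
  let ?U = "{u \<in> fin_subfield (q ^ 2). R u = 0}"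
  let ?F = "\<lambda>u. {a :: 'a. a ^ (q ^ 2) + a = u}"
  have q4: "a ^ (q ^ 4) = (a ^ (q ^ 2)) ^ (q ^ 2)" for a :: 'a
    by (simp add: power_mult[symmetric] flip: power_add)
  have "{a \<in> fin_subfield (q ^ 4). Tr (rhs a) = 0} = (\<Union>u\<in>?U. ?F u)"
  proof (intro equalityI subsetI)
    fix a assume "a \<in> {a \<in> fin_subfield (q ^ 4). Tr (rhs a) = 0}"
    then have a: "a ^ (q ^ 4) = a" "Tr (rhs a) = 0" by (auto simp: fin_subfield_def)
    let ?u = "a ^ (q ^ 2) + a"
    have "?u ^ (q ^ 2) = ?u" using a(1) by (simp add: frob_q q4 add.commute)
    moreover have "R ?u = 0" using Tr_rhs[OF a(1)] a(2) by (simp add: add.commute)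
    ultimately show "a \<in> (\<Union>u\<in>?U. ?F u)" by (auto simp: fin_subfield_def)
  next
    fix a assume "a \<in> (\<Union>u\<in>?U. ?F u)"
    then have u: "(a ^ (q ^ 2) + a) ^ (q ^ 2) = a ^ (q ^ 2) + a" "R (a ^ (q ^ 2) + a) = 0"
      by (auto simp: fin_subfield_def)
    then have "a ^ (q ^ 4) + a ^ (q ^ 2) = a + a ^ (q ^ 2)" by (simp add: frob_q q4 add.commute)
    then have "a ^ (q ^ 4) = a" by simp
    then show "a \<in> {a \<in> fin_subfield (q ^ 4). Tr (rhs a) = 0}"
      using Tr_rhs u(2) by (simp add: fin_subfield_def add.commute)
  qed
  moreover have "card ?U = 2 * q - 1" by (rule card_isotropic)
  then have "finite ?U" using q_ge2 by (intro card_ge_0_finite) simp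
  moreover have "finite (?F u)" for u using card_q2_roots[of u] q_ge2 by (intro card_ge_0_finite) simp
  ultimately have "card {a \<in> fin_subfield (q ^ 4). Tr (rhs a) = 0} = (\<Sum>u\<in>?U. card (?F u))"
    by (simp only:) (intro card_UN_disjoint, auto)
  then show ?thesis using card_isotropic by (simp add: card_q2_roots)
qed

theorem card_affine_points:
  "card {(a, b). a \<in> fin_subfield (q ^ 4) \<and> b \<in> fin_subfield (q ^ 4) \<and> b ^ q + b = a ^ (q + 1) + a0 * a ^ 2} + q ^ 3 = 2 * q ^ 4"
proof -
  let ?k = "fin_subfield (q ^ 4) :: 'a set"
  have fin: "finite ?k" using card_fin_subfield[of 4] q_ge2 by (intro card_ge_0_finite) simp
  have "{(a, b). a \<in> ?k \<and> b \<in> ?k \<and> b ^ q + b = a ^ (q + 1) + a0 * a ^ 2} = (SIGMA a:?k. {b \<in> ?k. b ^ q + b = rhs a})"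
    by (auto simp: rhs_def)
  then have "card {(a, b). a \<in> ?k \<and> b \<in> ?k \<and> b ^ q + b = a ^ (q + 1) + a0 * a ^ 2} = (\<Sum>a\<in>?k. if Tr (rhs a) = 0 then q else 0)"
    using fin by (simp add: card_fiber)
  also have "\<dots> = q * card {a \<in> ?k. Tr (rhs a) = 0}" using fin by (simp add: sum.inter_filter[symmetric])
  also have "\<dots> = q * ((2 * q - 1) * q ^ 2)" by (simp add: card_Tr_zero)
  finally have "card {(a, b). a \<in> ?k \<and> b \<in> ?k \<and> b ^ q + b = a ^ (q + 1) + a0 * a ^ 2} = q * ((2 * q - 1) * q ^ 2)" .
  moreover have "q * ((2 * q - 1) * q ^ 2) + q ^ 3 = 2 * q ^ 4"
  proof -
    obtain r where "q = Suc r" using q_ge2 by (cases q) auto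
    then show ?thesis by (simp add: power2_eq_square power3_eq_cube power4_eq_xxxx algebra_simps)
  qed
  ultimately show ?thesis by simp
qed

end

text \<open>For \<open>a\<close> in the field with \<open>q ^ 2\<close> elements the right side
  \<open>z\<close> lies there too, so \<open>Tr z\<close> is twice \<open>z + z ^ q\<close>, that is
  0, and \<open>b\<close> is fixed by the \<open>q ^ 4\<close>-th power.\<close>

lemma heisenberg_subset:
  "carrier (heisenberg q a0) \<subseteq> fin_subfield (q ^ 4) \<times> fin_subfield (q ^ 4)"
proof -
  have "a \<in> fin_subfield (q ^ 4) \<and> b \<in> fin_subfield (q ^ 4)"
    if a: "a ^ (q ^ 2) = a" and b: "b ^ q + b = a ^ (q + 1) + a0 * a ^ 2" for a b
  proof -
    have q4: "z ^ (q ^ 4) = (z ^ (q ^ 2)) ^ (q ^ 2)" for z :: 'a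
      by (simp add: power_mult[symmetric] flip: power_add)
    define z where "z = a ^ (q + 1) + a0 * a ^ 2"
    have pow: "(z ^ i) ^ (q ^ 2) = (z ^ (q ^ 2)) ^ i" for z :: 'a and i by (simp add: power_mult[symmetric] mult.commute)
    have z: "z ^ (q ^ 2) = z"
      unfolding z_def frob_q power_mult_distrib pow a a0_q2 ..
    have "Tr z = 0"
      using z add_self unfolding Tr_def pow_qs by (metis add.assoc add.commute add_left_self)
    then have "b ^ (q ^ 4) = b" using artin_schreier_power[of b z] b by (simp add: z_def)
    then show ?thesis using a by (simp add: fin_subfield_def q4)
  qed
  then show ?thesis by (auto simp: heisenberg_def fin_subfield_def)
qed

end

theorem proposition6p2:
  fixes n p :: nat and a0 :: "'a::field"
  assumes "n \<ge> 1" and "p = 2 ^ n"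
    and "CHAR('a) = 2"
    and "algebraic_closure (ring_of_type_algebra :: 'a ring) (fin_subfield p)"
    and "a0 \<in> fin_subfield (p ^ 2)"
  shows "carrier (heisenberg p a0) \<subseteq> fin_subfield (p ^ 4) \<times> fin_subfield (p ^ 4) \<and>
    (trace_to_F2 n (a0 ^ (p + 1)) = 1 \<longrightarrow>
      maximal_compactification p (curve_poly p (S_poly p a0)))"
proof (intro conjI impI)
  interpret char2_closed a0 n p
    using assms algebraic_closure_has_root[OF assms(4)]
    by unfold_locales (auto simp: fin_subfield_def)
  interpret W: weighted p a0 by unfold_locales (rule q_ge2)
  show "carrier (heisenberg p a0) \<subseteq> fin_subfield (p ^ 4) \<times> fin_subfield (p ^ 4)"
    by (rule heisenberg_subset)
  assume tr: "trace_to_F2 n (a0 ^ (p + 1)) = 1"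
  define k0 where "k0 = (fin_subfield (p ^ 4) :: 'a set)"
  have k0_sub: "W.subring_set k0"
    using q_ge2 unfolding W.subring_set_def k0_def fin_subfield_def
    by (auto simp: frob_q power_mult_distrib power_0_left uminus_CHAR_2[OF char2])
  have a0: "a0 \<in> k0"
  proof -
    have "a0 ^ (p ^ 4) = (a0 ^ (p ^ 2)) ^ (p ^ 2)" by (simp add: power_mult[symmetric] flip: power_add)
    then show ?thesis using a0_q2 by (simp add: k0_def fin_subfield_def)
  qed
  \<comment> \<open>The same choice as in \<open>function_field\<close>, so that both refer to one
    point.\<close>
  define P where "P = (SOME P. generic_point k0 W.f P)"
  have "generic_point k0 W.f P"
    unfolding P_def by (rule someI_ex[OF W.generic_point_exists[OF k0_sub a0]])
  then interpret G: generic p a0 n k0 "fst P" "snd P"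
    using n1 char2 qn k0_sub a0 card_fin_subfield[of 4] q_ge2
    by unfold_locales (auto simp: k0_def fin_subfield_def power_inverse)
  have K: "function_field k0 W.f = G.C.K"
    unfolding function_field_def P_def[symmetric] Let_def G.C.K_eq_generate ..
  have "card (rational_places (const ` k0) G.C.K) = p ^ 4 + 1 + 2 * G.C.genus * p ^ 2"
  proof -
    have "card G.C.points + p ^ 3 = 2 * p ^ 4"
      using G.card_points card_affine_points[OF tr] unfolding k0_def by simp
    \<comment> \<open>As \<open>2 * genus\<close> is \<open>p * (p - 1)\<close>, the middle term is
      \<open>p ^ 4 - p ^ 3\<close>.\<close>
    moreover have "p ^ 4 + 2 * G.C.genus * p ^ 2 + p ^ 3 = 2 * p ^ 4"
    proof -
      obtain r where r: "p = Suc r" using q_ge2 by (cases p) auto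
      have "even (p * (p - 1))" by auto
      then have "2 * G.C.genus = p * (p - 1)" by simp
      then show ?thesis unfolding r by (simp add: power2_eq_square power3_eq_cube power4_eq_xxxx algebra_simps)
    qed
    ultimately show ?thesis using G.C.card_rational_places by linarith
  qed
  moreover have "has_genus (const ` k0) G.C.K G.C.genus" by (rule G.C.genus_curve)
  ultimately show "maximal_compactification p (curve_poly p (S_poly p a0))"
    unfolding maximal_compactification_def Let_def W.f_def[symmetric] k0_def[symmetric] K
    using G.f_k0 W.f_irreducible by blast
qed

end
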